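(* For every $q\in(0,1)$ there exists a constant $\mathrm{gr}_q$ with $0<\mathrm{gr}_q<\infty$ such that $$\frac{\log \#\mathrm{StabMatch}(\mathrm{MalPref}_{q,n})}{n}\longrightarrow \mathrm{gr}_q\quad\text{in distribution as } n\to\infty .$$ Furthermore, $q\mapsto \mathrm{gr}_q$ is a continuous function on $(0,1)$ and $\mathrm{gr}_q\to 0$ as $q\to 0$.
   Context: Let $[n]=\{1,\dots,n\}$, let $\Omega_n=[n]\times\{\mathsf m,\mathsf f\}$ ($\mathsf m$ = man, $\mathsf f$ = woman), and let $S_n$ be the set of permutations of $[n]$. A preference structure on $\Omega_n$ is a map $\mathcal P:\Omega_n\to S_n$. Woman $(i,\mathsf f)$ prefers man $(j,\mathsf m)$ to man $(k,\mathsf m)$ if $\mathcal P((i,\mathsf f))(j)>\mathcal P((i,\mathsf f))(k)$; man $(i,\mathsf m)$ prefers woman $(j,\mathsf f)$ to woman $(k,\mathsf f)$ if $\mathcal P((i,\mathsf m))(j)>\mathcal P((i,\mathsf m))(k)$. A match is an unordered pair $\{(i,\mathsf m),(j,\mathsf f)\}$ with $i,j\in[n]$; its two elements are each other's partners. A matching of $\Omega_n$ is a set of matches in which every element of $\Omega_n$ appears in exactly one match. A matching is stable with respect to $\mathcal P$ if there do not exist $i,j$ such that $(i,\mathsf m)$ and $(j,\mathsf f)$ each prefer the other to their partner in the matching. $\mathrm{StabMatch}(\mathcal P)$ is the set of matchings that are stable with respect to $\mathcal P$. For $\pi\in S_n$ let $\mathrm{inv}(\pi)=\#\{1\le i<j\le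 n:\pi(i)>\pi(j)\}$. For $q\in(0,1)$, the Mallows measure $\mathrm{Mal}_{q,n}$ is the probability measure on $S_n$ assigning to each $\pi$ a probability proportional to $q^{\mathrm{inv}(\pi)}$. $\mathrm{MalPref}_{q,n}$ is the random preference structure on $\Omega_n$ assigning independent $\mathrm{Mal}_{q,n}$-distributed permutations to all elements of $\Omega_n$. *)

theory Defs
  imports "HOL-Probability.Probability" "HOL-Combinatorics.Permutations"
begin

datatype gender = Man | Woman

type_synonym person = "nat \<times> gender"

definition Omega :: "nat \<Rightarrow> person set" where
  "Omega n = {1..n} \<times> UNIV"

definition perms :: "nat \<Rightarrow> (nat \<Rightarrow> nat) set" where
  "perms n = {\<pi>. \<pi> permutes {1..n}}"

text \<open>
  A preference structure assigns to each person a permutation of \<open>{1..n}\<close>; larger values mean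
  stronger preference. Only its values on \<open>Omega n\<close> matter.
\<close>

type_synonym pref = "person \<Rightarrow> nat \<Rightarrow> nat"

definition prefers :: "pref \<Rightarrow> person \<Rightarrow> person \<Rightarrow> person \<Rightarrow> bool" where
  "prefers P x y z \<longleftrightarrow>
     snd y \<noteq> snd x \<and> snd z \<noteq> snd x \<and> P x (fst y) > P x (fst z)"

definition matches :: "nat \<Rightarrow> person set set" where
  "matches n = {{(i, Man), (j, Woman)} | i j. i \<in> {1..n} \<and> j \<in> {1..n}}"

definition matchings :: "nat \<Rightarrow> person set set set" where
  "matchings n = {M. M \<subseteq> matches n \<and> (\<forall>x\<in>Omega n. \<exists>!e. e \<in> M \<and> x \<in> e)}"

definition partner :: "person set set \<Rightarrow> person \<Rightarrow> person" where
  "partner M x = (THE y. {x, y} \<in> M)"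

definition stable :: "nat \<Rightarrow> pref \<Rightarrow> person set set \<Rightarrow> bool" where
  "stable n P M \<longleftrightarrow>
     \<not> (\<exists>i\<in>{1..n}. \<exists>j\<in>{1..n}.
          prefers P (i, Man) (j, Woman) (partner M (i, Man)) \<and>
          prefers P (j, Woman) (i, Man) (partner M (j, Woman)))"

definition StabMatch :: "nat \<Rightarrow> pref \<Rightarrow> person set set set" where
  "StabMatch n P = {M \<in> matchings n. stable n P M}"

definition inv_count :: "nat \<Rightarrow> (nat \<Rightarrow> nat) \<Rightarrow> nat" where
  "inv_count n \<pi> = card {(i, j). 1 \<le> i \<and> i < j \<and> j \<le> n \<and> \<pi> i > \<pi> j}"

text \<open>
  The Mallows measure. \<^const>\<open>embed_pmf\<close> is only meaningful for a mass function of total mass 1;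
  the lemma \<open>pmf_Mal\<close> below shows that this is the case for positive \<open>q\<close>.
\<close>

definition Mal :: "real \<Rightarrow> nat \<Rightarrow> (nat \<Rightarrow> nat) pmf" where
  "Mal q n = embed_pmf (\<lambda>\<pi>. if \<pi> \<in> perms n
     then q ^ inv_count n \<pi> / (\<Sum>\<sigma>\<in>perms n. q ^ inv_count n \<sigma>) else 0)"

text \<open>Independent Mallows permutations for all persons; \<open>id\<close> is the dummy value off \<open>Omega n\<close>.\<close>

definition MalPref :: "real \<Rightarrow> nat \<Rightarrow> pref pmf" where
  "MalPref q n = Pi_pmf (Omega n) id (\<lambda>_. Mal q n)"

lemma finite_perms [simp]: "finite (perms n)"
  unfolding perms_def by (simp add: finite_permutations)

lemma id_in_perms [simp]: "id \<in> perms n"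
  unfolding perms_def by (simp add: permutes_id)

lemma finite_Omega [simp]: "finite (Omega n)"
proof -
  have "(UNIV :: gender set) \<subseteq> {Man, Woman}"
    by (auto intro: gender.exhaust)
  then have "finite (UNIV :: gender set)"
    by (rule finite_subset) simp
  then show ?thesis
    unfolding Omega_def by simp
qed

lemma Mal_normaliser_pos:
  assumes "0 < q"
  shows "0 < (\<Sum>\<sigma>\<in>perms n. (q :: real) ^ inv_count n \<sigma>)"
proof (rule sum_pos)
  show "perms n \<noteq> {}"
    using id_in_perms by blast
qed (use assms in simp_all)

lemma pmf_Mal:
  assumes "0 < q"
  shows "pmf (Mal q n) \<pi> = (if \<pi> \<in> perms n
     then q ^ inv_count n \<pi> / (\<Sum>\<sigma>\<in>perms n. q ^ inv_count n \<sigma>) else 0)"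
proof -
  define Z where "Z = (\<Sum>\<sigma>\<in>perms n. q ^ inv_count n \<sigma>)"
  have Z: "Z > 0"
    unfolding Z_def using Mal_normaliser_pos[OF assms] .
  let ?f = "\<lambda>\<pi>. if \<pi> \<in> perms n then q ^ inv_count n \<pi> / Z else 0"
  have nonneg: "?f \<pi> \<ge> 0" for \<pi>
    using assms Z by simp
  have "(\<integral>\<^sup>+\<pi>. ennreal (?f \<pi>) \<partial>count_space UNIV) = (\<Sum>\<pi>\<in>perms n. ennreal (?f \<pi>))"
    by (intro nn_integral_count_space') auto
  also have "\<dots> = ennreal (\<Sum>\<pi>\<in>perms n. ?f \<pi>)"
    using nonneg by (intro sum_ennreal)
  also have "(\<Sum>\<pi>\<in>perms n. ?f \<pi>) = (\<Sum>\<pi>\<in>perms n. q ^ inv_count n \<pi>) / Z"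
    by (simp add: sum_divide_distrib)
  also have "\<dots> = 1"
    using Z unfolding Z_def by simp
  finally have "(\<integral>\<^sup>+\<pi>. ennreal (?f \<pi>) \<partial>count_space UNIV) = 1"
    by simp
  from pmf_embed_pmf[OF nonneg this] show ?thesis
    unfolding Mal_def Z_def .
qed

lemma partner_eqI:
  assumes "M \<in> matchings n" "{x, y} \<in> M"
  shows "partner M x = y"
  unfolding partner_def
proof (rule the_equality)
  fix z assume z: "{x, z} \<in> M"
  have M: "M \<subseteq> matches n"
    using assms(1) by (simp add: matchings_def)
  then obtain i j where ij: "{x, y} = {(i, Man), (j, Woman)}" "i \<in> {1..n}" "j \<in> {1..n}"
    using assms(2) unfolding matches_def by blast
  then have "x \<in> Omega n"
    unfolding Omega_def by (auto simp: doubleton_eq_iff)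
  then have "\<exists>!e. e \<in> M \<and> x \<in> e"
    using assms(1) by (simp add: matchings_def)
  with z assms(2) have "{x, z} = {x, y}"
    by blast
  then show "z = y"
    by (auto simp: doubleton_eq_iff)
qed (fact assms(2))

end

theory Submission
  imports Defs "HOL-Real_Asymp.Real_Asymp"
begin

text \<open>
  A Mallows permutation is close to the identity. So everybody roughly prefers people of higher
  index, stable matchings pair people of nearly the same index, and the number of stable
  matchings nearly factorises over disjoint intervals of indices. Its logarithm therefore obeys a
  law of large numbers.

  In detail, let \<open>log_stab a b\<close> be the logarithm of the number of stable matchings of the people
  with index in \<open>{a<..b}\<close> among themselves. If in each stable matching of \<open>{c<..b}\<close> everybody
  prefers their partner to everybody not above \<open>c\<close>, then the stable matchings of \<open>{a<..b}\<close> are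
  exactly the unions of a stable matching of \<open>{a<..c}\<close> and one of \<open>{c<..b}\<close> (\<open>card_stab_union\<close>), so
  \<open>log_stab\<close> is additive at \<open>c\<close>. A condition \<open>calm_above\<close> on the individual preferences of the
  persons above \<open>c\<close> guarantees this for all \<open>b\<close> simultaneously (\<open>calm_above_cut\<close>). It asks less of
  a person the further that person is from \<open>c\<close>, and is violated at height \<open>l\<close> only with a
  probability exponentially small in \<open>l\<close> (\<open>prob_not_calm\<close>). As the persons are independent, a level
  is calm with a probability bounded below (\<open>Pr_calm_above\<close>). Searching upwards for a calm level,
  one may start afresh beyond the first person who violates the condition; so the distance to
  the next calm level has an exponential tail (\<open>Pr_no_calm_cut\<close>).

  Consequently the failure of additivity at an arbitrary level has a bounded mean
  (\<open>E_defect\<close>). Cutting \<open>{0<..n}\<close> into blocks of length \<open>L\<close> changes \<open>log_stab 0 n\<close> by \<open>O(n / L)\<close> in mean,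
  and the blocks are independent and identically distributed, because the pattern of a Mallows
  permutation on a window is again a Mallows permutation (\<open>map_pattern_Mal\<close>). Letting first \<open>n\<close>
  and then \<open>L\<close> tend to infinity gives convergence in mean of \<open>log_stab 0 n / n\<close> to a constant, with
  an error \<open>K / L\<close> for the mean at size \<open>L\<close> (\<open>growth_limits\<close>). All estimates are uniform for \<open>q\<close> in
  \<open>{0<..q1}\<close> when \<open>q1 < 1\<close>; hence continuity in \<open>q\<close>, and the limit for \<open>q\<close> tending to \<open>0\<close>, are
  inherited from the means at finite size. The limit is positive since a local configuration with
  two stable matchings appears directly below a calm level with positive density (\<open>growth_pos\<close>).
\<close>

section \<open>Stable matchings as permutations\<close>

text \<open>
  Man \<open>i\<close> is matched with woman \<open>\<sigma> i\<close>; \<open>p\<close> and \<open>q\<close> are the preferences of the men and of the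
  women. Running through the women in the form \<open>\<sigma> k\<close> makes \<open>k\<close> the partner of the second member of
  a would-be blocking pair, so that no inverse of \<open>\<sigma>\<close> is needed.
\<close>

definition stab :: "'a set \<Rightarrow> ('a \<Rightarrow> 'a \<Rightarrow> nat) \<Rightarrow> ('a \<Rightarrow> 'a \<Rightarrow> nat) \<Rightarrow> ('a \<Rightarrow> 'a) set" where
  "stab U p q = {\<sigma>. \<sigma> permutes U \<and>
     (\<forall>i\<in>U. \<forall>k\<in>U. \<not> (p i (\<sigma> i) < p i (\<sigma> k) \<and> q (\<sigma> k) k < q (\<sigma> k) i))}"

lemma stabD:
  assumes "\<sigma> \<in> stab U p q" "i \<in> U" "k \<in> U" "p i (\<sigma> i) < p i (\<sigma> k)"
  shows "\<not> q (\<sigma> k) k < q (\<sigma> k) i"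
  using assms unfolding stab_def by blast

lemma stab_permutes: "\<sigma> \<in> stab U p q \<Longrightarrow> \<sigma> permutes U"
  by (simp add: stab_def)

lemma finite_stab: "finite U \<Longrightarrow> finite (stab U p q)"
  by (rule finite_subset[OF _ finite_permutations[of U]]) (auto simp: stab_def)

lemma card_stab_le_fact: "finite U \<Longrightarrow> card (stab U p q) \<le> fact (card U)"
proof -
  assume U: "finite U"
  have "card (stab U p q) \<le> card {\<sigma>. \<sigma> permutes U}"
    by (rule card_mono) (auto simp: stab_def finite_permutations U)
  then show ?thesis using card_permutations[OF refl U] by simp
qed

lemma stab_swap:
  assumes "\<sigma> \<in> stab U p q"
  shows "inv \<sigma> \<in> stab U q p"
proof -
  have s: "\<sigma> permutes U" using assms by (simp add: stab_def)
  have "\<not> (q i (inv \<sigma> i) < q i (inv \<sigma> k) \<and> p (inv \<sigma> k) k < p (inv \<sigma> k) i)"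
    if "i \<in> U" "k \<in> U" for i k
  proof -
    have "inv \<sigma> i \<in> U" "inv \<sigma> k \<in> U"
      using that permutes_in_image[OF permutes_inv[OF s]] by auto
    then show ?thesis
      using stabD[OF assms, of "inv \<sigma> k" "inv \<sigma> i"] permutes_inverses[OF s] by auto
  qed
  then show ?thesis using permutes_inv[OF s] by (auto simp: stab_def)
qed

text \<open>
  The theorem of Gale and Shapley. Instead of running the proposal algorithm, take a maximal set
  \<open>R\<close> of rejections \<open>(i, j)\<close> of man \<open>i\<close> by woman \<open>j\<close> in which each rejection is justified: \<open>j\<close>
  prefers to \<open>i\<close> a man whose favourite among those not rejecting him is \<open>j\<close>. If two men had the
  same favourite, the one whom she likes less could be added to \<open>R\<close>; hence by maximality the
  favourites form a matching, and a blocking pair would be a rejection, which is justified.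
\<close>

lemma stab_nonempty:
  fixes p q :: "'a \<Rightarrow> 'a \<Rightarrow> nat"
  assumes fin: "finite U"
    and p: "\<And>i. i \<in> U \<Longrightarrow> inj_on (p i) U" and q: "\<And>j. j \<in> U \<Longrightarrow> inj_on (q j) U"
  shows "stab U p q \<noteq> {}"
proof -
  define top where "top R i j \<longleftrightarrow> i \<in> U \<and> j \<in> U \<and> (i, j) \<notin> R \<and> (\<forall>j'\<in>U. (i, j') \<notin> R \<longrightarrow> p i j' \<le> p i j)"
    for R and i j :: 'a
  define just where "just R \<longleftrightarrow> R \<subseteq> U \<times> U \<and> (\<forall>i j. (i, j) \<in> R \<longrightarrow> (\<exists>i'. top R i' j \<and> q j i < q j i'))"
    for R
  have "finite {R. just R}"
    by (rule finite_subset[of _ "Pow (U \<times> U)"]) (auto simp: just_def fin)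
  moreover have "just {}" by (simp add: just_def)
  ultimately obtain R where R: "just R" and max: "\<And>R'. just R' \<Longrightarrow> R \<subseteq> R' \<Longrightarrow> R = R'"
    using finite_has_maximal[of "{R. just R}"] by blast
  have uniq: "j = j'" if "top R i j" "top R i j'" for i j j'
    using that p[of i] unfolding top_def inj_on_def by (meson le_antisym)
  have no_clash: False if t: "top R i j" "top R i' j" and lt: "q j i < q j i'" for i i' j
  proof -
    let ?R = "insert (i, j) R"
    have ne: "i' \<noteq> i" using lt by auto
    have keep: "top ?R k l" if "top R k l" "k \<noteq> i" for k l
      using that by (auto simp: top_def)
    have "just ?R"
      unfolding just_def
    proof (intro conjI allI impI)
      show "?R \<subseteq> U \<times> U" using R t by (auto simp: just_def top_def)
      fix k l assume "(k, l) \<in> ?R"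
      then consider "k = i" "l = j" | "(k, l) \<in> R" by auto
      then show "\<exists>i'. top ?R i' l \<and> q l k < q l i'"
      proof cases
        case 1
        then show ?thesis using keep[OF t(2) ne] lt by auto
      next
        case 2
        then obtain m where m: "top R m l" "q l k < q l m" using R unfolding just_def by blast
        show ?thesis
        proof (cases "m = i")
          case True
          then have "l = j" using m(1) t(1) uniq by auto
          then show ?thesis using m(2) True keep[OF t(2) ne] lt by (meson less_trans)
        qed (use m keep in blast)
      qed
    qed
    from max[OF this] have "(i, j) \<in> R" by auto
    then show False using t by (simp add: top_def)
  qed
  have inj: "i = i'" if "top R i j" "top R i' j" for i i' j
  proof -
    have "j \<in> U" "i \<in> U" "i' \<in> U" using that by (auto simp: top_def)
    then show ?thesis
      using no_clash[OF that] no_clash[OF that(2,1)] q[of j] unfolding inj_on_def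
      by (meson linorder_neqE_nat)
  qed
  have ex: "\<exists>j. top R i j" if i: "i \<in> U" for i
  proof (cases "\<exists>j\<in>U. (i, j) \<notin> R")
    case True
    let ?F = "{j\<in>U. (i, j) \<notin> R}"
    have "finite ?F" "?F \<noteq> {}" using fin True by auto
    then have "Max (p i ` ?F) \<in> p i ` ?F" by (intro Max_in) auto
    then obtain j where "j \<in> ?F" "p i j = Max (p i ` ?F)" by auto
    then have "top R i j" using fin i by (auto simp: top_def)
    then show ?thesis ..
  next
    \<comment> \<open>If every woman had rejected \<open>i\<close>, all of them would hold proposals of the other men.\<close>
    case False
    then have "\<forall>j\<in>U. \<exists>i'. top R i' j" using R unfolding just_def by blast
    then obtain f where f: "\<And>j. j \<in> U \<Longrightarrow> top R (f j) j" by metis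
    have "inj_on f U" using f uniq by (auto simp: inj_on_def) metis
    moreover have "f ` U \<subseteq> U - {i}" using f False by (auto simp: top_def)
    ultimately have "card U \<le> card (U - {i})" using fin by (intro card_inj_on_le) auto
    then show ?thesis using i fin card_Diff1_less[of U i] by linarith
  qed
  then obtain g where g: "\<And>i. i \<in> U \<Longrightarrow> top R i (g i)" by metis
  define \<sigma> where "\<sigma> i = (if i \<in> U then g i else i)" for i
  have "inj_on g U" using g inj by (auto simp: inj_on_def) metis
  moreover have "g ` U \<subseteq> U" using g by (auto simp: top_def)
  ultimately have "bij_betw g U U"
    using fin by (simp add: bij_betw_def endo_inj_surj)
  then have "bij_betw \<sigma> U U" by (rule bij_betw_cong[THEN iffD1, rotated]) (simp add: \<sigma>_def)
  then have perm: "\<sigma> permutes U" by (rule bij_imp_permutes) (simp add: \<sigma>_def)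
  have "\<not> (p i (\<sigma> i) < p i (\<sigma> k) \<and> q (\<sigma> k) k < q (\<sigma> k) i)" if "i \<in> U" "k \<in> U" for i k
  proof
    assume b: "p i (\<sigma> i) < p i (\<sigma> k) \<and> q (\<sigma> k) k < q (\<sigma> k) i"
    have t: "top R i (\<sigma> i)" "top R k (\<sigma> k)" using g that by (auto simp: \<sigma>_def)
    then have "(i, \<sigma> k) \<in> R" using b unfolding top_def by (meson linorder_not_le)
    then obtain m where "top R m (\<sigma> k)" "q (\<sigma> k) i < q (\<sigma> k) m" using R unfolding just_def by blast
    moreover have "k = m" using inj t(2) calculation(1) .
    ultimately show False using b by simp
  qed
  with perm show ?thesis by (auto simp: stab_def)
qed

section \<open>Factorisation across a dominated set\<close>

text \<open>
  Whatever stable matching \<open>U\<close> settles on, its members have no reason to look at \<open>D\<close>, however much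
  those in \<open>D\<close> would like them as partners.
\<close>

definition dominates :: "'a set \<Rightarrow> 'a set \<Rightarrow> ('a \<Rightarrow> 'a \<Rightarrow> nat) \<Rightarrow> ('a \<Rightarrow> 'a \<Rightarrow> nat) \<Rightarrow> bool" where
  "dominates U D p q \<longleftrightarrow> (\<forall>\<sigma>\<in>stab U p q. \<forall>k\<in>U. \<forall>j\<in>D. p k j < p k (\<sigma> k) \<and> q (\<sigma> k) j < q (\<sigma> k) k)"

text \<open>
  A blocking pair of the union would have one member in \<open>U\<close> and one in \<open>D\<close>, and the member in
  \<open>U\<close> has no interest in it.
\<close>

lemma stab_union:
  assumes d: "dominates U D p q" and dis: "U \<inter> D = {}"
    and \<delta>: "\<delta> \<in> stab D p q" and \<upsilon>: "\<upsilon> \<in> stab U p q"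
  shows "\<delta> \<circ> \<upsilon> \<in> stab (D \<union> U) p q" "\<And>x. x \<in> U \<Longrightarrow> (\<delta> \<circ> \<upsilon>) x = \<upsilon> x" "\<And>x. x \<in> D \<Longrightarrow> (\<delta> \<circ> \<upsilon>) x = \<delta> x"
proof -
  have per: "\<delta> permutes D" "\<upsilon> permutes U" using \<delta> \<upsilon> by (auto simp: stab_def)
  have "\<upsilon> x \<in> U" if "x \<in> U" for x using permutes_in_image[OF per(2)] that by auto
  then show onU: "(\<delta> \<circ> \<upsilon>) x = \<upsilon> x" if "x \<in> U" for x
    using that dis per by (auto simp: permutes_def)
  show onD: "(\<delta> \<circ> \<upsilon>) x = \<delta> x" if "x \<in> D" for x
    using that dis per by (auto simp: permutes_def)
  have "\<delta> \<circ> \<upsilon> permutes D \<union> U"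
    by (rule permutes_compose) (auto intro: permutes_subset per)
  moreover have "\<not> (p i ((\<delta> \<circ> \<upsilon>) i) < p i ((\<delta> \<circ> \<upsilon>) k)
      \<and> q ((\<delta> \<circ> \<upsilon>) k) k < q ((\<delta> \<circ> \<upsilon>) k) i)" if i: "i \<in> D \<union> U" and k: "k \<in> D \<union> U" for i k
  proof -
    consider "i \<in> U" "k \<in> U" | "i \<in> U" "k \<in> D" | "i \<in> D" "k \<in> U" | "i \<in> D" "k \<in> D" using i k by auto
    then show ?thesis
    proof cases
      case 1 then show ?thesis using \<upsilon> onU by (auto simp: stab_def)
    next
      case 2
      then have "\<delta> k \<in> D" using permutes_in_image[OF per(1)] by auto
      then have "p i (\<delta> k) < p i (\<upsilon> i)" using d \<upsilon> 2 by (auto simp: dominates_def)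
      then show ?thesis using onU[OF 2(1)] onD[OF 2(2)] by auto
    next
      case 3
      then have "q (\<upsilon> k) i < q (\<upsilon> k) k" using d \<upsilon> by (auto simp: dominates_def)
      then show ?thesis using onU[OF 3(2)] by auto
    next
      case 4 then show ?thesis using \<delta> onD by (auto simp: stab_def)
    qed
  qed
  ultimately show "\<delta> \<circ> \<upsilon> \<in> stab (D \<union> U) p q" by (auto simp: stab_def)
qed

text \<open>
  Compare a stable matching \<open>\<nu>\<close> with a union \<open>\<mu>\<close> of stable matchings of \<open>D\<close> and \<open>U\<close>. Start with
  a man of \<open>U\<close> who prefers \<open>\<mu>\<close>, go to his partner in \<open>\<mu>\<close>, and on to her partner in \<open>\<nu>\<close>. Stability
  of both matchings makes preferences alternate along this walk: she prefers \<open>\<nu>\<close>, which keeps the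
  walk inside \<open>U\<close> by domination, and the next man prefers \<open>\<mu>\<close> again. The walk is a permutation
  of the finite set of these men, so it also enters the starting man: his partner in \<open>\<nu>\<close> lies in
  \<open>U\<close>. A man of \<open>U\<close> with a partner in \<open>D\<close> would be such a starting man.
\<close>

lemma stab_respects_domination:
  assumes d: "dominates U D p q" and dis: "U \<inter> D = {}" and fin: "finite U" "finite D"
    and p: "\<And>i. inj_on (p i) (D \<union> U)" and q: "\<And>j. inj_on (q j) (D \<union> U)"
    and \<nu>: "\<nu> \<in> stab (D \<union> U) p q"
  shows "\<nu> ` U = U"
proof -
  obtain \<delta> \<upsilon> where \<delta>: "\<delta> \<in> stab D p q" and \<upsilon>: "\<upsilon> \<in> stab U p q"
    using stab_nonempty[OF fin(1), of p q] stab_nonempty[OF fin(2), of p q] p q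
    by (metis ex_in_conv inj_on_subset sup_ge1 sup_ge2)
  define \<mu> where "\<mu> = \<delta> \<circ> \<upsilon>"
  note su = stab_union[OF d dis \<delta> \<upsilon>, folded \<mu>_def]
  have per: "\<nu> permutes D \<union> U" "\<upsilon> permutes U" using \<nu> \<upsilon> by (auto simp: stab_def)
  define Z where "Z = {i \<in> U. p i (\<nu> i) < p i (\<mu> i)}"
  \<comment> \<open>One round of the walk, from a man to the next man.\<close>
  define \<tau> where "\<tau> = inv \<nu> \<circ> \<mu>"
  have \<nu>\<tau>: "\<nu> (\<tau> i) = \<mu> i" for i
    unfolding \<tau>_def using permutes_inverses[OF per(1)] by simp
  have "\<tau> i \<in> Z" if i: "i \<in> Z" for i
  proof -
    have iU: "i \<in> U" and pi: "p i (\<nu> i) < p i (\<mu> i)" using i by (auto simp: Z_def)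
    let ?k = "\<tau> i"
    have mu: "\<mu> i \<in> U" using su(2)[OF iU] permutes_in_image[OF per(2)] iU by auto
    have k: "?k \<in> D \<union> U" using permutes_in_image[OF per(1), of ?k] \<nu>\<tau>[of i] mu by auto
    have ne: "?k \<noteq> i" using pi \<nu>\<tau>[of i] by auto
    have "\<not> q (\<mu> i) ?k < q (\<mu> i) i"
      using stabD[OF \<nu>, of i ?k] iU k pi \<nu>\<tau>[of i] by auto
    moreover have "q (\<mu> i) ?k \<noteq> q (\<mu> i) i"
      using q[of "\<mu> i"] ne k iU by (auto simp: inj_on_def)
    ultimately have qk: "q (\<mu> i) i < q (\<mu> i) ?k" by linarith
    have kU: "?k \<in> U"
    proof (rule ccontr)
      assume "?k \<notin> U"
      then have "q (\<upsilon> i) ?k < q (\<upsilon> i) i" using k d \<upsilon> iU by (auto simp: dominates_def)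
      then show False using qk su(2)[OF iU] by auto
    qed
    have "\<not> p ?k (\<mu> ?k) < p ?k (\<mu> i)"
      using su(1) kU iU qk unfolding stab_def by blast
    moreover have "\<mu> ?k \<noteq> \<mu> i"
      using su(1) ne by (auto simp: stab_def dest: permutes_inj injD)
    moreover have "\<mu> ?k \<in> U" using su(2)[OF kU] permutes_in_image[OF per(2)] kU by auto
    ultimately have "p ?k (\<mu> i) < p ?k (\<mu> ?k)"
      using p[of ?k] mu unfolding inj_on_def by (metis UnI2 linorder_neqE_nat)
    then show ?thesis using kU \<nu>\<tau>[of i] by (simp add: Z_def)
  qed
  then have "\<tau> ` Z \<subseteq> Z" by auto
  moreover have "inj \<tau>"
    unfolding \<tau>_def using su(1) permutes_inv[OF per(1)]
    by (intro inj_compose) (auto simp: stab_def dest: permutes_inj)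
  ultimately have \<tau>Z: "\<tau> ` Z = Z"
    using fin(1) by (intro endo_inj_surj) (auto simp: Z_def intro: inj_on_subset)
  have sub: "\<nu> i \<in> U" if iU: "i \<in> U" for i
  proof (rule ccontr)
    assume n: "\<nu> i \<notin> U"
    then have "\<nu> i \<in> D" using permutes_in_image[OF per(1), of i] iU by auto
    then have "p i (\<nu> i) < p i (\<mu> i)"
      using d \<upsilon> iU su(2)[OF iU] by (auto simp: dominates_def)
    then have "i \<in> \<tau> ` Z" using iU \<tau>Z by (simp add: Z_def)
    then obtain m where "m \<in> Z" "i = \<tau> m" by auto
    then have "\<nu> i = \<mu> m" "m \<in> U" using \<nu>\<tau> by (auto simp: Z_def)
    then show False using n su(2)[of m] permutes_in_image[OF per(2), of m] by auto
  qed
  then show ?thesis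
    using fin(1) permutes_inj[OF per(1)] by (intro endo_inj_surj) (auto intro: inj_on_subset)
qed

lemma stab_restrict:
  assumes "\<nu> \<in> stab V p q" "\<nu> ` W = W" "W \<subseteq> V"
  shows "(\<lambda>x. if x \<in> W then \<nu> x else x) \<in> stab W p q"
proof -
  have inj: "inj \<nu>" using assms by (auto simp: stab_def dest: permutes_inj)
  let ?f = "\<lambda>x. if x \<in> W then \<nu> x else x"
  have "bij_betw \<nu> W W" using assms inj by (auto simp: bij_betw_def intro: inj_on_subset)
  then have "bij_betw ?f W W" by (rule bij_betw_cong[THEN iffD1, rotated]) simp
  then have "?f permutes W" by (rule bij_imp_permutes) simp
  moreover have "\<not> (p i (?f i) < p i (?f k) \<and> q (?f k) k < q (?f k) i)" if "i \<in> W" "k \<in> W" for i k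
    using stabD[OF assms(1), of i k] that assms(3) by auto
  ultimately show ?thesis unfolding stab_def by blast
qed

theorem card_stab_union:
  assumes d: "dominates U D p q" and dis: "U \<inter> D = {}" and fin: "finite U" "finite D"
    and p: "\<And>i. inj_on (p i) (D \<union> U)" and q: "\<And>j. inj_on (q j) (D \<union> U)"
  shows "card (stab (D \<union> U) p q) = card (stab D p q) * card (stab U p q)"
proof -
  have "bij_betw (\<lambda>(\<delta>, \<upsilon>). \<delta> \<circ> \<upsilon>) (stab D p q \<times> stab U p q) (stab (D \<union> U) p q)"
  proof (rule bij_betwI')
    fix x y assume x: "x \<in> stab D p q \<times> stab U p q" and y: "y \<in> stab D p q \<times> stab U p q"
    obtain \<delta> \<upsilon> \<delta>' \<upsilon>' where xy: "x = (\<delta>, \<upsilon>)" "y = (\<delta>', \<upsilon>')" by (metis surj_pair)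
    have m: "\<delta> \<in> stab D p q" "\<upsilon> \<in> stab U p q" "\<delta>' \<in> stab D p q" "\<upsilon>' \<in> stab U p q"
      using x y xy by auto
    have per: "\<delta> permutes D" "\<upsilon> permutes U" "\<delta>' permutes D" "\<upsilon>' permutes U"
      using m by (auto simp: stab_def)
    note su = stab_union[OF d dis m(1,2)] and su' = stab_union[OF d dis m(3,4)]
    have "\<delta> = \<delta>' \<and> \<upsilon> = \<upsilon>'" if e: "\<delta> \<circ> \<upsilon> = \<delta>' \<circ> \<upsilon>'"
    proof (intro conjI ext)
      fix t
      show "\<delta> t = \<delta>' t" using su(3)[of t] su'(3)[of t] e per by (cases "t \<in> D") (auto simp: permutes_def)
      show "\<upsilon> t = \<upsilon>' t" using su(2)[of t] su'(2)[of t] e per by (cases "t \<in> U") (auto simp: permutes_def)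
    qed
    then show "((case x of (\<delta>, \<upsilon>) \<Rightarrow> \<delta> \<circ> \<upsilon>) = (case y of (\<delta>, \<upsilon>) \<Rightarrow> \<delta> \<circ> \<upsilon>)) = (x = y)"
      using xy by auto
  next
    fix x assume "x \<in> stab D p q \<times> stab U p q"
    then show "(case x of (\<delta>, \<upsilon>) \<Rightarrow> \<delta> \<circ> \<upsilon>) \<in> stab (D \<union> U) p q"
      using stab_union(1)[OF d dis] by auto
  next
    fix \<nu> assume \<nu>: "\<nu> \<in> stab (D \<union> U) p q"
    have U: "\<nu> ` U = U" by (rule stab_respects_domination[OF d dis fin p q \<nu>])
    have per: "\<nu> permutes D \<union> U" using \<nu> by (simp add: stab_def)
    have "\<nu> ` (D \<union> U) = D \<union> U" using per by (rule permutes_image)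
    then have "\<nu> ` ((D \<union> U) - U) = (D \<union> U) - U"
      using U permutes_inj[OF per] by (metis image_set_diff)
    moreover have "(D \<union> U) - U = D" using dis by blast
    ultimately have D: "\<nu> ` D = D" by simp
    let ?\<delta> = "\<lambda>x. if x \<in> D then \<nu> x else x" and ?\<upsilon> = "\<lambda>x. if x \<in> U then \<nu> x else x"
    have "?\<delta> \<in> stab D p q" "?\<upsilon> \<in> stab U p q"
      using stab_restrict[OF \<nu>] U D by auto
    moreover have "\<nu> = ?\<delta> \<circ> ?\<upsilon>"
    proof
      fix t
      show "\<nu> t = (?\<delta> \<circ> ?\<upsilon>) t"
        using U dis per by (auto simp: permutes_def)
    qed
    ultimately show "\<exists>x\<in>stab D p q \<times> stab U p q. \<nu> = (case x of (\<delta>, \<upsilon>) \<Rightarrow> \<delta> \<circ> \<upsilon>)" by auto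
  qed
  then have "card (stab D p q \<times> stab U p q) = card (stab (D \<union> U) p q)" by (rule bij_betw_same_card)
  then show ?thesis by (simp add: card_cartesian_product)
qed

section \<open>Counting stable matchings of an interval\<close>

text \<open>
  Only the order in which a person ranks the others matters, and relabelling the
  persons does not change the number of stable matchings.
\<close>

lemma card_stab_transfer:
  assumes f: "bij_betw f U V"
    and p: "\<And>i j k. i \<in> U \<Longrightarrow> j \<in> U \<Longrightarrow> k \<in> U \<Longrightarrow> p i j < p i k \<longleftrightarrow> p' (f i) (f j) < p' (f i) (f k)"
    and q: "\<And>i j k. i \<in> U \<Longrightarrow> j \<in> U \<Longrightarrow> k \<in> U \<Longrightarrow> q i j < q i k \<longleftrightarrow> q' (f i) (f j) < q' (f i) (f k)"
  shows "card (stab U p q) = card (stab V p' q')"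
proof -
  let ?F = "\<lambda>\<pi> x. if x \<in> V then f (\<pi> (inv_into U f x)) else x"
  have F: "bij_betw ?F {\<pi>. \<pi> permutes U} {\<pi>. \<pi> permutes V}"
    by (rule bij_betw_permutations[OF f])
  have iff: "?F \<sigma> \<in> stab V p' q' \<longleftrightarrow> \<sigma> \<in> stab U p q" if s: "\<sigma> permutes U" for \<sigma>
  proof -
    have Fs: "?F \<sigma> permutes V" using F s by (auto simp: bij_betw_def)
    have V: "V = f ` U" using f by (simp add: bij_betw_def)
    define G where "G = ?F \<sigma>"
    have val: "G (f x) = f (\<sigma> x)" if "x \<in> U" for x
      unfolding G_def using that f by (auto simp: bij_betw_def)
    have im: "\<sigma> x \<in> U" if "x \<in> U" for x using permutes_in_image[OF s] that by simp
    have "(\<forall>i\<in>V. \<forall>k\<in>V. \<not> (p' i (G i) < p' i (G k) \<and> q' (G k) k < q' (G k) i)) \<longleftrightarrow>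
      (\<forall>i\<in>U. \<forall>k\<in>U. \<not> (p' (f i) (f (\<sigma> i)) < p' (f i) (f (\<sigma> k)) \<and> q' (f (\<sigma> k)) (f k) < q' (f (\<sigma> k)) (f i)))"
      unfolding V using val by simp
    also have "\<dots> \<longleftrightarrow> (\<forall>i\<in>U. \<forall>k\<in>U. \<not> (p i (\<sigma> i) < p i (\<sigma> k) \<and> q (\<sigma> k) k < q (\<sigma> k) i))"
      using p q im by simp
    finally show ?thesis using Fs s by (simp only: stab_def mem_Collect_eq G_def)
  qed
  have "bij_betw ?F {\<sigma> \<in> {\<pi>. \<pi> permutes U}. \<sigma> \<in> stab U p q} {\<sigma> \<in> {\<pi>. \<pi> permutes V}. \<sigma> \<in> stab V p' q'}"
    by (rule bij_betw_Collect[OF F]) (simp only: mem_Collect_eq iff)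
  moreover have "{\<sigma> \<in> {\<pi>. \<pi> permutes U}. \<sigma> \<in> stab U p q} = stab U p q"
    "{\<sigma> \<in> {\<pi>. \<pi> permutes V}. \<sigma> \<in> stab V p' q'} = stab V p' q'"
    using stab_permutes by blast+
  ultimately have "bij_betw ?F (stab U p q) (stab V p' q')" by (simp only:)
  then show ?thesis by (rule bij_betw_same_card)
qed

definition stab_count :: "nat \<Rightarrow> nat \<Rightarrow> pref \<Rightarrow> nat" where
  "stab_count a b P = card (stab {a<..b} (\<lambda>i. P (i, Man)) (\<lambda>j. P (j, Woman)))"

definition log_stab :: "nat \<Rightarrow> nat \<Rightarrow> pref \<Rightarrow> real" where
  "log_stab a b P = ln (real (stab_count a b P))"

definition strict_pref :: "pref \<Rightarrow> bool" where "strict_pref P \<longleftrightarrow> (\<forall>x. inj (P x))"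

lemma strict_pref_inj_on: "strict_pref P \<Longrightarrow> inj_on (P x) S"
  unfolding strict_pref_def by (metis inj_on_subset subset_UNIV)

lemma stab_count_pos: "strict_pref P \<Longrightarrow> stab_count a b P > 0"
proof -
  assume "strict_pref P"
  note inj = strict_pref_inj_on[OF this]
  then show ?thesis
    unfolding stab_count_def by (subst card_gt_0_iff) (intro conjI finite_stab stab_nonempty; simp add: inj)
qed

lemma stab_count_le: "stab_count a b P \<le> fact (b - a)"
  unfolding stab_count_def using card_stab_le_fact[of "{a<..b}"] by simp

lemma log_stab_nonneg: "0 \<le> log_stab a b P"
proof (cases "stab_count a b P = 0")
  case False then show ?thesis unfolding log_stab_def by (intro ln_ge_zero) linarith
qed (simp add: log_stab_def)

lemma log_stab_le: "log_stab a b P \<le> (real (b - a))\<^sup>2"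
proof (cases "stab_count a b P = 0 \<or> b \<le> a")
  case True
  moreover have "b \<le> a \<Longrightarrow> stab_count a b P \<le> 1" using stab_count_le[of a b P] by simp
  ultimately have "stab_count a b P = 0 \<or> stab_count a b P = 1" by linarith
  then show ?thesis by (auto simp: log_stab_def)
next
  case False
  let ?k = "b - a"
  have "real (stab_count a b P) \<le> real ?k ^ ?k"
  proof (goal_cases)
    case 1
    have "stab_count a b P \<le> ?k ^ ?k"
      using stab_count_le[of a b P] fact_le_power[of ?k, where ?'a = nat] by simp
    then have "real (stab_count a b P) \<le> real (?k ^ ?k)" by (simp only: of_nat_le_iff)
    then show "real (stab_count a b P) \<le> real ?k ^ ?k" by (simp only: of_nat_power)
  qed
  moreover have "0 < real (stab_count a b P)" using False by simp
  ultimately have "log_stab a b P \<le> ln (real ?k ^ ?k)" unfolding log_stab_def by (intro ln_mono)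
  also have "\<dots> = real ?k * ln (real ?k)" using False by (simp add: ln_realpow)
  also have "\<dots> \<le> real ?k * real ?k"
    using False ln_le_minus_one[of "real ?k"] by (intro mult_left_mono) auto
  finally show ?thesis by (simp add: power2_eq_square)
qed

lemma log_stab_small:
  assumes "b \<le> Suc a"
  shows "log_stab a b P = 0"
proof -
  have "b - a \<le> 1" using assms by simp
  then have "fact (b - a) = (1 :: nat)" by (metis fact_0 fact_1 le_0_eq le_SucE One_nat_def)
  then have "stab_count a b P \<le> 1" using stab_count_le[of a b P] by metis
  then have "stab_count a b P = 0 \<or> stab_count a b P = 1" by linarith
  then show ?thesis by (auto simp: log_stab_def)
qed

lemma log_stab_cong:
  assumes "\<And>i g. a < i \<Longrightarrow> i \<le> b \<Longrightarrow> P (i, g) = P' (i, g)"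
  shows "log_stab a b P = log_stab a b P'"
proof -
  have "stab_count a b P = stab_count a b P'"
    unfolding stab_count_def
    by (rule card_stab_transfer[of id]) (simp_all only: bij_betw_id id_apply greaterThanAtMost_iff assms)
  then show ?thesis by (simp add: log_stab_def)
qed

lemma log_stab_translate:
  assumes "\<And>i g j k. 0 < i \<Longrightarrow> i \<le> L \<Longrightarrow> 0 < j \<Longrightarrow> j \<le> L \<Longrightarrow> 0 < k \<Longrightarrow> k \<le> L \<Longrightarrow>
    P' (i, g) j < P' (i, g) k \<longleftrightarrow> P (a + i, g) (a + j) < P (a + i, g) (a + k)"
  shows "log_stab 0 L P' = log_stab a (a + L) P"
proof -
  have 1: "bij_betw ((+) a) {0<..L} {a<..a + L}"
    by (rule bij_betw_byWitness[of _ "\<lambda>x. x - a"]) auto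
  have 2: "P' (i, g) j < P' (i, g) k \<longleftrightarrow> P (a + i, g) (a + j) < P (a + i, g) (a + k)"
    if "i \<in> {0<..L}" "j \<in> {0<..L}" "k \<in> {0<..L}" for i g j k
    using that unfolding greaterThanAtMost_iff by (elim conjE) (rule assms)
  have "stab_count 0 L P' = stab_count a (a + L) P"
    unfolding stab_count_def by (rule card_stab_transfer[where f = "(+) a"], rule 1) (rule 2; assumption)+
  then show ?thesis unfolding log_stab_def by (rule arg_cong)
qed

section \<open>Cuts forced by calm preferences\<close>

text \<open>
  No index below an interval is smaller than \<open>1\<close>; a cut at \<open>c\<close> therefore serves all intervals that
  start at or below \<open>c\<close>.
\<close>

definition cut :: "nat \<Rightarrow> nat \<Rightarrow> pref \<Rightarrow> bool" where
  "cut c b P = dominates {c<..b} {1..c} (\<lambda>i. P (i, Man)) (\<lambda>j. P (j, Woman))"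

lemma log_stab_cut:
  assumes "cut c b P" "strict_pref P" "a \<le> c" "c \<le> b"
  shows "log_stab a b P = log_stab a c P + log_stab c b P"
proof -
  have eq: "{a<..c} \<union> {c<..b} = {a<..b}" using assms by auto
  note inj = strict_pref_inj_on[OF assms(2)]
  have "dominates {c<..b} {a<..c} (\<lambda>i. P (i, Man)) (\<lambda>j. P (j, Woman))"
    using assms(1) unfolding cut_def dominates_def by auto
  then have "stab_count a b P = stab_count a c P * stab_count c b P"
    unfolding stab_count_def eq[symmetric] by (rule card_stab_union) (auto simp: inj)
  then show ?thesis
    using stab_count_pos[OF assms(2)] by (simp add: log_stab_def ln_mult)
qed

text \<open>
  The ranking \<open>\<pi>\<close> of the person with index \<open>i\<close>, at height \<open>i - c\<close> above \<open>c\<close>, has no inversion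
  that spans at least an eighth of the height, except possibly inversions that lie entirely among
  the indices up to \<open>c\<close> or entirely above twice the height. The excluded inversions get
  longer with the height, so that they become exponentially unlikely; the factors \<open>2\<close> and \<open>8\<close> are
  what \<open>partner_not_low_step\<close> needs.
\<close>

definition calm :: "nat \<Rightarrow> nat \<Rightarrow> nat \<Rightarrow> (nat \<Rightarrow> nat) \<Rightarrow> bool" where
  "calm n c i \<pi> \<longleftrightarrow> (\<forall>u v. 1 \<le> u \<and> u < v \<and> v \<le> n \<and> c < v \<and> u \<le> c + 2 * (i - c) \<and> i - c \<le> 8 * (v - u)
     \<longrightarrow> \<pi> u < \<pi> v)"

definition calm_above :: "nat \<Rightarrow> nat \<Rightarrow> pref \<Rightarrow> bool" where
  "calm_above n c P \<longleftrightarrow> (\<forall>i g. c < i \<and> i \<le> n \<longrightarrow> calm n c i (P (i, g)))"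

lemma calmD:
  "calm n c i \<pi> \<Longrightarrow> 1 \<le> u \<Longrightarrow> u < v \<Longrightarrow> v \<le> n \<Longrightarrow> c < v \<Longrightarrow> u \<le> c + 2 * (i - c) \<Longrightarrow> i - c \<le> 8 * (v - u)
    \<Longrightarrow> \<pi> u < \<pi> v"
  unfolding calm_def by blast

text \<open>
  In units of the height \<open>H\<close> of \<open>h\<close>: suppose that the partner of \<open>h\<close> is below \<open>1/2\<close>, and let
  \<open>A\<close> be \<open>3/4\<close>. Everybody of the other side at height at least \<open>A\<close> then has a partner above \<open>A\<close>:
  if the height is at least \<open>2 * A + 2\<close> this is the hypothesis about larger indices, and
  otherwise \<open>h\<close> would like to have that person as a partner, so the person must prefer their
  own partner to \<open>h\<close>, which calmness rules out for partners not above \<open>A\<close>. But there are more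
  persons from \<open>A\<close> onwards than strictly above \<open>A\<close>.
\<close>

lemma partner_not_low_step:
  assumes p: "\<And>i. c < i \<Longrightarrow> i \<le> b \<Longrightarrow> calm n c i (p i)"
    and q: "\<And>i. c < i \<Longrightarrow> i \<le> b \<Longrightarrow> calm n c i (q i)"
    and s: "\<sigma> \<in> stab {c<..b} p q" and bn: "b \<le> n" and h: "c < h" "h \<le> b"
    and up: "\<And>l. h < l \<Longrightarrow> l \<le> b \<Longrightarrow> l - c \<le> 2 * (inv \<sigma> l - c)"
  shows "h - c \<le> 2 * (\<sigma> h - c)"
proof (rule ccontr)
  assume neg: "\<not> ?thesis"
  have per: "\<sigma> permutes {c<..b}" using s by (rule stab_permutes)
  have sh: "c < \<sigma> h" "\<sigma> h \<le> b" using permutes_in_image[OF per, of h] h by auto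
  define H w A where "H = h - c" and "w = \<sigma> h - c" and "A = (3 * (h - c)) div 4"
  have Hw: "h = c + H" "\<sigma> h = c + w" "1 \<le> w" "2 * w < H" using neg h sh by (auto simp: H_def w_def)
  have A: "A = (3 * H) div 4" by (simp add: A_def H_def)
  have A1: "w < A" "A < H" "H \<le> 8 * (A - w)" "H < 2 * A + 2" "2 * A + 1 \<le> 2 * H" "2 * A + 1 \<le> 8 * (H - A)" "H \<le> 2 * A"
    using Hw(3,4) unfolding A by linarith+
  have "inv \<sigma> l \<in> {c + A + 1..b}" if l: "l \<in> {c + A..b}" for l
  proof -
    let ?k = "inv \<sigma> l"
    have lc: "c < l" "l \<le> b" using l A1 by auto
    have k: "c < ?k" "?k \<le> b" "\<sigma> ?k = l"
      using permutes_in_image[OF permutes_inv[OF per], of l] lc permutes_inverses[OF per] by auto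
    have "c + A < ?k"
    proof (cases "2 * A + 2 \<le> l - c")
      case True
      then have "h < l" using Hw A1 by auto
      from up[OF this lc(2)] show ?thesis using True by linarith
    next
      case False
      \<comment> \<open>\<open>h\<close> prefers \<open>l\<close> to its partner, so \<open>l\<close> must prefer its own partner to \<open>h\<close>.\<close>
      have "p h (\<sigma> h) < p h l"
        using Hw A1 l lc bn by (intro calmD[OF p[OF h]]) auto
      then have "\<not> q l ?k < q l h" using stabD[OF s, of h ?k] k h by auto
      moreover have "q l ?k < q l h" if "?k \<le> c + A"
        using Hw A1 l lc bn h that k False by (intro calmD[OF q[OF lc]]) auto
      ultimately show ?thesis by linarith
    qed
    then show ?thesis using k by auto
  qed
  then have "inv \<sigma> ` {c + A..b} \<subseteq> {c + A + 1..b}" by auto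
  moreover have "inj_on (inv \<sigma>) {c + A..b}"
    using permutes_inj[OF permutes_inv[OF per]] by (rule inj_on_subset) auto
  ultimately have "card {c + A..b} \<le> card {c + A + 1..b}" by (intro card_inj_on_le) auto
  then show False using A1 Hw h by auto
qed

text \<open>
  Downward induction from the top of the interval, where no larger indices remain.
\<close>

lemma partner_not_low:
  assumes p: "\<And>i. c < i \<Longrightarrow> i \<le> b \<Longrightarrow> calm n c i (p i)"
    and q: "\<And>i. c < i \<Longrightarrow> i \<le> b \<Longrightarrow> calm n c i (q i)"
    and s: "\<sigma> \<in> stab {c<..b} p q" and bn: "b \<le> n"
  shows "c < h \<Longrightarrow> h \<le> b \<Longrightarrow> h - c \<le> 2 * (\<sigma> h - c) \<and> h - c \<le> 2 * (inv \<sigma> h - c)"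
proof (induction "b - h" arbitrary: h rule: less_induct)
  case less
  have per: "\<sigma> permutes {c<..b}" using s by (rule stab_permutes)
  have up: "l - c \<le> 2 * (\<sigma> l - c) \<and> l - c \<le> 2 * (inv \<sigma> l - c)" if "h < l" "l \<le> b" for l
    using less that by (intro less.hyps) auto
  have "h - c \<le> 2 * (\<sigma> h - c)"
    using partner_not_low_step[OF p q s bn less.prems] up by blast
  moreover have "h - c \<le> 2 * (inv \<sigma> h - c)"
    using partner_not_low_step[OF q p stab_swap[OF s] bn less.prems] up permutes_inv_inv[OF per] by auto
  ultimately show ?case ..
qed

text \<open>
  A partner has at least half the height of the person, so an inversion between the partner and
  somebody not above \<open>c\<close> would span half the height.
\<close>

theorem calm_above_cut:
  assumes g: "calm_above n c P" and bn: "b \<le> n"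
  shows "cut c b P"
  unfolding cut_def dominates_def
proof (intro ballI)
  fix \<sigma> k j
  let ?p = "\<lambda>i. P (i, Man)" and ?q = "\<lambda>j. P (j, Woman)"
  assume s: "\<sigma> \<in> stab {c<..b} ?p ?q" and k: "k \<in> {c<..b}" and j: "j \<in> {1..c}"
  have per: "\<sigma> permutes {c<..b}" using s by (rule stab_permutes)
  have sk: "c < \<sigma> k" "\<sigma> k \<le> b" using permutes_in_image[OF per, of k] k by auto
  have c: "calm n c i (?p i)" "calm n c i (?q i)" if "c < i" "i \<le> b" for i
    using g that bn by (auto simp: calm_above_def)
  note low = partner_not_low[OF c s bn]
  have 1: "k - c \<le> 2 * (\<sigma> k - c)" using low[of k] k by auto
  have 2: "\<sigma> k - c \<le> 2 * (k - c)" using low[of "\<sigma> k"] sk permutes_inverses[OF per] by auto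
  have "?p k j < ?p k (\<sigma> k)"
    using k j sk 1 bn by (intro calmD[OF c(1)[of k]]) auto
  moreover have "?q (\<sigma> k) j < ?q (\<sigma> k) k"
    using k j sk 2 bn by (intro calmD[OF c(2)[of "\<sigma> k"]]) auto
  ultimately show "?p k j < ?p k (\<sigma> k) \<and> ?q (\<sigma> k) j < ?q (\<sigma> k) k" ..
qed

lemma log_stab_calm_above:
  "calm_above n c P \<Longrightarrow> strict_pref P \<Longrightarrow> a \<le> c \<Longrightarrow> c \<le> b \<Longrightarrow> b \<le> n \<Longrightarrow> log_stab a b P = log_stab a c P + log_stab c b P"
  by (rule log_stab_cut[OF calm_above_cut])

section \<open>The additive defect at an arbitrary level\<close>

text \<open>
  Since \<open>calm_above n c\<close> holds trivially for \<open>c \<ge> n\<close>, this forces \<open>s + r \<le> n\<close> if \<open>r > 0\<close>. An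
  interval of levels that reaches beyond \<open>n\<close> is thus covered without a special case.
\<close>

definition no_calm_cut :: "nat \<Rightarrow> nat \<Rightarrow> nat \<Rightarrow> pref \<Rightarrow> bool" where
  "no_calm_cut n s r P \<longleftrightarrow> (\<forall>c. s \<le> c \<and> c < s + r \<longrightarrow> \<not> calm_above n c P)"

lemma sq_le_sum: "(real T)\<^sup>2 \<le> (\<Sum>r=1..T. 2 * real r)"
proof (induction T)
  case (Suc T)
  then show ?case by (simp add: power2_eq_square algebra_simps)
qed simp

text \<open>
  Let \<open>c\<close> be the first calm level from \<open>m\<close> upwards and \<open>d\<close> the last one from \<open>m\<close> downwards, with
  the ends of the interval as substitutes. Cutting everything at \<open>c\<close> and \<open>d\<close> leaves only the
  contributions of the intervals between \<open>d\<close>, \<open>m\<close> and \<open>c\<close>, which are at most quadratic in their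
  lengths. Writing the squares as sums over \<open>r\<close> turns them into sums of indicators of
  events, so that no random level has to be handled later.
\<close>

lemma log_stab_defect:
  assumes st: "strict_pref P" and am: "a \<le> m" and mb: "m \<le> b" and bn: "b \<le> n"
  shows "\<bar>log_stab a b P - log_stab a m P - log_stab m b P\<bar> \<le>
    (\<Sum>r=1..n. 4 * real r * (of_bool (no_calm_cut n m r P) + of_bool (r \<le> m \<and> no_calm_cut n (m + 1 - r) r P)))"
proof -
  define c where "c = (if \<exists>x. m \<le> x \<and> x \<le> b \<and> calm_above n x P then LEAST x. m \<le> x \<and> x \<le> b \<and> calm_above n x P else b)"
  have c: "m \<le> c" "c \<le> b" "c = b \<or> calm_above n c P"
    and c_min: "\<And>x. m \<le> x \<Longrightarrow> x < c \<Longrightarrow> \<not> calm_above n x P"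
  proof -
    have "m \<le> c \<and> c \<le> b \<and> (c = b \<or> calm_above n c P) \<and> (\<forall>x. m \<le> x \<longrightarrow> x < c \<longrightarrow> \<not> calm_above n x P)"
    proof (cases "\<exists>x. m \<le> x \<and> x \<le> b \<and> calm_above n x P")
      case True
      let ?Q = "\<lambda>x. m \<le> x \<and> x \<le> b \<and> calm_above n x P"
      have c: "c = (LEAST x. ?Q x)" unfolding c_def using True by (rule if_P)
      have "?Q c" unfolding c using True by (rule LeastI_ex)
      moreover have "\<not> ?Q x" if "x < c" for x using that unfolding c by (rule not_less_Least)
      ultimately show ?thesis by (meson less_imp_le order_trans)
    next
      case False
      have "c = b" unfolding c_def using False by (rule if_not_P)
      then show ?thesis using False mb by (meson less_imp_le order_refl)
    qed
    then show "m \<le> c" "c \<le> b" "c = b \<or> calm_above n c P" "\<And>x. m \<le> x \<Longrightarrow> x < c \<Longrightarrow> \<not> calm_above n x P" by blast+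
  qed
  let ?S = "{x. a \<le> x \<and> x \<le> m \<and> calm_above n x P}"
  define d where "d = (if ?S = {} then a else Max ?S)"
  have fS: "finite ?S" by (rule finite_subset[of _ "{..m}"]) auto
  have d: "a \<le> d" "d \<le> m" "d = a \<or> calm_above n d P"
  proof -
    have "a \<le> d \<and> d \<le> m \<and> (d = a \<or> calm_above n d P)"
    proof (cases "?S = {}")
      case True
      then show ?thesis using am by (simp add: d_def)
    next
      case False
      then have "d = Max ?S" unfolding d_def by (rule if_not_P)
      then show ?thesis using Max_in[OF fS False] by simp
    qed
    then show "a \<le> d" "d \<le> m" "d = a \<or> calm_above n d P" by blast+
  qed
  have d_max: "\<not> calm_above n x P" if "d < x" "x \<le> m" for x
  proof
    assume "calm_above n x P"
    then have x: "x \<in> ?S" using that d(1) by simp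
    then have "d = Max ?S" unfolding d_def by (intro if_not_P) blast
    then show False using Max_ge[OF fS x] that(1) by linarith
  qed
  have "log_stab b b P = 0" "log_stab a a P = 0" by (auto intro: log_stab_small)
  then have cc: "log_stab e b P = log_stab e c P + log_stab c b P" if "e \<le> c" for e
    using c log_stab_calm_above[of n c P e b] that bn st by auto
  have dd: "log_stab a e P = log_stab a d P + log_stab d e P" if "d \<le> e" "e \<le> n" for e
    using d log_stab_calm_above[of n d P a e] that st \<open>log_stab a a P = 0\<close> by auto
  have "log_stab a b P - log_stab a m P - log_stab m b P = log_stab d c P - log_stab d m P - log_stab m c P"
    using cc[of d] cc[of m] dd[of b] dd[of m] c d mb bn by auto
  moreover have "log_stab d c P \<le> (real (c - d))\<^sup>2" "log_stab d m P \<le> (real (m - d))\<^sup>2" "log_stab m c P \<le> (real (c - m))\<^sup>2"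
    by (rule log_stab_le)+
  moreover have "(real (c - d))\<^sup>2 \<le> 2 * (real (c - m))\<^sup>2 + 2 * (real (m - d))\<^sup>2"
  proof -
    have "real (c - d) = real (c - m) + real (m - d)" using c d by simp
    then show ?thesis using sum_squares_bound[of "real (c - m)" "real (m - d)"]
      by (simp add: power2_sum)
  qed
  moreover note log_stab_nonneg[of d c P] log_stab_nonneg[of d m P] log_stab_nonneg[of m c P]
    zero_le_power2[of "real (c - m)"] zero_le_power2[of "real (m - d)"]
  ultimately have "\<bar>log_stab a b P - log_stab a m P - log_stab m b P\<bar> \<le> 2 * (real (c - m))\<^sup>2 + 2 * (real (m - d))\<^sup>2"
    by linarith
  also have "\<dots> \<le> (\<Sum>r=1..c-m. 4 * real r) + (\<Sum>r=1..m-d. 4 * real r)"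
    using sq_le_sum[of "c - m"] sq_le_sum[of "m - d"] by (simp add: sum_distrib_left[symmetric])
  also have "\<dots> = (\<Sum>r=1..c-m. 4 * real r * of_bool (no_calm_cut n m r P)) +
      (\<Sum>r=1..m-d. 4 * real r * of_bool (r \<le> m \<and> no_calm_cut n (m + 1 - r) r P))"
    using c_min d_max by (intro arg_cong2[where f = "(+)"] sum.cong) (auto simp: no_calm_cut_def)
  also have "\<dots> \<le> (\<Sum>r=1..n. 4 * real r * of_bool (no_calm_cut n m r P)) +
      (\<Sum>r=1..n. 4 * real r * of_bool (r \<le> m \<and> no_calm_cut n (m + 1 - r) r P))"
    using c d mb bn by (intro add_mono sum_mono2) auto
  finally show ?thesis by (simp add: sum.distrib distrib_left)
qed

section \<open>A local configuration that doubles the count\<close>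

text \<open>
  The people at \<open>s + 1\<close> and \<open>s + 2\<close> rank each other above everybody below, and among the four of
  them each man wants a different woman while each woman wants the man who does not want her.
  Both matchings of the four are then stable.
\<close>

definition gadget :: "nat \<Rightarrow> pref \<Rightarrow> bool" where
  "gadget s P \<longleftrightarrow> (\<forall>g. \<forall>i\<in>{s + 1, s + 2}. \<forall>j\<in>{1..s}. \<forall>v\<in>{s + 1, s + 2}. P (i, g) j < P (i, g) v) \<and>
     P (s + 1, Man) (s + 1) < P (s + 1, Man) (s + 2) \<and> P (s + 2, Man) (s + 2) < P (s + 2, Man) (s + 1) \<and>
     P (s + 1, Woman) (s + 2) < P (s + 1, Woman) (s + 1) \<and> P (s + 2, Woman) (s + 1) < P (s + 2, Woman) (s + 2)"

lemma gadget_cut: "gadget s P \<Longrightarrow> cut s (s + 2) P"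
  unfolding cut_def dominates_def
proof (intro ballI)
  fix \<sigma> k j
  assume g: "gadget s P" and s: "\<sigma> \<in> stab {s<..s + 2} (\<lambda>i. P (i, Man)) (\<lambda>j. P (j, Woman))"
    and k: "k \<in> {s<..s + 2}" and j: "j \<in> {1..s}"
  have "\<sigma> k \<in> {s<..s + 2}" using permutes_in_image[OF stab_permutes[OF s]] k by auto
  moreover have "{s<..s + 2} = {s + 1, s + 2}" by auto
  ultimately show "P (k, Man) j < P (k, Man) (\<sigma> k) \<and> P (\<sigma> k, Woman) j < P (\<sigma> k, Woman) k"
    using g j k unfolding gadget_def by metis
qed

lemma gadget_two:
  assumes g: "gadget s P"
  shows "ln 2 \<le> log_stab s (s + 2) P"
proof -
  let ?p = "\<lambda>i. P (i, Man)" and ?q = "\<lambda>j. P (j, Woman)"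
  have U: "{s<..s + 2} = {s + 1, s + 2}" by auto
  have "id \<in> stab {s<..s + 2} ?p ?q"
    using g unfolding stab_def U gadget_def by (auto simp: permutes_id)
  moreover have "Transposition.transpose (s + 1) (s + 2) \<in> stab {s<..s + 2} ?p ?q"
    using g unfolding stab_def U gadget_def by (auto intro!: permutes_swap_id)
  ultimately have "card {id, Transposition.transpose (s + 1) (s + 2)} \<le> stab_count s (s + 2) P"
    unfolding stab_count_def by (intro card_mono finite_stab) auto
  moreover have "id \<noteq> Transposition.transpose (s + 1) (s + 2)"
    by (metis id_apply n_not_Suc_n transpose_apply_first add_Suc_right numeral_2_eq_2 One_nat_def)
  ultimately show ?thesis unfolding log_stab_def by simp
qed

lemma card_insert_Suc: "finite S \<Longrightarrow> card (insert x S) \<le> Suc (card S)"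
  by (simp add: card_insert_if)

text \<open>
  Look at the topmost gadget that sits directly below a calm level. The calm level splits off
  what is above it, and the gadget is a cut of what is left; induction continues below.
\<close>

lemma log_stab_ge_gadgets:
  assumes st: "strict_pref P"
  shows "b \<le> n \<Longrightarrow> ln 2 * real (card {k. 2 * k + 2 \<le> b \<and> calm_above n (2 * k + 2) P \<and> gadget (2 * k) P}) \<le> log_stab 0 b P"
proof (induction b rule: less_induct)
  case (less b)
  let ?K = "\<lambda>b. {k. 2 * k + 2 \<le> b \<and> calm_above n (2 * k + 2) P \<and> gadget (2 * k) P}"
  have fin: "finite (?K b)" for b by (rule finite_subset[of _ "{..b}"]) auto
  show ?case
  proof (cases "?K b = {}")
    case True then show ?thesis unfolding True using log_stab_nonneg[of 0 b P] by simp
  next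
    case False
    define k where "k = Max (?K b)"
    have k: "2 * k + 2 \<le> b" "calm_above n (2 * k + 2) P" "gadget (2 * k) P"
      using Max_in[OF fin False] unfolding k_def by auto
    have "?K b \<subseteq> insert k (?K (2 * k))"
    proof
      fix j assume j: "j \<in> ?K b"
      then have "j \<le> k" unfolding k_def by (intro Max_ge fin)
      then show "j \<in> insert k (?K (2 * k))" using j by (cases "j = k") auto
    qed
    then have "card (?K b) \<le> card (insert k (?K (2 * k)))" by (intro card_mono finite.insertI fin)
    also have "\<dots> \<le> Suc (card (?K (2 * k)))" by (rule card_insert_Suc[OF fin])
    finally have "real (card (?K b)) \<le> 1 + real (card (?K (2 * k)))" by linarith
    then have "ln 2 * real (card (?K b)) \<le> ln 2 * (1 + real (card (?K (2 * k))))"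
      by (intro mult_left_mono) auto
    also have "\<dots> \<le> ln 2 + log_stab 0 (2 * k) P"
      using less.IH[of "2 * k"] k less.prems by (simp add: distrib_left)
    also have "\<dots> \<le> log_stab (2 * k) (2 * k + 2) P + log_stab 0 (2 * k) P"
      using gadget_two[OF k(3)] by simp
    also have "\<dots> = log_stab 0 (2 * k + 2) P"
      using log_stab_cut[OF gadget_cut[OF k(3)] st, of 0] by simp
    also have "\<dots> \<le> log_stab 0 b P"
      using log_stab_calm_above[OF k(2) st, of 0 b] k(1) less.prems log_stab_nonneg[of "2 * k + 2" b P] by simp
    finally show ?thesis .
  qed
qed

lemma log_stab_identity:
  assumes "\<And>x. x \<in> Omega n \<Longrightarrow> P x = id" "strict_pref P"
  shows "log_stab 0 n P = 0"
proof -
  have G: "calm_above n c P" for c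
    using assms(1) by (auto simp: calm_above_def calm_def Omega_def)
  have "b \<le> n \<Longrightarrow> log_stab 0 b P = 0" for b
  proof (induction b)
    case (Suc b)
    then show ?case using log_stab_calm_above[OF G assms(2), of 0 b "Suc b"] log_stab_small[of "Suc b" b P] by simp
  qed (simp add: log_stab_small)
  then show ?thesis by simp
qed

section \<open>Mallows weights and the pattern on a window\<close>

definition weight :: "real \<Rightarrow> nat \<Rightarrow> ((nat \<Rightarrow> nat) \<Rightarrow> bool) \<Rightarrow> real" where
  "weight q n A = (\<Sum>\<pi> | \<pi> \<in> perms n \<and> A \<pi>. q ^ inv_count n \<pi>)"

lemma weight_True: "weight q n (\<lambda>_. True) = (\<Sum>\<pi>\<in>perms n. q ^ inv_count n \<pi>)"
  by (simp add: weight_def)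

lemma weight_True_pos: "0 < q \<Longrightarrow> 0 < weight q n (\<lambda>_. True)"
  unfolding weight_True by (rule Mal_normaliser_pos)

lemma weight_nonneg: "0 \<le> q \<Longrightarrow> 0 \<le> weight q n A"
  unfolding weight_def by (intro sum_nonneg) simp

lemma weight_mono: "0 \<le> q \<Longrightarrow> (\<And>\<pi>. \<pi> \<in> perms n \<Longrightarrow> A \<pi> \<Longrightarrow> B \<pi>) \<Longrightarrow> weight q n A \<le> weight q n B"
  unfolding weight_def by (intro sum_mono2) auto

lemma weight_cong: "(\<And>\<pi>. \<pi> \<in> perms n \<Longrightarrow> A \<pi> \<longleftrightarrow> B \<pi>) \<Longrightarrow> weight q n A = weight q n B"
  unfolding weight_def by (intro sum.cong) auto

lemma set_Mal: "0 < q \<Longrightarrow> set_pmf (Mal q n) = perms n"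
  using Mal_normaliser_pos[of q n] by (auto simp: set_pmf_eq pmf_Mal)

lemma prob_Mal:
  assumes "0 < q"
  shows "measure_pmf.prob (Mal q n) {\<pi>. A \<pi>} = weight q n A / weight q n (\<lambda>_. True)"
proof -
  have "measure_pmf.prob (Mal q n) {\<pi>. A \<pi>} = measure_pmf.prob (Mal q n) {\<pi>. \<pi> \<in> perms n \<and> A \<pi>}"
    by (rule measure_prob_cong_0) (auto simp: pmf_Mal[OF assms])
  also have "\<dots> = (\<Sum>\<pi> | \<pi> \<in> perms n \<and> A \<pi>. pmf (Mal q n) \<pi>)"
    by (rule measure_measure_pmf_finite) simp
  also have "\<dots> = weight q n A / weight q n (\<lambda>_. True)"
    unfolding weight_True weight_def[of q n A] sum_divide_distrib
    by (intro sum.cong) (auto simp: pmf_Mal[OF assms])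
  finally show ?thesis .
qed

definition window_perm :: "nat \<Rightarrow> nat \<Rightarrow> (nat \<Rightarrow> nat) \<Rightarrow> nat \<Rightarrow> nat" where
  "window_perm a L \<sigma> i = (if a < i \<and> i \<le> a + L then a + \<sigma> (i - a) else i)"

text \<open>
  The standardisation of the values that \<open>\<pi>\<close> takes on the window of length \<open>L\<close> after \<open>a\<close>.
\<close>

definition pattern :: "nat \<Rightarrow> nat \<Rightarrow> (nat \<Rightarrow> nat) \<Rightarrow> nat \<Rightarrow> nat" where
  "pattern a L \<pi> i = (if 1 \<le> i \<and> i \<le> L then card {j \<in> {1..L}. \<pi> (a + j) \<le> \<pi> (a + i)} else i)"

lemma permsD: "\<pi> \<in> perms n \<Longrightarrow> \<pi> permutes {1..n}" by (simp add: perms_def)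

lemma perms_range: "\<pi> \<in> perms n \<Longrightarrow> 1 \<le> i \<Longrightarrow> i \<le> n \<Longrightarrow> 1 \<le> \<pi> i \<and> \<pi> i \<le> n"
  using permutes_in_image[of \<pi> "{1..n}" i] by (auto simp: perms_def)

lemma perms_inj: "\<pi> \<in> perms n \<Longrightarrow> inj \<pi>"
  by (auto simp: perms_def dest: permutes_inj)

lemma perms_eq_iff: "\<pi> \<in> perms n \<Longrightarrow> \<pi> i = \<pi> j \<longleftrightarrow> i = j"
  using perms_inj[of \<pi> n] by (auto simp: inj_def)

lemma window_perm_permutes:
  assumes "\<sigma> \<in> perms L"
  shows "window_perm a L \<sigma> permutes {a<..a + L}"
proof (rule bij_imp_permutes)
  have "inj_on (window_perm a L \<sigma>) {a<..a + L}"
    by (auto simp: inj_on_def window_perm_def perms_eq_iff[OF assms])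
  moreover have "window_perm a L \<sigma> ` {a<..a + L} \<subseteq> {a<..a + L}"
    using perms_range[OF assms] by (auto simp: window_perm_def Suc_le_eq)
  ultimately show "bij_betw (window_perm a L \<sigma>) {a<..a + L} {a<..a + L}"
    by (simp add: bij_betw_def endo_inj_surj)
qed (auto simp: window_perm_def)

lemma window_perm_in_perms: "\<sigma> \<in> perms L \<Longrightarrow> a + L \<le> n \<Longrightarrow> window_perm a L \<sigma> \<in> perms n"
  unfolding perms_def mem_Collect_eq
  by (rule permutes_subset[of _ "{a<..a + L}"]) (auto intro: window_perm_permutes simp: perms_def)

lemma comp_in_perms: "\<pi> \<in> perms n \<Longrightarrow> \<tau> \<in> perms n \<Longrightarrow> \<pi> \<circ> \<tau> \<in> perms n"
  unfolding perms_def by (simp add: permutes_compose)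

lemma pattern_less_iff:
  assumes "inj \<pi>" "i \<in> {1..L}" "j \<in> {1..L}"
  shows "pattern a L \<pi> i < pattern a L \<pi> j \<longleftrightarrow> \<pi> (a + i) < \<pi> (a + j)"
proof -
  have *: "pattern a L \<pi> i < pattern a L \<pi> j" if "\<pi> (a + i) < \<pi> (a + j)" "i \<in> {1..L}" "j \<in> {1..L}" for i j
  proof -
    let ?D = "\<lambda>i. {k \<in> {1..L}. \<pi> (a + k) \<le> \<pi> (a + i)}"
    have "?D i \<subseteq> ?D j" "j \<in> ?D j" "j \<notin> ?D i" using that by auto
    then have "?D i \<subset> ?D j" by blast
    then have "card (?D i) < card (?D j)" by (intro psubset_card_mono) auto
    then show ?thesis using that by (simp add: pattern_def)
  qed
  show ?thesis
  proof
    assume l: "pattern a L \<pi> i < pattern a L \<pi> j"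
    then have "i \<noteq> j" by auto
    then have "\<pi> (a + i) \<noteq> \<pi> (a + j)" using assms(1) by (metis add_left_cancel injD)
    then show "\<pi> (a + i) < \<pi> (a + j)" using *[of j i] l assms by (meson less_asym linorder_neqE_nat)
  qed (use * assms in blast)
qed

lemma pattern_in_perms:
  assumes "inj \<pi>"
  shows "pattern a L \<pi> \<in> perms L"
  unfolding perms_def mem_Collect_eq
proof (rule bij_imp_permutes)
  have "inj_on (pattern a L \<pi>) {1..L}"
  proof (rule inj_onI)
    fix i j assume ij: "i \<in> {1..L}" "j \<in> {1..L}" "pattern a L \<pi> i = pattern a L \<pi> j"
    then have "\<not> \<pi> (a + i) < \<pi> (a + j)" "\<not> \<pi> (a + j) < \<pi> (a + i)"
      using pattern_less_iff[OF assms] by (metis less_irrefl)+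
    then show "i = j" using assms by (metis add_left_cancel injD linorder_neqE_nat)
  qed
  moreover have "pattern a L \<pi> ` {1..L} \<subseteq> {1..L}"
  proof clarify
    fix i assume i: "i \<in> {1..L}"
    have "card {j \<in> {1..L}. \<pi> (a + j) \<le> \<pi> (a + i)} \<le> card {1..L}" by (intro card_mono) auto
    moreover have "0 < card {j \<in> {1..L}. \<pi> (a + j) \<le> \<pi> (a + i)}" using i by (subst card_gt_0_iff) auto
    ultimately show "pattern a L \<pi> i \<in> {1..L}" using i by (simp add: pattern_def)
  qed
  ultimately show "bij_betw (pattern a L \<pi>) {1..L} {1..L}" by (simp add: bij_betw_def endo_inj_surj)
qed (auto simp: pattern_def)

lemma pattern_comp_window_perm:
  assumes "\<sigma> \<in> perms L"
  shows "pattern a L (\<pi> \<circ> window_perm a L \<sigma>) = pattern a L \<pi> \<circ> \<sigma>"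
proof
  fix i
  show "pattern a L (\<pi> \<circ> window_perm a L \<sigma>) i = (pattern a L \<pi> \<circ> \<sigma>) i"
  proof (cases "i \<in> {1..L}")
    case True
    then have si: "\<sigma> i \<in> {1..L}" using perms_range[OF assms] by auto
    have "\<sigma> ` {j \<in> {1..L}. \<pi> (a + \<sigma> j) \<le> \<pi> (a + \<sigma> i)} = {j \<in> \<sigma> ` {1..L}. \<pi> (a + j) \<le> \<pi> (a + \<sigma> i)}"
      by auto
    also have "\<sigma> ` {1..L} = {1..L}" using permutes_image[OF permsD[OF assms]] .
    finally have "{j \<in> {1..L}. \<pi> (a + j) \<le> \<pi> (a + \<sigma> i)} = \<sigma> ` {j \<in> {1..L}. \<pi> (a + \<sigma> j) \<le> \<pi> (a + \<sigma> i)}" ..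
    moreover have "inj_on \<sigma> S" for S using perms_inj[OF assms] by (rule inj_on_subset) simp
    ultimately have "card {j \<in> {1..L}. \<pi> (a + j) \<le> \<pi> (a + \<sigma> i)} = card {j \<in> {1..L}. \<pi> (a + \<sigma> j) \<le> \<pi> (a + \<sigma> i)}"
      by (simp add: card_image)
    moreover have "{j \<in> {1..L}. \<pi> (window_perm a L \<sigma> (a + j)) \<le> \<pi> (window_perm a L \<sigma> (a + i))}
        = {j \<in> {1..L}. \<pi> (a + \<sigma> j) \<le> \<pi> (a + \<sigma> i)}"
      using True by (auto simp: window_perm_def)
    ultimately show ?thesis using True si by (simp add: pattern_def)
  next
    case False
    then have "\<sigma> i = i" using permsD[OF assms] by (auto simp: permutes_def)
    then show ?thesis using False by (auto simp: pattern_def)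
  qed
qed

text \<open>
  Permuting the positions of a window moves the inversions with at most one end in the
  window to inversions of the same kind, because the window is an interval. So only the
  inversions inside count, and there are none for \<open>\<pi>\<close> by assumption.
\<close>

lemma inv_count_comp_window_perm:
  assumes \<pi>: "\<pi> \<in> perms n" and \<sigma>: "\<sigma> \<in> perms L" and aL: "a + L \<le> n"
    and inc: "\<And>i j. a < i \<Longrightarrow> i < j \<Longrightarrow> j \<le> a + L \<Longrightarrow> \<pi> i < \<pi> j"
  shows "inv_count n (\<pi> \<circ> window_perm a L \<sigma>) = inv_count n \<pi> + inv_count L \<sigma>"
proof -
  let ?\<tau> = "window_perm a L \<sigma>"
  let ?I = "{a<..a + L}"
  let ?J = "\<lambda>f. {(i, j). 1 \<le> i \<and> i < j \<and> j \<le> n \<and> f i > (f j :: nat)}"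
  have fin: "finite (?J f)" for f by (rule finite_subset[of _ "{1..n} \<times> {1..n}"]) auto
  have per: "?\<tau> permutes ?I" by (rule window_perm_permutes[OF \<sigma>])
  have inI: "?\<tau> i \<in> ?I \<longleftrightarrow> i \<in> ?I" for i by (rule permutes_in_image[OF per])
  have inc': "\<pi> i < \<pi> j \<longleftrightarrow> i < j" if "i \<in> ?I" "j \<in> ?I" for i j
    using inc[of i j] inc[of j i] that by (metis greaterThanAtMost_iff less_asym linorder_neqE_nat)
  let ?A = "{p \<in> ?J (\<pi> \<circ> ?\<tau>). fst p \<in> ?I \<and> snd p \<in> ?I}"
  let ?B = "{p \<in> ?J (\<pi> \<circ> ?\<tau>). \<not> (fst p \<in> ?I \<and> snd p \<in> ?I)}"
  have "?J (\<pi> \<circ> ?\<tau>) = ?A \<union> ?B" by auto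
  then have "inv_count n (\<pi> \<circ> ?\<tau>) = card (?A \<union> ?B)" by (simp only: inv_count_def)
  also have "\<dots> = card ?A + card ?B"
    by (rule card_Un_disjoint) (auto intro: finite_subset[OF _ fin[of "\<pi> \<circ> ?\<tau>"]])
  also have "card ?A = inv_count L \<sigma>"
    unfolding inv_count_def
  proof (rule bij_betw_same_card[of "\<lambda>(i, j). (i - a, j - a)"],
      rule bij_betw_byWitness[where f' = "\<lambda>(i, j). (a + i, a + j)"])
    show "(\<lambda>(i, j). (i - a, j - a)) ` ?A \<subseteq> {(i, j). 1 \<le> i \<and> i < j \<and> j \<le> L \<and> \<sigma> j < \<sigma> i}"
    proof
      fix p assume "p \<in> (\<lambda>(i, j). (i - a, j - a)) ` ?A"
      then obtain i j where ij: "i \<in> ?I" "j \<in> ?I" "i < j" "\<pi> (?\<tau> j) < \<pi> (?\<tau> i)" "p = (i - a, j - a)" by auto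
      then have "?\<tau> j < ?\<tau> i" using inI inc' by blast
      then show "p \<in> {(i, j). 1 \<le> i \<and> i < j \<and> j \<le> L \<and> \<sigma> j < \<sigma> i}"
        using ij by (auto simp: window_perm_def)
    qed
    show "(\<lambda>(i, j). (a + i, a + j)) ` {(i, j). 1 \<le> i \<and> i < j \<and> j \<le> L \<and> \<sigma> j < \<sigma> i} \<subseteq> ?A"
    proof
      fix p assume "p \<in> (\<lambda>(i, j). (a + i, a + j)) ` {(i, j). 1 \<le> i \<and> i < j \<and> j \<le> L \<and> \<sigma> j < \<sigma> i}"
      then obtain i j where ij: "1 \<le> i" "i < j" "j \<le> L" "\<sigma> j < \<sigma> i" "p = (a + i, a + j)" by auto
      have "?\<tau> (a + i) \<in> ?I" "?\<tau> (a + j) \<in> ?I" using inI ij by auto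
      moreover have "?\<tau> (a + j) < ?\<tau> (a + i)" using ij by (auto simp: window_perm_def)
      ultimately have "\<pi> (?\<tau> (a + j)) < \<pi> (?\<tau> (a + i))" using inc' by blast
      then show "p \<in> ?A" using ij aL by auto
    qed
  qed auto
  also have "card ?B = inv_count n \<pi>"
    unfolding inv_count_def
  proof (rule bij_betw_same_card[of "\<lambda>(i, j). (?\<tau> i, ?\<tau> j)"],
      rule bij_betw_byWitness[where f' = "\<lambda>(i, j). (inv ?\<tau> i, inv ?\<tau> j)"])
    have ord: "f i < f j" if "f permutes ?I" "i < j" "\<not> (i \<in> ?I \<and> j \<in> ?I)" for f i j
    proof -
      have "f x \<in> ?I" if "x \<in> ?I" for x using permutes_in_image[OF \<open>f permutes ?I\<close>] that by blast
      moreover have "f x = x" if "x \<notin> ?I" for x using \<open>f permutes ?I\<close> that by (auto simp: permutes_def)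
      ultimately show ?thesis using that(2,3)
        by (metis greaterThanAtMost_iff le_less_trans less_le_trans not_le order_less_imp_le)
    qed
    have rng: "1 \<le> f i \<and> f i \<le> n" if "f permutes ?I" "1 \<le> i" "i \<le> n" for f i
    proof -
      have "f permutes {1..n}" using that(1) by (rule permutes_subset) (use aL in auto)
      then show ?thesis using permutes_in_image[of f "{1..n}" i] that by auto
    qed
    show "(\<lambda>(i, j). (?\<tau> i, ?\<tau> j)) ` ?B \<subseteq> ?J \<pi>"
    proof
      fix p assume "p \<in> (\<lambda>(i, j). (?\<tau> i, ?\<tau> j)) ` ?B"
      then obtain x where x: "x \<in> ?B" "p = (case x of (i, j) \<Rightarrow> (?\<tau> i, ?\<tau> j))" by (rule imageE)
      obtain i j where xij: "x = (i, j)" by (cases x)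
      have ij: "1 \<le> i" "i < j" "j \<le> n" "\<pi> (?\<tau> j) < \<pi> (?\<tau> i)" "\<not> (i \<in> ?I \<and> j \<in> ?I)"
        "p = (?\<tau> i, ?\<tau> j)" using x unfolding xij by simp_all
      then show "p \<in> ?J \<pi>" using ord[OF per ij(2,5)] rng[OF per, of i] rng[OF per, of j] by auto
    qed
    have per': "inv ?\<tau> permutes ?I" by (rule permutes_inv[OF per])
    have inv_in: "inv ?\<tau> i \<in> ?I \<longleftrightarrow> i \<in> ?I" for i by (rule permutes_in_image[OF per'])
    show "(\<lambda>(i, j). (inv ?\<tau> i, inv ?\<tau> j)) ` ?J \<pi> \<subseteq> ?B"
    proof
      fix p assume "p \<in> (\<lambda>(i, j). (inv ?\<tau> i, inv ?\<tau> j)) ` ?J \<pi>"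
      then obtain i j where ij: "1 \<le> i" "i < j" "j \<le> n" "\<pi> j < \<pi> i" "p = (inv ?\<tau> i, inv ?\<tau> j)" by auto
      have nI: "\<not> (i \<in> ?I \<and> j \<in> ?I)" using inc' ij by (meson less_asym)
      then have "inv ?\<tau> i < inv ?\<tau> j" using ord[OF per' ij(2)] by blast
      then show "p \<in> ?B"
        using ij rng[OF per', of i] rng[OF per', of j] nI inv_in permutes_inverses(1)[OF per] by auto
    qed
    show "\<forall>p\<in>?B. (case case p of (i, j) \<Rightarrow> (?\<tau> i, ?\<tau> j) of (i, j) \<Rightarrow> (inv ?\<tau> i, inv ?\<tau> j)) = p"
      using permutes_inverses[OF per] by auto
    show "\<forall>p\<in>?J \<pi>. (case case p of (i, j) \<Rightarrow> (inv ?\<tau> i, inv ?\<tau> j) of (i, j) \<Rightarrow> (?\<tau> i, ?\<tau> j)) = p"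
      using permutes_inverses[OF per] by auto
  qed
  finally show ?thesis by (simp only: add.commute)
qed

text \<open>
  Composition with \<open>window_perm a L \<sigma>\<close> is a bijection from the permutations that increase on the
  window to those with pattern \<open>\<sigma>\<close>, and it multiplies every weight by \<open>q ^ inv_count L \<sigma>\<close>. The
  event \<open>B\<close> stands for further conditions that do not see the order inside the window.
\<close>

lemma weight_pattern:
  assumes \<sigma>: "\<sigma> \<in> perms L" and aL: "a + L \<le> n"
    and B: "\<And>\<pi>. \<pi> \<in> perms n \<Longrightarrow> B (\<pi> \<circ> window_perm a L \<sigma>) \<longleftrightarrow> B \<pi>"
  shows "weight q n (\<lambda>\<pi>. pattern a L \<pi> = \<sigma> \<and> B \<pi>) = q ^ inv_count L \<sigma> * weight q n (\<lambda>\<pi>. pattern a L \<pi> = id \<and> B \<pi>)"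
proof -
  let ?\<tau> = "window_perm a L \<sigma>"
  have \<tau>n: "?\<tau> \<in> perms n" by (rule window_perm_in_perms[OF \<sigma> aL])
  have \<tau>p: "?\<tau> permutes {1..n}" by (rule permsD[OF \<tau>n])
  have bij: "bij_betw (\<lambda>\<pi>. \<pi> \<circ> ?\<tau>) {\<pi> \<in> perms n. pattern a L \<pi> = id \<and> B \<pi>} {\<pi> \<in> perms n. pattern a L \<pi> = \<sigma> \<and> B \<pi>}"
  proof (rule bij_betw_byWitness[where f' = "\<lambda>\<pi>. \<pi> \<circ> inv ?\<tau>"])
    show "\<forall>\<pi>\<in>{\<pi> \<in> perms n. pattern a L \<pi> = id \<and> B \<pi>}. \<pi> \<circ> ?\<tau> \<circ> inv ?\<tau> = \<pi>"
      "\<forall>\<pi>\<in>{\<pi> \<in> perms n. pattern a L \<pi> = \<sigma> \<and> B \<pi>}. \<pi> \<circ> inv ?\<tau> \<circ> ?\<tau> = \<pi>"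
      using permutes_inv_o[OF \<tau>p] by (auto simp: comp_assoc)
    show "(\<lambda>\<pi>. \<pi> \<circ> ?\<tau>) ` {\<pi> \<in> perms n. pattern a L \<pi> = id \<and> B \<pi>} \<subseteq> {\<pi> \<in> perms n. pattern a L \<pi> = \<sigma> \<and> B \<pi>}"
      using comp_in_perms \<tau>n B pattern_comp_window_perm[OF \<sigma>] by auto
    show "(\<lambda>\<pi>. \<pi> \<circ> inv ?\<tau>) ` {\<pi> \<in> perms n. pattern a L \<pi> = \<sigma> \<and> B \<pi>} \<subseteq> {\<pi> \<in> perms n. pattern a L \<pi> = id \<and> B \<pi>}"
    proof
      fix x assume "x \<in> (\<lambda>\<pi>. \<pi> \<circ> inv ?\<tau>) ` {\<pi> \<in> perms n. pattern a L \<pi> = \<sigma> \<and> B \<pi>}"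
      then obtain \<pi> where \<pi>: "\<pi> \<in> perms n" "pattern a L \<pi> = \<sigma>" "B \<pi>" "x = \<pi> \<circ> inv ?\<tau>" by auto
      have "inv ?\<tau> \<in> perms n" using permutes_inv[OF \<tau>p] by (simp add: perms_def)
      then have xn: "x \<in> perms n" using \<pi> comp_in_perms by auto
      have x\<tau>: "x \<circ> ?\<tau> = \<pi>" using \<pi> permutes_inv_o[OF \<tau>p] by (simp add: comp_assoc)
      have "pattern a L x \<circ> \<sigma> = \<sigma>" using pattern_comp_window_perm[OF \<sigma>, of a x] x\<tau> \<pi> by simp
      moreover have "surj \<sigma>" using permutes_surj[OF permsD[OF \<sigma>]] .
      ultimately have "pattern a L x = id" by (metis ext id_apply comp_apply surjD)
      then show "x \<in> {\<pi> \<in> perms n. pattern a L \<pi> = id \<and> B \<pi>}" using xn B[OF xn] x\<tau> \<pi> by simp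
    qed
  qed
  have "weight q n (\<lambda>\<pi>. pattern a L \<pi> = \<sigma> \<and> B \<pi>) =
      (\<Sum>\<pi> | \<pi> \<in> perms n \<and> pattern a L \<pi> = id \<and> B \<pi>. q ^ inv_count n (\<pi> \<circ> ?\<tau>))"
    unfolding weight_def by (rule sum.reindex_bij_betw[OF bij, symmetric])
  also have "\<dots> = (\<Sum>\<pi> | \<pi> \<in> perms n \<and> pattern a L \<pi> = id \<and> B \<pi>. q ^ inv_count L \<sigma> * q ^ inv_count n \<pi>)"
  proof (rule sum.cong[OF refl])
    fix \<pi> assume "\<pi> \<in> {\<pi>. \<pi> \<in> perms n \<and> pattern a L \<pi> = id \<and> B \<pi>}"
    then have \<pi>: "\<pi> \<in> perms n" "pattern a L \<pi> = id" by auto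
    have "\<pi> i < \<pi> j" if "a < i" "i < j" "j \<le> a + L" for i j
    proof -
      have "i - a \<in> {1..L}" "j - a \<in> {1..L}" "i - a < j - a" using that by auto
      then show ?thesis using pattern_less_iff[OF perms_inj[OF \<pi>(1)], of "i - a" L "j - a" a] \<pi>(2) that by simp
    qed
    then show "q ^ inv_count n (\<pi> \<circ> ?\<tau>) = q ^ inv_count L \<sigma> * q ^ inv_count n \<pi>"
      using inv_count_comp_window_perm[OF \<pi>(1) \<sigma> aL] by (simp add: power_add)
  qed
  finally show ?thesis by (simp add: weight_def sum_distrib_left)
qed

text \<open>
  Mallows measures are consistent: restricting to a window of positions gives the Mallows measure
  of the size of the window, since by \<open>weight_pattern\<close> the probabilities are proportional
  to \<open>q ^ inv_count L \<sigma>\<close>.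
\<close>

theorem map_pattern_Mal:
  assumes q: "0 < q" and aL: "a + L \<le> n"
  shows "map_pmf (pattern a L) (Mal q n) = Mal q L"
proof -
  define K where "K = weight q n (\<lambda>\<pi>. pattern a L \<pi> = id) / weight q n (\<lambda>_. True)"
  let ?M = "map_pmf (pattern a L) (Mal q n)"
  have pm: "pmf ?M \<sigma> = K * q ^ inv_count L \<sigma>" if "\<sigma> \<in> perms L" for \<sigma>
  proof -
    have "pmf ?M \<sigma> = measure_pmf.prob (Mal q n) {\<pi>. pattern a L \<pi> = \<sigma>}"
      by (simp add: pmf_map vimage_def)
    then show ?thesis
      using weight_pattern[OF that aL, of "\<lambda>_. True" q] by (simp add: prob_Mal[OF q] K_def)
  qed
  have sub: "set_pmf ?M \<subseteq> perms L" using pattern_in_perms perms_inj by (auto simp: set_Mal[OF q])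
  have "1 = (\<Sum>\<sigma>\<in>perms L. pmf ?M \<sigma>)" by (rule sum_pmf_eq_1[OF finite_perms sub, symmetric])
  also have "\<dots> = K * weight q L (\<lambda>_. True)" by (simp add: pm weight_True sum_distrib_left)
  finally have K: "K = 1 / weight q L (\<lambda>_. True)" using weight_True_pos[OF q, of L] by (simp add: field_simps)
  show ?thesis
  proof (rule pmf_eqI)
    fix \<sigma>
    show "pmf ?M \<sigma> = pmf (Mal q L) \<sigma>"
    proof (cases "\<sigma> \<in> perms L")
      case True
      then show ?thesis using pm K by (simp add: pmf_Mal[OF q] weight_True)
    next
      case False
      then have "\<sigma> \<notin> set_pmf ?M" using sub by blast
      then show ?thesis using False by (simp add: pmf_Mal[OF q] pmf_eq_0_set_pmf)
    qed
  qed
qed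

section \<open>Inserting the last element and reflecting\<close>

lemma prob_pmf_mono:
  assumes "\<And>x. x \<in> set_pmf p \<Longrightarrow> x \<in> A \<Longrightarrow> x \<in> B"
  shows "measure_pmf.prob p A \<le> measure_pmf.prob p B"
  by (rule measure_pmf.finite_measure_mono_AE) (auto simp: AE_measure_pmf_iff assms)

text \<open>
  The effect on the values of appending a new last position \<open>Suc n\<close> which takes the value
  \<open>Suc n - k\<close> and thereby creates \<open>k\<close> inversions.
\<close>

definition insert_value :: "nat \<Rightarrow> nat \<Rightarrow> nat \<Rightarrow> nat" where
  "insert_value n k v = (if v = Suc n then Suc n - k else if Suc n - k \<le> v \<and> v \<le> n then Suc v else v)"

lemma insert_value_less_iff: "v \<le> n \<Longrightarrow> w \<le> n \<Longrightarrow> insert_value n k v < insert_value n k w \<longleftrightarrow> v < w"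
  by (auto simp: insert_value_def)

lemma insert_value_in_perms:
  assumes "k \<le> n"
  shows "insert_value n k \<in> perms (Suc n)"
  unfolding perms_def mem_Collect_eq
proof (rule bij_imp_permutes)
  have "inj_on (insert_value n k) {1..Suc n}" by (auto simp: inj_on_def insert_value_def split: if_splits)
  moreover have "insert_value n k ` {1..Suc n} \<subseteq> {1..Suc n}" using assms by (auto simp: insert_value_def)
  ultimately show "bij_betw (insert_value n k) {1..Suc n} {1..Suc n}" by (simp add: bij_betw_def endo_inj_surj)
qed (use assms in \<open>auto simp: insert_value_def\<close>)

lemma perms_Suc_subset: "perms n \<subseteq> perms (Suc n)"
  unfolding perms_def by (auto intro: permutes_subset)

lemma perms_fix: "\<pi> \<in> perms n \<Longrightarrow> n < i \<Longrightarrow> \<pi> i = i"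
  by (auto simp: perms_def permutes_def)

lemma inv_count_insert_value:
  assumes \<pi>: "\<pi> \<in> perms n" and k: "k \<le> n"
  shows "inv_count (Suc n) (insert_value n k \<circ> \<pi>) = inv_count n \<pi> + k"
proof -
  let ?A = "{(i, j). 1 \<le> i \<and> i < j \<and> j \<le> n \<and> \<pi> j < \<pi> i}"
  let ?B = "(\<lambda>i. (i, Suc n)) ` {i \<in> {1..n}. Suc n - k \<le> \<pi> i}"
  have r: "\<pi> i \<le> n" if "1 \<le> i" "i \<le> n" for i using perms_range[OF \<pi>] that by blast
  have "{(i, j). 1 \<le> i \<and> i < j \<and> j \<le> Suc n \<and> (insert_value n k \<circ> \<pi>) j < (insert_value n k \<circ> \<pi>) i} = ?A \<union> ?B"
  proof (intro set_eqI iffI)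
    fix p assume "p \<in> {(i, j). 1 \<le> i \<and> i < j \<and> j \<le> Suc n \<and> (insert_value n k \<circ> \<pi>) j < (insert_value n k \<circ> \<pi>) i}"
    then obtain i j where p: "p = (i, j)" "1 \<le> i" "i < j" "j \<le> Suc n" "insert_value n k (\<pi> j) < insert_value n k (\<pi> i)" by auto
    show "p \<in> ?A \<union> ?B"
    proof (cases "j = Suc n")
      case True
      then have "\<pi> j = Suc n" using perms_fix[OF \<pi>] by simp
      then have "Suc n - k \<le> \<pi> i" using p(5) by (simp add: insert_value_def split: if_splits)
      then show ?thesis using p True by auto
    next
      case False
      then have "\<pi> j < \<pi> i" using p insert_value_less_iff[OF r r, of j i k] by auto
      then show ?thesis using p False by auto
    qed
  next
    fix p assume "p \<in> ?A \<union> ?B"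
    then consider i j where "p = (i, j)" "1 \<le> i" "i < j" "j \<le> n" "\<pi> j < \<pi> i"
      | i where "p = (i, Suc n)" "1 \<le> i" "i \<le> n" "Suc n - k \<le> \<pi> i" by auto
    then show "p \<in> {(i, j). 1 \<le> i \<and> i < j \<and> j \<le> Suc n \<and> (insert_value n k \<circ> \<pi>) j < (insert_value n k \<circ> \<pi>) i}"
    proof cases
      case 1
      then show ?thesis using insert_value_less_iff[OF r r, of j i k] by auto
    next
      case 2
      then show ?thesis using perms_fix[OF \<pi>, of "Suc n"] r[of i] by (auto simp: insert_value_def)
    qed
  qed
  then have "inv_count (Suc n) (insert_value n k \<circ> \<pi>) = card (?A \<union> ?B)" by (simp only: inv_count_def)
  also have "\<dots> = card ?A + card ?B"
  proof (rule card_Un_disjoint)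
    show "finite ?A" by (rule finite_subset[of _ "{1..n} \<times> {1..n}"]) auto
  qed auto
  also have "card ?B = card {i \<in> {1..n}. Suc n - k \<le> \<pi> i}" by (rule card_image) (auto simp: inj_on_def)
  also have "\<dots> = card (\<pi> ` {i \<in> {1..n}. Suc n - k \<le> \<pi> i})"
    by (rule card_image[symmetric], rule inj_on_subset[OF perms_inj[OF \<pi>]]) simp
  also have "\<pi> ` {i \<in> {1..n}. Suc n - k \<le> \<pi> i} = {v \<in> \<pi> ` {1..n}. Suc n - k \<le> v}" by auto
  also have "\<pi> ` {1..n} = {1..n}" by (rule permutes_image[OF permsD[OF \<pi>]])
  also have "{v \<in> {1..n}. Suc n - k \<le> v} = {Suc n - k..n}" using k by auto
  finally show ?thesis using k by (simp add: inv_count_def)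
qed

lemma bij_insert_value: "bij_betw (\<lambda>(k, \<pi>). insert_value n k \<circ> \<pi>) ({..n} \<times> perms n) (perms (Suc n))"
proof -
  let ?F = "\<lambda>(k, \<pi>). insert_value n k \<circ> \<pi>"
  have "inj_on ?F ({..n} \<times> perms n)"
  proof (rule inj_onI)
    fix x y assume x: "x \<in> {..n} \<times> perms n" and y: "y \<in> {..n} \<times> perms n" and e: "?F x = ?F y"
    obtain k \<pi> k' \<pi>' where xy: "x = (k, \<pi>)" "y = (k', \<pi>')" by (metis surj_pair)
    have m: "k \<le> n" "k' \<le> n" "\<pi> \<in> perms n" "\<pi>' \<in> perms n" using x y xy by auto
    have e': "insert_value n k (\<pi> i) = insert_value n k' (\<pi>' i)" for i using e unfolding xy by (simp add: fun_eq_iff)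
    have "\<pi> (Suc n) = Suc n" "\<pi>' (Suc n) = Suc n" using m perms_fix by auto
    then have k: "k = k'" using e'[of "Suc n"] m by (simp add: insert_value_def)
    have "\<pi> i = \<pi>' i" for i using e'[of i] perms_eq_iff[OF insert_value_in_perms[OF m(1)]] by (simp add: k)
    then show "x = y" using k xy by auto
  qed
  moreover have "?F ` ({..n} \<times> perms n) = perms (Suc n)"
  proof (rule card_subset_eq)
    show "?F ` ({..n} \<times> perms n) \<subseteq> perms (Suc n)"
      using insert_value_in_perms perms_Suc_subset by (auto intro!: comp_in_perms)
    have "card (?F ` ({..n} \<times> perms n)) = Suc n * card (perms n)"
      using calculation by (simp add: card_image card_cartesian_product)
    also have "\<dots> = card (perms (Suc n))"
      unfolding perms_def using card_permutations[of "{1..n}" n] card_permutations[of "{1..Suc n}" "Suc n"] by simp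
    finally show "card (?F ` ({..n} \<times> perms n)) = card (perms (Suc n))" .
  qed simp
  ultimately show ?thesis by (simp add: bij_betw_def)
qed

text \<open>
  The recursion behind the product formula for the normaliser: the number \<open>k\<close> of inversions of
  the last position is independent of the pattern before it.
\<close>

lemma weight_Suc: "weight q (Suc n) A = (\<Sum>k\<le>n. q ^ k * weight q n (\<lambda>\<pi>. A (insert_value n k \<circ> \<pi>)))"
proof -
  have "weight q (Suc n) A = (\<Sum>\<pi>\<in>perms (Suc n). q ^ inv_count (Suc n) \<pi> * of_bool (A \<pi>))"
    unfolding weight_def by (rule sum.mono_neutral_cong_left) auto
  also have "\<dots> = (\<Sum>x\<in>{..n} \<times> perms n. case x of (k, \<pi>) \<Rightarrow>
      q ^ inv_count (Suc n) (insert_value n k \<circ> \<pi>) * of_bool (A (insert_value n k \<circ> \<pi>)))"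
    by (subst sum.reindex_bij_betw[OF bij_insert_value, symmetric]) (simp add: case_prod_unfold)
  also have "\<dots> = (\<Sum>k\<le>n. \<Sum>\<pi>\<in>perms n. q ^ k * (q ^ inv_count n \<pi> * of_bool (A (insert_value n k \<circ> \<pi>))))"
    unfolding sum.cartesian_product
    by (rule sum.cong[OF refl]) (auto simp: inv_count_insert_value power_add)
  also have "\<dots> = (\<Sum>k\<le>n. q ^ k * weight q n (\<lambda>\<pi>. A (insert_value n k \<circ> \<pi>)))"
    unfolding sum_distrib_left[symmetric] weight_def
    by (intro sum.cong arg_cong2[where f = "(*)"] refl sum.mono_neutral_cong_right) auto
  finally show ?thesis .
qed

text \<open>
  The number of inversions of the last position has a truncated geometric distribution.
\<close>

lemma prob_last_low:
  assumes q: "0 < q" and n: "1 \<le> n"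
  shows "measure_pmf.prob (Mal q n) {\<pi>. \<pi> n + k \<le> n} \<le> q ^ k"
proof -
  obtain m where m: "n = Suc m" using n by (cases n) auto
  have "weight q (Suc m) (\<lambda>\<pi>. \<pi> (Suc m) + k \<le> Suc m) =
      (\<Sum>j\<le>m. q ^ j * (of_bool (k \<le> j) * weight q m (\<lambda>_. True)))"
  proof (subst weight_Suc, intro sum.cong refl arg_cong2[where f = "(*)"])
    fix j assume "j \<in> {..m}"
    then have "(insert_value m j \<circ> \<pi>) (Suc m) + k \<le> Suc m \<longleftrightarrow> k \<le> j" if "\<pi> \<in> perms m" for \<pi>
      using perms_fix[OF that, of "Suc m"] by (auto simp: insert_value_def)
    then have "weight q m (\<lambda>\<pi>. (insert_value m j \<circ> \<pi>) (Suc m) + k \<le> Suc m) = weight q m (\<lambda>_. k \<le> j)" by (rule weight_cong)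
    also have "\<dots> = of_bool (k \<le> j) * weight q m (\<lambda>_. True)" by (auto simp: weight_def)
    finally show "weight q m (\<lambda>\<pi>. (insert_value m j \<circ> \<pi>) (Suc m) + k \<le> Suc m) = \<dots>" .
  qed
  also have "\<dots> = (\<Sum>j\<le>m. q ^ j * of_bool (k \<le> j)) * weight q m (\<lambda>_. True)"
    unfolding sum_distrib_right by (simp only: mult.assoc)
  also have "\<dots> \<le> (q ^ k * (\<Sum>j\<le>m. q ^ j)) * weight q m (\<lambda>_. True)"
  proof (rule mult_right_mono)
    have "(\<Sum>j\<le>m. q ^ j * of_bool (k \<le> j)) = (\<Sum>j\<in>{k..m}. q ^ j)"
      by (rule sum.mono_neutral_cong_right) auto
    also have "\<dots> = (\<Sum>i\<in>(\<lambda>j. j - k) ` {k..m}. q ^ (k + i))"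
      by (rule sum.reindex_cong[symmetric, of "\<lambda>j. j - k"]) (auto simp: inj_on_def)
    also have "\<dots> \<le> (\<Sum>i\<le>m. q ^ (k + i))" using q by (intro sum_mono2) auto
    finally show "(\<Sum>j\<le>m. q ^ j * of_bool (k \<le> j)) \<le> q ^ k * (\<Sum>j\<le>m. q ^ j)"
      by (simp add: power_add sum_distrib_left)
  qed (use q weight_nonneg in auto)
  also have "\<dots> = q ^ k * weight q (Suc m) (\<lambda>_. True)"
    by (simp add: weight_Suc[of q m "\<lambda>_. True"] sum_distrib_right sum_distrib_left mult.assoc)
  finally show ?thesis
    using weight_True_pos[OF q, of "Suc m"] by (simp add: m prob_Mal[OF q] divide_le_eq)
qed

text \<open>
  Conjugation with this reversal preserves the number of inversions and exchanges the first
  and the last position.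
\<close>

definition reflect :: "nat \<Rightarrow> nat \<Rightarrow> nat" where
  "reflect n i = (if 1 \<le> i \<and> i \<le> n then Suc n - i else i)"

lemma reflect_reflect [simp]: "reflect n (reflect n i) = i"
  by (auto simp: reflect_def)

lemma reflect_in_perms: "reflect n \<in> perms n"
  unfolding perms_def mem_Collect_eq
proof (rule bij_imp_permutes)
  show "bij_betw (reflect n) {1..n} {1..n}"
    by (rule bij_betw_byWitness[of _ "reflect n"]) (auto, auto simp: reflect_def)
qed (auto simp: reflect_def)

lemma inv_count_reflect:
  assumes \<pi>: "\<pi> \<in> perms n"
  shows "inv_count n (reflect n \<circ> \<pi> \<circ> reflect n) = inv_count n \<pi>"
  unfolding inv_count_def
proof (rule bij_betw_same_card[of "\<lambda>(i, j). (reflect n j, reflect n i)"],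
    rule bij_betw_byWitness[where f' = "\<lambda>(i, j). (reflect n j, reflect n i)"])
  have lt: "reflect n j < reflect n i" if "1 \<le> i" "i < j" "j \<le> n" for i j using that by (auto simp: reflect_def)
  have rng: "1 \<le> reflect n i \<and> reflect n i \<le> n" if "1 \<le> i" "i \<le> n" for i using that by (auto simp: reflect_def)
  let ?\<rho> = "reflect n \<circ> \<pi> \<circ> reflect n"
  have main: "\<rho>' (reflect n i) < \<rho>' (reflect n j)"
    if "\<rho> \<in> perms n" "\<rho> j < \<rho> i" "\<rho>' = reflect n \<circ> \<rho> \<circ> reflect n" "1 \<le> i" "i \<le> n" "1 \<le> j" "j \<le> n" for \<rho> \<rho>' i j
    using that lt[of "\<rho> j" "\<rho> i"] perms_range[OF that(1), of i] perms_range[OF that(1), of j] by simp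
  have \<rho>: "?\<rho> \<in> perms n" using \<pi> reflect_in_perms comp_in_perms by blast
  have \<pi>\<rho>: "\<pi> = reflect n \<circ> ?\<rho> \<circ> reflect n" by auto
  show "(\<lambda>(i, j). (reflect n j, reflect n i)) ` {(i, j). 1 \<le> i \<and> i < j \<and> j \<le> n \<and> ?\<rho> j < ?\<rho> i}
      \<subseteq> {(i, j). 1 \<le> i \<and> i < j \<and> j \<le> n \<and> \<pi> j < \<pi> i}"
  proof
    fix p assume "p \<in> (\<lambda>(i, j). (reflect n j, reflect n i)) ` {(i, j). 1 \<le> i \<and> i < j \<and> j \<le> n \<and> ?\<rho> j < ?\<rho> i}"
    then obtain i j where ij: "1 \<le> i" "i < j" "j \<le> n" "?\<rho> j < ?\<rho> i" "p = (reflect n j, reflect n i)"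
      by (auto simp del: o_apply)
    then show "p \<in> {(i, j). 1 \<le> i \<and> i < j \<and> j \<le> n \<and> \<pi> j < \<pi> i}"
      using main[OF \<rho> ij(4) \<pi>\<rho>] lt[of i j] rng[of i] rng[of j] by (auto simp del: o_apply)
  qed
  show "(\<lambda>(i, j). (reflect n j, reflect n i)) ` {(i, j). 1 \<le> i \<and> i < j \<and> j \<le> n \<and> \<pi> j < \<pi> i}
      \<subseteq> {(i, j). 1 \<le> i \<and> i < j \<and> j \<le> n \<and> ?\<rho> j < ?\<rho> i}"
  proof
    fix p assume "p \<in> (\<lambda>(i, j). (reflect n j, reflect n i)) ` {(i, j). 1 \<le> i \<and> i < j \<and> j \<le> n \<and> \<pi> j < \<pi> i}"
    then obtain i j where ij: "1 \<le> i" "i < j" "j \<le> n" "\<pi> j < \<pi> i" "p = (reflect n j, reflect n i)"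
      by (auto simp del: o_apply)
    then show "p \<in> {(i, j). 1 \<le> i \<and> i < j \<and> j \<le> n \<and> ?\<rho> j < ?\<rho> i}"
      using main[OF \<pi> ij(4) refl] lt[of i j] rng[of i] rng[of j] by (auto simp del: o_apply)
  qed
qed auto

lemma weight_reflect: "weight q n (\<lambda>\<pi>. A (reflect n \<circ> \<pi> \<circ> reflect n)) = weight q n A"
proof -
  have ff: "reflect n \<circ> (reflect n \<circ> \<pi> \<circ> reflect n) \<circ> reflect n = \<pi>" for \<pi> by auto
  have m: "reflect n \<circ> \<pi> \<circ> reflect n \<in> perms n" if "\<pi> \<in> perms n" for \<pi>
    using that reflect_in_perms comp_in_perms by blast
  have b: "bij_betw (\<lambda>\<pi>. reflect n \<circ> \<pi> \<circ> reflect n) {\<pi> \<in> perms n. A (reflect n \<circ> \<pi> \<circ> reflect n)} {\<pi> \<in> perms n. A \<pi>}"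
    by (rule bij_betw_byWitness[of _ "\<lambda>\<pi>. reflect n \<circ> \<pi> \<circ> reflect n"])
      (use ff m in \<open>auto simp del: o_apply simp: comp_assoc\<close>)
  show ?thesis
    unfolding weight_def sum.reindex_bij_betw[OF b, symmetric] by (rule sum.cong) (auto simp: inv_count_reflect)
qed

lemma prob_first_high:
  assumes q: "0 < q" and n: "1 \<le> n"
  shows "measure_pmf.prob (Mal q n) {\<pi>. k < \<pi> 1} \<le> q ^ k"
proof -
  have "weight q n (\<lambda>\<pi>. k < \<pi> 1) = weight q n (\<lambda>\<pi>. (reflect n \<circ> \<pi> \<circ> reflect n) n + k \<le> n)"
  proof (rule weight_cong)
    fix \<pi> assume "\<pi> \<in> perms n"
    from perms_range[OF this, of 1] n
    show "k < \<pi> 1 \<longleftrightarrow> (reflect n \<circ> \<pi> \<circ> reflect n) n + k \<le> n" by (auto simp: reflect_def)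
  qed
  also have "\<dots> = weight q n (\<lambda>\<pi>. \<pi> n + k \<le> n)" by (rule weight_reflect)
  finally show ?thesis using prob_last_low[OF q n, of k] by (simp add: prob_Mal[OF q])
qed

text \<open>
  Restrict to the window from \<open>u\<close> to \<open>v\<close>. If its first value exceeds its last one, then either
  the first value is in the upper half or the last one is in the lower half, and both are
  geometrically unlikely.
\<close>

theorem prob_inversion:
  assumes q: "0 < q" and uv: "1 \<le> u" "u < v" "v \<le> n"
  shows "measure_pmf.prob (Mal q n) {\<pi>. \<pi> v < \<pi> u} \<le> 2 * q ^ ((v - u + 1) div 2)"
proof -
  define a L k where "a = u - 1" and "L = v - u + 1" and "k = (v - u + 1) div 2"
  have aL: "a + L \<le> n" "a + 1 = u" "a + L = v" "1 \<le> L" using uv by (auto simp: a_def L_def)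
  have "measure_pmf.prob (Mal q n) {\<pi>. \<pi> v < \<pi> u} \<le> measure_pmf.prob (Mal q n) {\<pi>. pattern a L \<pi> L < pattern a L \<pi> 1}"
  proof (rule prob_pmf_mono)
    fix \<pi> assume "\<pi> \<in> set_pmf (Mal q n)" "\<pi> \<in> {\<pi>. \<pi> v < \<pi> u}"
    then show "\<pi> \<in> {\<pi>. pattern a L \<pi> L < pattern a L \<pi> 1}"
      using pattern_less_iff[of \<pi> L L 1 a] aL perms_inj by (auto simp: set_Mal[OF q])
  qed
  also have "\<dots> = measure_pmf.prob (map_pmf (pattern a L) (Mal q n)) {\<sigma>. \<sigma> L < \<sigma> 1}"
    by (simp add: vimage_def)
  also have "\<dots> = measure_pmf.prob (Mal q L) {\<sigma>. \<sigma> L < \<sigma> 1}"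
    unfolding map_pattern_Mal[OF q aL(1)] ..
  also have "\<dots> \<le> measure_pmf.prob (Mal q L) ({\<sigma>. k < \<sigma> 1} \<union> {\<sigma>. \<sigma> L + k \<le> L})"
    by (intro measure_pmf.finite_measure_mono) (auto simp: k_def L_def)
  also have "\<dots> \<le> measure_pmf.prob (Mal q L) {\<sigma>. k < \<sigma> 1} + measure_pmf.prob (Mal q L) {\<sigma>. \<sigma> L + k \<le> L}"
    by (rule measure_Un_le) auto
  also have "\<dots> \<le> q ^ k + q ^ k"
    by (intro add_mono prob_first_high prob_last_low q aL)
  finally show ?thesis by (simp add: k_def)
qed

section \<open>Probabilities of calm preferences\<close>

text \<open>
  Equivalently, for every level from \<open>c\<close> to \<open>c + R\<close> the positions up to that level have exactly the
  values up to it. For \<open>R\<close> twice the height this implies calmness, and unlike that of calmness its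
  probability can be computed by inserting the positions one after the other.
\<close>

definition sorted_across :: "nat \<Rightarrow> nat \<Rightarrow> nat \<Rightarrow> (nat \<Rightarrow> nat) \<Rightarrow> bool" where
  "sorted_across n c R \<pi> \<longleftrightarrow> (\<forall>u v. 1 \<le> u \<and> u < v \<and> v \<le> n \<and> u \<le> c + R \<and> c < v \<longrightarrow> \<pi> u < \<pi> v)"

lemma sorted_acrossD: "sorted_across n c R \<pi> \<Longrightarrow> 1 \<le> u \<Longrightarrow> u < v \<Longrightarrow> v \<le> n \<Longrightarrow> u \<le> c + R \<Longrightarrow> c < v \<Longrightarrow> \<pi> u < \<pi> v"
  unfolding sorted_across_def by blast

lemma sorted_across_calm: "sorted_across n c (2 * (i - c)) \<pi> \<Longrightarrow> calm n c i \<pi>"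
  unfolding sorted_across_def calm_def by blast

lemma sorted_across_low:
  assumes S: "sorted_across n c R \<pi>" and \<pi>: "\<pi> \<in> perms n" and u: "1 \<le> u" "u \<le> min (c + R) n"
  shows "\<pi> u \<le> min (c + R) n"
proof -
  let ?j = "min (c + R) n"
  have "\<pi> ` {?j<..n} \<subseteq> {\<pi> u<..n}"
  proof clarify
    fix v assume v: "v \<in> {?j<..n}"
    then have "\<pi> u < \<pi> v" using u by (intro sorted_acrossD[OF S]) auto
    then show "\<pi> v \<in> {\<pi> u<..n}" using perms_range[OF \<pi>, of v] v by auto
  qed
  moreover have "inj_on \<pi> {?j<..n}" using perms_inj[OF \<pi>] by (rule inj_on_subset) simp
  ultimately have "card {?j<..n} \<le> card {\<pi> u<..n}" by (intro card_inj_on_le) auto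
  then show ?thesis using perms_range[OF \<pi>, of u] u by auto
qed

lemma sorted_across_insert_value:
  assumes S: "sorted_across n c R \<pi>" and \<pi>: "\<pi> \<in> perms n" and k: "k \<le> n - min (c + R) n"
  shows "sorted_across (Suc n) c R (insert_value n k \<circ> \<pi>)"
  unfolding sorted_across_def
proof (intro allI impI)
  fix u v assume uv: "1 \<le> u \<and> u < v \<and> v \<le> Suc n \<and> u \<le> c + R \<and> c < v"
  show "(insert_value n k \<circ> \<pi>) u < (insert_value n k \<circ> \<pi>) v"
  proof (cases "v = Suc n")
    case True
    have "\<pi> u \<le> min (c + R) n" using sorted_across_low[OF S \<pi>] uv True by auto
    then show ?thesis using True perms_fix[OF \<pi>, of v] k by (auto simp: insert_value_def)
  next
    case False
    then have "\<pi> u \<le> n" "\<pi> v \<le> n" using perms_range[OF \<pi>, of u] perms_range[OF \<pi>, of v] uv by auto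
    moreover have "\<pi> u < \<pi> v" using uv False by (intro sorted_acrossD[OF S]) auto
    ultimately show ?thesis using insert_value_less_iff by simp
  qed
qed

text \<open>
  Position \<open>Suc n\<close> may be inserted below at most \<open>n - min (c + R) n\<close> earlier ones; each step
  therefore costs a factor \<open>1 - q ^ k\<close>, where \<open>k\<close> grows with the distance from \<open>c + R\<close>.
\<close>

lemma weight_sorted_across:
  assumes q: "0 < q" "q < 1"
  shows "(1 - q) ^ min (n - c) R * (\<Prod>k=1..n-(c+R). 1 - q ^ k) * weight q n (\<lambda>_. True) \<le> weight q n (sorted_across n c R)"
proof (induction n)
  case 0
  have "weight q 0 (\<lambda>_. True) = weight q 0 (sorted_across 0 c R)" by (rule weight_cong) (auto simp: sorted_across_def)
  then show ?case by simp
next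
  case (Suc n)
  show ?case
  proof (cases "n < c")
    case True
    have "weight q (Suc n) (\<lambda>_. True) = weight q (Suc n) (sorted_across (Suc n) c R)"
      by (rule weight_cong) (use True in \<open>auto simp: sorted_across_def\<close>)
    then show ?thesis using True by simp
  next
    case False
    define j where "j = min (c + R) n"
    define lb where "lb n = (1 - q) ^ min (n - c) R * (\<Prod>k=1..n-(c+R). 1 - q ^ k)" for n
    let ?g = "\<lambda>m. \<Sum>k\<le>m. q ^ k"
    have lb0: "0 \<le> lb n" for n
      unfolding lb_def using q by (intro mult_nonneg_nonneg prod_nonneg) (auto simp: power_le_one)
    have lb: "lb (Suc n) = lb n * (1 - q ^ Suc (n - j))"
    proof (cases "n < c + R")
      case True
      then have "min (Suc n - c) R = Suc (min (n - c) R)" "Suc n - (c + R) = 0" "n - j = 0"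
        using False by (auto simp: j_def)
      then show ?thesis using True by (simp add: lb_def)
    next
      case f: False
      then have "min (Suc n - c) R = min (n - c) R" "Suc n - (c + R) = Suc (n - j)" "n - (c + R) = n - j"
        using False by (auto simp: j_def)
      then show ?thesis by (simp add: lb_def)
    qed
    have geo: "(1 - q) * ?g m = 1 - q ^ Suc m" for m by (rule sum_gp_basic)
    have "(1 - q) * ((1 - q ^ Suc (n - j)) * ?g n) = (1 - q ^ Suc (n - j)) * (1 - q ^ Suc n)"
      using geo[of n] by (metis mult.left_commute)
    also have "\<dots> \<le> 1 - q ^ Suc (n - j)"
      using q by (intro mult_right_le_one_le) (simp_all add: power_le_one del: power_Suc)
    also have "\<dots> = (1 - q) * ?g (n - j)" by (rule geo[symmetric])
    finally have g: "(1 - q ^ Suc (n - j)) * ?g n \<le> ?g (n - j)" using q by simp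
    have "lb (Suc n) * weight q (Suc n) (\<lambda>_. True) = (lb n * weight q n (\<lambda>_. True)) * ((1 - q ^ Suc (n - j)) * ?g n)"
      by (simp add: weight_Suc[of q n "\<lambda>_. True"] lb sum_distrib_right[symmetric])
    also have "\<dots> \<le> (lb n * weight q n (\<lambda>_. True)) * ?g (n - j)"
      using g lb0[of n] weight_True_pos[OF q(1), of n] by (intro mult_left_mono) auto
    also have "\<dots> \<le> weight q n (sorted_across n c R) * ?g (n - j)"
      using Suc q by (intro mult_right_mono sum_nonneg) (auto simp: lb_def)
    also have "\<dots> = (\<Sum>k\<le>n - j. q ^ k * weight q n (sorted_across n c R))"
      by (simp add: sum_distrib_right mult.commute)
    also have "\<dots> \<le> (\<Sum>k\<le>n - j. q ^ k * weight q n (\<lambda>\<pi>. sorted_across (Suc n) c R (insert_value n k \<circ> \<pi>)))"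
      using q by (intro sum_mono mult_left_mono weight_mono sorted_across_insert_value) (auto simp: j_def)
    also have "\<dots> \<le> (\<Sum>k\<le>n. q ^ k * weight q n (\<lambda>\<pi>. sorted_across (Suc n) c R (insert_value n k \<circ> \<pi>)))"
      using q weight_nonneg[of q] by (intro sum_mono2) auto
    also have "\<dots> = weight q (Suc n) (sorted_across (Suc n) c R)" by (rule weight_Suc[symmetric])
    finally show ?thesis by (simp only: lb_def)
  qed
qed

lemma sum_power_le_geometric:
  fixes t :: real
  assumes "0 < t" "t < 1" "finite F" "inj_on f F"
  shows "(\<Sum>x\<in>F. t ^ f x) \<le> 1 / (1 - t)"
proof -
  have "(\<Sum>x\<in>F. t ^ f x) = (\<Sum>i\<in>f ` F. t ^ i)" using assms by (simp add: sum.reindex)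
  also have "\<dots> \<le> (\<Sum>i. t ^ i)" using assms by (intro sum_le_suminf summable_geometric) auto
  also have "\<dots> = 1 / (1 - t)" using assms by (intro suminf_geometric) auto
  finally show ?thesis .
qed

text \<open>
  The exponential is a lower bound for the infinite product of the factors \<open>1 - q ^ k\<close>.
\<close>

definition \<kappa> :: "real \<Rightarrow> nat \<Rightarrow> real" where
  "\<kappa> q R = (1 - q) ^ R * exp (- (1 / (1 - q)\<^sup>2))"

lemma \<kappa>_pos: "q < 1 \<Longrightarrow> 0 < \<kappa> q R"
  by (simp add: \<kappa>_def)

lemma \<kappa>_antimono: "q \<le> q1 \<Longrightarrow> q1 < 1 \<Longrightarrow> \<kappa> q1 R \<le> \<kappa> q R"
  unfolding \<kappa>_def by (intro mult_mono power_mono) (auto intro!: divide_left_mono power_mono)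

text \<open>
  Since \<open>1 / (1 - x) = 1 + x / (1 - x) \<le> exp (x / (1 - x))\<close>, the product is controlled by a
  geometric series.
\<close>

lemma prod_one_minus_power_ge:
  fixes q :: real
  assumes q: "0 < q" "q < 1"
  shows "exp (- (1 / (1 - q)\<^sup>2)) \<le> (\<Prod>k=1..m. 1 - q ^ k)"
proof -
  have "(\<Sum>k=1..m. q ^ k / (1 - q)) = (\<Sum>k=1..m. q ^ k) / (1 - q)" by (simp add: sum_divide_distrib)
  also have "\<dots> \<le> (1 / (1 - q)) / (1 - q)"
    using q sum_power_le_geometric[OF q, of "{1..m}" "\<lambda>k. k"] by (intro divide_right_mono) auto
  finally have "exp (- (1 / (1 - q)\<^sup>2)) \<le> exp (- (\<Sum>k=1..m. q ^ k / (1 - q)))"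
    using q by (simp add: power2_eq_square)
  also have "\<dots> = (\<Prod>k=1..m. exp (- (q ^ k / (1 - q))))"
    by (simp add: exp_sum[symmetric] sum_negf)
  also have "\<dots> \<le> (\<Prod>k=1..m. 1 - q ^ k)"
  proof (rule prod_mono, intro conjI)
    fix k assume k: "k \<in> {1..m}"
    let ?x = "q ^ k"
    have x: "0 < ?x" "?x \<le> q" using q k power_decreasing[of 1 k q] by auto
    then have "1 / (1 - ?x) = 1 + ?x / (1 - ?x)" using q by (simp add: field_simps)
    also have "\<dots> \<le> exp (?x / (1 - ?x))" by (rule exp_ge_add_one_self)
    also have "\<dots> \<le> exp (?x / (1 - q))" using x q by (simp add: frac_le)
    finally have "exp (- (?x / (1 - q))) \<le> 1 - ?x"
      using x q by (simp add: exp_minus field_simps)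
    then show "exp (- (q ^ k / (1 - q))) \<le> 1 - q ^ k" .
  qed simp
  finally show ?thesis .
qed

theorem prob_sorted_across:
  assumes q: "0 < q" "q < 1"
  shows "\<kappa> q R \<le> measure_pmf.prob (Mal q n) {\<pi>. sorted_across n c R \<pi>}"
proof -
  have "\<kappa> q R \<le> (1 - q) ^ min (n - c) R * (\<Prod>k=1..n-(c+R). 1 - q ^ k)"
    unfolding \<kappa>_def using q
    by (intro mult_mono power_decreasing prod_one_minus_power_ge) auto
  also have "\<dots> \<le> weight q n (sorted_across n c R) / weight q n (\<lambda>_. True)"
    using weight_sorted_across[OF q, of n c R] weight_True_pos[OF q(1), of n] by (simp add: le_divide_eq)
  finally show ?thesis by (simp add: prob_Mal[OF q(1)])
qed

lemma prob_calm:
  assumes q: "0 < q" "q < 1"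
  shows "\<kappa> q (2 * (i - c)) \<le> measure_pmf.prob (Mal q n) {\<pi>. calm n c i \<pi>}"
  using prob_sorted_across[OF q] by (rule order_trans) (rule prob_pmf_mono, use sorted_across_calm in auto)

text \<open>
  A union bound over all inversions that calmness excludes. Each has probability at most
  \<open>2 * t ^ (16 * (v - u))\<close>; half of the exponent absorbs the height \<open>i - c \<le> 8 * (v - u)\<close>, and the
  rest makes the sum over the pairs converge. Taking \<open>t ^ 32\<close> as an upper bound for \<open>q\<close> keeps the
  estimate uniform over small \<open>q\<close>.
\<close>

theorem prob_not_calm:
  assumes q: "0 < q" "q \<le> t ^ 32" and t: "0 < t" "t < 1"
  shows "measure_pmf.prob (Mal q n) {\<pi>. \<not> calm n c i \<pi>} \<le> 2 * (2 * real (i - c) + 1) * t ^ (i - c) / (1 - t)\<^sup>2"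
proof -
  define l where "l = i - c"
  let ?S = "{(u, v). 1 \<le> u \<and> u < v \<and> v \<le> n \<and> c < v \<and> u \<le> c + 2 * l \<and> l \<le> 8 * (v - u)}"
  let ?T = "SIGMA u:{1..c + 2 * l}. {max u c<..n}"
  have fin: "finite ?S" by (rule finite_subset[of _ "{1..n} \<times> {1..n}"]) auto
  have "measure_pmf.prob (Mal q n) {\<pi>. \<not> calm n c i \<pi>} \<le>
      measure_pmf.prob (Mal q n) (\<Union>p\<in>?S. {\<pi>. \<pi> (snd p) < \<pi> (fst p)})"
  proof (rule prob_pmf_mono)
    fix \<pi> assume \<pi>: "\<pi> \<in> set_pmf (Mal q n)" "\<pi> \<in> {\<pi>. \<not> calm n c i \<pi>}"
    then obtain u v where "(u, v) \<in> ?S" "\<not> \<pi> u < \<pi> v" by (auto simp: calm_def l_def)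
    moreover from this have "\<pi> v \<noteq> \<pi> u" using \<pi> perms_eq_iff by (auto simp: set_Mal[OF q(1)])
    ultimately show "\<pi> \<in> (\<Union>p\<in>?S. {\<pi>. \<pi> (snd p) < \<pi> (fst p)})" by fastforce
  qed
  also have "\<dots> \<le> (\<Sum>p\<in>?S. measure_pmf.prob (Mal q n) {\<pi>. \<pi> (snd p) < \<pi> (fst p)})"
    by (intro measure_pmf.finite_measure_subadditive_finite fin) auto
  also have "\<dots> \<le> (\<Sum>p\<in>?S. 2 * t ^ l * t ^ (snd p - fst p))"
  proof (rule sum_mono)
    fix p assume "p \<in> ?S"
    then obtain u v where p: "p = (u, v)" "1 \<le> u" "u < v" "v \<le> n" "l \<le> 8 * (v - u)" by auto
    have "measure_pmf.prob (Mal q n) {\<pi>. \<pi> v < \<pi> u} \<le> 2 * q ^ ((v - u + 1) div 2)"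
      by (rule prob_inversion[OF q(1) p(2-4)])
    also have "q ^ ((v - u + 1) div 2) \<le> (t ^ 32) ^ ((v - u + 1) div 2)"
      using q by (intro power_mono) auto
    also have "\<dots> = t ^ (32 * ((v - u + 1) div 2))" by (simp add: power_mult)
    also have "\<dots> \<le> t ^ (l + (v - u))"
      using t p by (intro power_decreasing) auto
    also have "2 * t ^ (l + (v - u)) = 2 * t ^ l * t ^ (v - u)" by (simp only: power_add mult.assoc)
    finally show "measure_pmf.prob (Mal q n) {\<pi>. \<pi> (snd p) < \<pi> (fst p)} \<le> 2 * t ^ l * t ^ (snd p - fst p)"
      using p by simp
  qed
  also have "\<dots> \<le> (\<Sum>p\<in>?T. 2 * t ^ l * t ^ (snd p - fst p))"
    using t by (intro sum_mono2) (auto intro!: finite_SigmaI)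
  also have "\<dots> = 2 * t ^ l * (\<Sum>u\<in>{1..c + 2 * l}. \<Sum>v\<in>{max u c<..n}. t ^ (v - u))"
    by (simp add: sum_distrib_left[symmetric] sum.Sigma case_prod_unfold)
  finally have main: "measure_pmf.prob (Mal q n) {\<pi>. \<not> calm n c i \<pi>} \<le>
      2 * t ^ l * (\<Sum>u\<in>{1..c + 2 * l}. \<Sum>v\<in>{max u c<..n}. t ^ (v - u))" .
  have "(\<Sum>u\<in>{1..c + 2 * l}. t ^ (max u c - u)) =
      (\<Sum>u\<in>{1..c}. t ^ (max u c - u)) + (\<Sum>u\<in>{c + 1..c + 2 * l}. t ^ (max u c - u))"
    by (subst sum.union_disjoint[symmetric]) (auto intro!: sum.cong)
  also have "(\<Sum>u\<in>{1..c}. t ^ (max u c - u)) = (\<Sum>u\<in>{1..c}. t ^ (c - u))"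
    by (intro sum.cong) (auto simp: max_def)
  also have "(\<Sum>u\<in>{c + 1..c + 2 * l}. t ^ (max u c - u)) = 2 * real l"
    by (simp add: max_def)
  also have "(\<Sum>u\<in>{1..c}. t ^ (c - u)) + 2 * real l \<le> 1 / (1 - t) + 2 * real l"
    using t by (intro add_right_mono sum_power_le_geometric) (auto simp: inj_on_def)
  also have "\<dots> \<le> (2 * real l + 1) * (1 / (1 - t))"
    using t mult_right_mono[of t 1 "real l"] by (simp add: field_simps)
  finally have outer: "(\<Sum>u\<in>{1..c + 2 * l}. t ^ (max u c - u)) \<le> (2 * real l + 1) * (1 / (1 - t))" .
  have "(\<Sum>u\<in>{1..c + 2 * l}. \<Sum>v\<in>{max u c<..n}. t ^ (v - u)) \<le>
      (\<Sum>u\<in>{1..c + 2 * l}. t ^ (max u c - u) * (1 / (1 - t)))"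
  proof (rule sum_mono)
    fix u
    have "(\<Sum>v\<in>{max u c<..n}. t ^ (v - u)) = (\<Sum>v\<in>{max u c<..n}. t ^ (max u c - u) * t ^ (v - max u c))"
      by (intro sum.cong refl) (auto simp: power_add[symmetric] intro!: arg_cong[where f = "(^) t"])
    also have "\<dots> \<le> t ^ (max u c - u) * (1 / (1 - t))"
      unfolding sum_distrib_left[symmetric] using t
      by (intro mult_left_mono sum_power_le_geometric) (auto simp: inj_on_def)
    finally show "(\<Sum>v\<in>{max u c<..n}. t ^ (v - u)) \<le> t ^ (max u c - u) * (1 / (1 - t))" .
  qed
  also have "\<dots> = (\<Sum>u\<in>{1..c + 2 * l}. t ^ (max u c - u)) * (1 / (1 - t))"
    by (rule sum_distrib_right[symmetric])
  also have "\<dots> \<le> (2 * real l + 1) * (1 / (1 - t)) * (1 / (1 - t))"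
    using outer t by (intro mult_right_mono) auto
  finally have "2 * t ^ l * (\<Sum>u\<in>{1..c + 2 * l}. \<Sum>v\<in>{max u c<..n}. t ^ (v - u)) \<le>
      2 * t ^ l * ((2 * real l + 1) * (1 / (1 - t)) * (1 / (1 - t)))"
    using t by (intro mult_left_mono) auto
  also have "\<dots> = 2 * (2 * real (i - c) + 1) * t ^ (i - c) / (1 - t)\<^sup>2"
    by (simp add: l_def power2_eq_square)
  finally show ?thesis using main by (rule order_trans[rotated])
qed

text \<open>
  What the four members of a gadget have in common. The order of \<open>s + 1\<close> and \<open>s + 2\<close> differs
  among them and is prescribed separately.
\<close>

definition top_pair :: "nat \<Rightarrow> (nat \<Rightarrow> nat) \<Rightarrow> bool" where
  "top_pair s \<pi> \<longleftrightarrow> (\<forall>j\<in>{1..s}. \<forall>v\<in>{s + 1, s + 2}. \<pi> j < \<pi> v)"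

lemma sorted_across_top_pair:
  assumes "sorted_across n s 2 \<pi>" "s + 2 \<le> n"
  shows "top_pair s \<pi>" "\<pi> (s + 1) < \<pi> (s + 2)"
proof -
  show "top_pair s \<pi>"
    unfolding top_pair_def
  proof (intro ballI)
    fix j v assume "j \<in> {1..s}" "v \<in> {s + 1, s + 2}"
    then have "1 \<le> j" "j < v" "v \<le> n" "j \<le> s + 2" "s < v" using assms(2) by auto
    then show "\<pi> j < \<pi> v" by (rule sorted_acrossD[OF assms(1)])
  qed
  show "\<pi> (s + 1) < \<pi> (s + 2)" by (rule sorted_acrossD[OF assms(1)]) (use assms(2) in simp_all)
qed

lemma prob_top_pair_inc:
  assumes q: "0 < q" "q < 1" and s: "s + 2 \<le> n"
  shows "\<kappa> q 2 \<le> measure_pmf.prob (Mal q n) {\<pi>. top_pair s \<pi> \<and> \<pi> (s + 1) < \<pi> (s + 2)}"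
proof -
  have "\<kappa> q 2 \<le> measure_pmf.prob (Mal q n) {\<pi>. sorted_across n s 2 \<pi>}" by (rule prob_sorted_across[OF q])
  also have "\<dots> \<le> measure_pmf.prob (Mal q n) {\<pi>. top_pair s \<pi> \<and> \<pi> (s + 1) < \<pi> (s + 2)}"
    by (rule prob_pmf_mono) (use sorted_across_top_pair s in blast)
  finally show ?thesis .
qed

text \<open>
  Exchanging the two positions in a permutation in which they increase costs one inversion,
  that is a factor \<open>q\<close>.
\<close>

lemma prob_top_pair_dec:
  assumes q: "0 < q" "q < 1" and s: "s + 2 \<le> n"
  shows "q * \<kappa> q 2 \<le> measure_pmf.prob (Mal q n) {\<pi>. top_pair s \<pi> \<and> \<pi> (s + 2) < \<pi> (s + 1)}"
proof -
  define \<tau> where "\<tau> = Transposition.transpose (1::nat) 2"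
  have \<tau>: "\<tau> \<in> perms 2" unfolding perms_def \<tau>_def by (auto intro: permutes_swap_id)
  have "{(i, j). 1 \<le> i \<and> i < j \<and> j \<le> 2 \<and> \<tau> j < \<tau> i} = {(1, 2)}"
    by (auto simp: \<tau>_def Transposition.transpose_def)
  then have inv: "inv_count 2 \<tau> = 1" unfolding inv_count_def by simp
  have sh: "window_perm s 2 \<tau> (s + 1) = s + 2" "window_perm s 2 \<tau> (s + 2) = s + 1" "window_perm s 2 \<tau> j = j" if "j \<le> s" for j
    using that by (auto simp: window_perm_def \<tau>_def)
  have B: "top_pair s (\<pi> \<circ> window_perm s 2 \<tau>) \<longleftrightarrow> top_pair s \<pi>" for \<pi>
    using sh by (auto simp: top_pair_def simp del: add_Suc_right)
  have "weight q n (sorted_across n s 2) \<le> weight q n (\<lambda>\<pi>. pattern s 2 \<pi> = id \<and> top_pair s \<pi>)"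
  proof (rule weight_mono)
    fix \<pi> assume \<pi>: "\<pi> \<in> perms n" and S: "sorted_across n s 2 \<pi>"
    have "pattern s 2 \<pi> 1 < pattern s 2 \<pi> 2"
      using pattern_less_iff[OF perms_inj[OF \<pi>], of 1 2 2 s] sorted_across_top_pair(2)[OF S s] by simp
    then have "pattern s 2 \<pi> 1 = 1" "pattern s 2 \<pi> 2 = 2"
      using perms_range[OF pattern_in_perms[OF perms_inj[OF \<pi>]], of 1 2 s] perms_range[OF pattern_in_perms[OF perms_inj[OF \<pi>]], of 2 2 s] by auto
    moreover have "pattern s 2 \<pi> i = i" if "i \<noteq> 1" "i \<noteq> 2" for i
      using that by (auto simp: pattern_def)
    ultimately have "pattern s 2 \<pi> = id" by (metis eq_id_iff)
    moreover have "top_pair s \<pi>" by (rule sorted_across_top_pair(1)[OF S s])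
    ultimately show "pattern s 2 \<pi> = id \<and> top_pair s \<pi>" ..
  qed (use q in simp)
  then have "q * weight q n (sorted_across n s 2) \<le> q ^ inv_count 2 \<tau> * weight q n (\<lambda>\<pi>. pattern s 2 \<pi> = id \<and> top_pair s \<pi>)"
    using q inv by simp
  also have "\<dots> = weight q n (\<lambda>\<pi>. pattern s 2 \<pi> = \<tau> \<and> top_pair s \<pi>)"
    by (rule weight_pattern[where B = "top_pair s", OF \<tau> s B, symmetric])
  also have "\<dots> \<le> weight q n (\<lambda>\<pi>. top_pair s \<pi> \<and> \<pi> (s + 2) < \<pi> (s + 1))"
  proof (rule weight_mono)
    fix \<pi> assume \<pi>: "\<pi> \<in> perms n" and S: "pattern s 2 \<pi> = \<tau> \<and> top_pair s \<pi>"
    have "pattern s 2 \<pi> 2 < pattern s 2 \<pi> 1" using S by (simp add: \<tau>_def)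
    then show "top_pair s \<pi> \<and> \<pi> (s + 2) < \<pi> (s + 1)"
      using S pattern_less_iff[OF perms_inj[OF \<pi>], of 2 2 1 s] by simp
  qed (use q in simp)
  finally have "q * (weight q n (sorted_across n s 2) / weight q n (\<lambda>_. True)) \<le>
      weight q n (\<lambda>\<pi>. top_pair s \<pi> \<and> \<pi> (s + 2) < \<pi> (s + 1)) / weight q n (\<lambda>_. True)"
    using weight_True_pos[OF q(1), of n] by (simp add: divide_right_mono)
  moreover have "q * \<kappa> q 2 \<le> q * (weight q n (sorted_across n s 2) / weight q n (\<lambda>_. True))"
    using prob_sorted_across[OF q, of 2 n s] q unfolding prob_Mal[OF q(1)] by (intro mult_left_mono) auto
  ultimately show ?thesis by (simp add: prob_Mal[OF q(1)])
qed

section \<open>Independence of the persons\<close>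

abbreviation E :: "real \<Rightarrow> nat \<Rightarrow> (pref \<Rightarrow> real) \<Rightarrow> real" where
  "E q n f \<equiv> measure_pmf.expectation (MalPref q n) f"

abbreviation Pr :: "real \<Rightarrow> nat \<Rightarrow> (pref \<Rightarrow> bool) \<Rightarrow> real" where
  "Pr q n A \<equiv> measure_pmf.prob (MalPref q n) {P. A P}"

lemma set_MalPref: "0 < q \<Longrightarrow> set_pmf (MalPref q n) = PiE_dflt (Omega n) id (\<lambda>_. perms n)"
  unfolding MalPref_def by (simp add: set_Pi_pmf set_Mal o_def)

lemma finite_set_MalPref: "0 < q \<Longrightarrow> finite (set_pmf (MalPref q n))"
  by (simp add: set_MalPref finite_PiE_dflt)

lemma integrable_MalPref: "0 < q \<Longrightarrow> integrable (measure_pmf (MalPref q n)) (f :: pref \<Rightarrow> real)"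
  by (intro integrable_measure_pmf_finite finite_set_MalPref)

lemma MalPref_perm: "0 < q \<Longrightarrow> P \<in> set_pmf (MalPref q n) \<Longrightarrow> P x \<in> perms n"
  by (cases "x \<in> Omega n") (simp_all add: set_MalPref PiE_dflt_def del: split_paired_All)

lemma MalPref_strict_pref: "0 < q \<Longrightarrow> P \<in> set_pmf (MalPref q n) \<Longrightarrow> strict_pref P"
  unfolding strict_pref_def using MalPref_perm perms_inj by blast

lemma Pr_eq_E: "Pr q n A = E q n (\<lambda>P. of_bool (A P))"
proof -
  have "(\<lambda>P. of_bool (A P)) = (indicator {P. A P} :: pref \<Rightarrow> real)" by (auto simp: indicator_def)
  then show ?thesis by simp
qed

lemma E_mono:
  assumes "0 < q" "\<And>P. P \<in> set_pmf (MalPref q n) \<Longrightarrow> f P \<le> g P"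
  shows "E q n f \<le> E q n g"
  using assms by (intro integral_mono_AE integrable_MalPref) (auto simp: AE_measure_pmf_iff)

definition depends_on :: "person set \<Rightarrow> (pref \<Rightarrow> 'b) \<Rightarrow> bool" where
  "depends_on S f \<longleftrightarrow> (\<forall>P P'. (\<forall>x\<in>S. P x = P' x) \<longrightarrow> f P = f P')"

lemma depends_onD: "depends_on S f \<Longrightarrow> (\<And>x. x \<in> S \<Longrightarrow> P x = P' x) \<Longrightarrow> f P = f P'"
  unfolding depends_on_def by blast

lemma depends_on_comp: "depends_on S f \<Longrightarrow> depends_on S (\<lambda>P. h (f P))"
  unfolding depends_on_def by (intro allI impI arg_cong[where f = h]) blast

lemma E_indep:
  fixes f g :: "pref \<Rightarrow> real"
  assumes q: "0 < q" and S: "S \<subseteq> Omega n" and f: "depends_on S f" and g: "depends_on T g" and ST: "S \<inter> T = {}"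
  shows "E q n (\<lambda>P. f P * g P) = E q n f * E q n g"
proof -
  let ?A = "Pi_pmf S id (\<lambda>_. Mal q n)" and ?B = "Pi_pmf (Omega n - S) id (\<lambda>_. Mal q n)"
  let ?h = "\<lambda>(a, b) x. if x \<in> S then a x else b x"
  have finS: "finite S" using S by (rule finite_subset) simp
  have M: "MalPref q n = map_pmf ?h (pair_pmf ?A ?B)"
    unfolding MalPref_def using Pi_pmf_union[OF finS, of "Omega n - S"] S by (simp add: Un_absorb1)
  have finA: "finite (set_pmf ?A)" and finB: "finite (set_pmf ?B)"
    using finS by (auto simp: set_Pi_pmf set_Mal[OF q] o_def)
  have fh: "f (\<lambda>x. if x \<in> S then a x else b x) = f a" for a b by (rule depends_onD[OF f]) simp
  have gh: "g (\<lambda>x. if x \<in> S then a x else b x) = g b" for a b by (rule depends_onD[OF g]) (use ST in auto)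
  have pair: "measure_pmf.expectation (pair_pmf ?A ?B) (\<lambda>z. u (fst z) * v (snd z)) =
      measure_pmf.expectation ?A u * measure_pmf.expectation ?B v" for u v :: "pref \<Rightarrow> real"
  proof -
    have "measure_pmf.expectation (pair_pmf ?A ?B) (\<lambda>z. u (fst z) * v (snd z)) =
        (\<Sum>z\<in>set_pmf ?A \<times> set_pmf ?B. (u (fst z) * v (snd z)) * pmf (pair_pmf ?A ?B) z)"
      using finA finB by (intro integral_measure_pmf_real) auto
    also have "\<dots> = (\<Sum>a\<in>set_pmf ?A. \<Sum>b\<in>set_pmf ?B. (u a * pmf ?A a) * (v b * pmf ?B b))"
      unfolding sum.cartesian_product by (rule sum.cong) (auto simp: pmf_pair)
    also have "\<dots> = (\<Sum>a\<in>set_pmf ?A. u a * pmf ?A a) * (\<Sum>b\<in>set_pmf ?B. v b * pmf ?B b)"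
      by (rule sum_product[symmetric])
    also have "\<dots> = measure_pmf.expectation ?A u * measure_pmf.expectation ?B v"
      using integral_measure_pmf_real[OF finA, of ?A u] integral_measure_pmf_real[OF finB, of ?B v] by simp
    finally show ?thesis .
  qed
  have "E q n (\<lambda>P. f P * g P) = measure_pmf.expectation (pair_pmf ?A ?B) (\<lambda>z. f (fst z) * g (snd z))"
    unfolding M integral_map_pmf by (rule Bochner_Integration.integral_cong) (auto simp: fh gh split: prod.splits)
  moreover have "E q n f = measure_pmf.expectation ?A f"
  proof -
    have "E q n f = measure_pmf.expectation (pair_pmf ?A ?B) (\<lambda>z. f (fst z))"
      unfolding M integral_map_pmf by (rule Bochner_Integration.integral_cong) (auto simp: fh split: prod.splits)
    then show ?thesis by simp
  qed
  moreover have "E q n g = measure_pmf.expectation ?B g"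
  proof -
    have "E q n g = measure_pmf.expectation (pair_pmf ?A ?B) (\<lambda>z. g (snd z))"
      unfolding M integral_map_pmf by (rule Bochner_Integration.integral_cong) (auto simp: gh split: prod.splits)
    then show ?thesis by simp
  qed
  ultimately show ?thesis using pair by simp
qed

lemma Pr_indep:
  assumes "0 < q" "S \<subseteq> Omega n" "depends_on S A" "depends_on T B" "S \<inter> T = {}"
  shows "Pr q n (\<lambda>P. A P \<and> B P) = Pr q n A * Pr q n B"
proof -
  have "E q n (\<lambda>P. of_bool (A P) * of_bool (B P)) = E q n (\<lambda>P. of_bool (A P)) * E q n (\<lambda>P. of_bool (B P))"
    by (rule E_indep[OF assms(1,2) depends_on_comp[OF assms(3), of of_bool] depends_on_comp[OF assms(4), of of_bool] assms(5)])
  then show ?thesis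
    unfolding Pr_eq_E by (simp add: of_bool_conj)
qed

lemma Pr_all:
  "Pr q n (\<lambda>P. \<forall>x\<in>Omega n. B x (P x)) = (\<Prod>x\<in>Omega n. measure_pmf.prob (Mal q n) {\<pi>. B x \<pi>})"
proof -
  have "{P. \<forall>x\<in>Omega n. B x (P x)} = Pi (Omega n) (\<lambda>x. {\<pi>. B x \<pi>})" by auto
  then show ?thesis unfolding MalPref_def by (simp add: measure_Pi_pmf_Pi)
qed

lemma Pr_one:
  assumes x: "x \<in> Omega n"
  shows "Pr q n (\<lambda>P. B (P x)) = measure_pmf.prob (Mal q n) {\<pi>. B \<pi>}"
proof -
  have "{P. B (P x)} = (\<lambda>P. P x) -` {\<pi>. B \<pi>}" by auto
  then have "Pr q n (\<lambda>P. B (P x)) = measure_pmf.prob (map_pmf (\<lambda>P. P x) (MalPref q n)) {\<pi>. B \<pi>}" by simp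
  also have "map_pmf (\<lambda>P. P x) (MalPref q n) = Mal q n"
    unfolding MalPref_def using Pi_pmf_component[of "Omega n" x id "\<lambda>_. Mal q n"] x by simp
  finally show ?thesis .
qed

section \<open>Calm levels are frequent\<close>

lemma UNIV_gender: "(UNIV :: gender set) = {Man, Woman}"
  by (auto intro: gender.exhaust)

text \<open>
  A bound for the probability that the two persons at height \<open>l\<close> are not both calm, in a form
  whose power series has an elementary sum.
\<close>

definition calm_tail :: "real \<Rightarrow> nat \<Rightarrow> real" where
  "calm_tail t l = 8 / (1 - t)\<^sup>2 * (real (Suc l) * t ^ l)"

lemma calm_tail_nonneg: "0 < t \<Longrightarrow> 0 \<le> calm_tail t l"
  by (simp add: calm_tail_def)

lemma prob_calm_ge:
  assumes "0 < q" "q \<le> t ^ 32" "0 < t" "t < 1"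
  shows "1 - calm_tail t (i - c) / 2 \<le> measure_pmf.prob (Mal q n) {\<pi>. calm n c i \<pi>}"
proof -
  let ?l = "i - c"
  have "2 * (2 * real ?l + 1) * t ^ ?l / (1 - t)\<^sup>2 \<le> calm_tail t ?l / 2"
    unfolding calm_tail_def using assms by (simp add: field_simps divide_right_mono mult_right_mono)
  with prob_not_calm[OF assms, of n c i]
  have "measure_pmf.prob (Mal q n) {\<pi>. \<not> calm n c i \<pi>} \<le> calm_tail t ?l / 2" by linarith
  moreover have "measure_pmf.prob (Mal q n) {\<pi>. \<not> calm n c i \<pi>} = 1 - measure_pmf.prob (Mal q n) {\<pi>. calm n c i \<pi>}"
    using measure_pmf.prob_compl[of "{\<pi>. calm n c i \<pi>}" "Mal q n"] by (simp add: Compl_eq_Diff_UNIV[symmetric] Collect_neg_eq)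
  ultimately show ?thesis by linarith
qed

lemma summable_calm_tail:
  assumes "0 < t" "t * x < 1" "0 < x"
  shows "summable (\<lambda>l. calm_tail t l * x ^ l)"
proof -
  have "summable (\<lambda>l. real (Suc l) * (t * x) ^ l)"
    using geometric_deriv_sums[of "t * x"] assms by (auto simp: sums_iff)
  from summable_mult[OF this, of "8 / (1 - t)\<^sup>2"] show ?thesis
    by (simp only: calm_tail_def power_mult_distrib mult.assoc)
qed

lemma prod_Omega:
  fixes F :: "nat \<Rightarrow> real"
  shows "(\<Prod>x\<in>Omega n. F (fst x)) = (\<Prod>i\<in>{1..n}. (F i)\<^sup>2)"
proof -
  have "(\<Prod>x\<in>Omega n. F (fst x)) = (\<Prod>i\<in>{1..n}. \<Prod>g\<in>(UNIV :: gender set). F i)"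
    unfolding Omega_def prod.cartesian_product by (simp add: case_prod_unfold)
  then show ?thesis by (simp add: UNIV_gender power2_eq_square)
qed

lemma calm_above_iff: "calm_above n c P \<longleftrightarrow> (\<forall>x\<in>Omega n. c < fst x \<longrightarrow> calm n c (fst x) (P x))"
  by (auto simp: calm_above_def Omega_def)

text \<open>
  The persons are independent, so the probability is a product. Far up the factors are close to
  one with summable deviations; the finitely many remaining factors are bounded below by \<open>\<kappa>\<close>.
\<close>

theorem Pr_calm_above:
  assumes t: "0 < t" "t < 1"
  shows "\<exists>p>0. \<forall>q n c. 0 < q \<and> q \<le> t ^ 32 \<longrightarrow> p \<le> Pr q n (calm_above n c)"
proof -
  have q1: "t ^ 32 < 1" using t by (intro power_less_one_iff[THEN iffD2]) auto
  have sm: "summable (calm_tail t)" using summable_calm_tail[of t 1] t by simp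
  obtain N where N: "\<And>m n. N \<le> m \<Longrightarrow> norm (\<Sum>l = m..n. calm_tail t l) < 1 / 2"
    using summable_partial_sum_bound[OF sm, of "1/2"] by auto
  define p where "p = (\<Prod>l\<in>{..<N}. (\<kappa> (t ^ 32) (2 * l))\<^sup>2) / 2"
  have k1: "0 < \<kappa> (t ^ 32) R" "\<kappa> (t ^ 32) R \<le> 1" for R
    using \<kappa>_pos[OF q1] prob_sorted_across[of "t ^ 32" R 0 0] q1 t measure_pmf.prob_le_1
    by (auto intro: order_trans)
  have "0 < p" unfolding p_def using k1 by (intro divide_pos_pos prod_pos zero_less_power) auto
  moreover have "p \<le> Pr q n (calm_above n c)" if q: "0 < q" "q \<le> t ^ 32" for q n c
  proof -
    define a where "a i = measure_pmf.prob (Mal q n) {\<pi>. calm n c i \<pi>}" for i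
    have a01: "0 \<le> a i" "a i \<le> 1" for i by (auto simp: a_def)
    have ak: "\<kappa> (t ^ 32) (2 * (i - c)) \<le> a i" for i
      unfolding a_def using \<kappa>_antimono[OF q(2) q1] prob_calm[of q i c n] q q1 by (meson le_less_trans order_trans)
    have at: "1 - calm_tail t (i - c) \<le> (a i)\<^sup>2" for i
    proof -
      have "(a i)\<^sup>2 \<ge> 1 - 2 * (1 - a i)"
        using zero_le_power2[of "1 - a i"] by (simp add: power2_diff)
      then show ?thesis using prob_calm_ge[OF q t, where i = i and c = c and n = n] by (simp add: a_def)
    qed
    have "Pr q n (calm_above n c) = (\<Prod>x\<in>Omega n. measure_pmf.prob (Mal q n) {\<pi>. c < fst x \<longrightarrow> calm n c (fst x) \<pi>})"
      unfolding calm_above_iff by (rule Pr_all)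
    also have "\<dots> = (\<Prod>i\<in>{1..n}. (measure_pmf.prob (Mal q n) {\<pi>. c < i \<longrightarrow> calm n c i \<pi>})\<^sup>2)"
      by (rule prod_Omega)
    also have "\<dots> = (\<Prod>i\<in>{c<..n}. (a i)\<^sup>2)"
      by (rule prod.mono_neutral_cong_right) (auto simp: a_def)
    also have "\<dots> = (\<Prod>l\<in>{1..n - c}. (a (c + l))\<^sup>2)"
      by (rule prod.reindex_bij_witness[of _ "\<lambda>l. c + l" "\<lambda>i. i - c"]) auto
    also have "\<dots> = (\<Prod>l\<in>{1..n - c} \<inter> {..<N}. (a (c + l))\<^sup>2) * (\<Prod>l\<in>{1..n - c} - {..<N}. (a (c + l))\<^sup>2)"
      by (rule prod.Int_Diff) simp
    also have "\<dots> \<ge> (\<Prod>l\<in>{..<N}. (\<kappa> (t ^ 32) (2 * l))\<^sup>2) * (1 / 2)"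
    proof (rule mult_mono)
      have "(\<Prod>l\<in>{..<N}. (\<kappa> (t ^ 32) (2 * l))\<^sup>2) =
          (\<Prod>l\<in>{..<N} \<inter> {1..n - c}. (\<kappa> (t ^ 32) (2 * l))\<^sup>2) * (\<Prod>l\<in>{..<N} - {1..n - c}. (\<kappa> (t ^ 32) (2 * l))\<^sup>2)"
        by (rule prod.Int_Diff) simp
      also have "\<dots> \<le> (\<Prod>l\<in>{..<N} \<inter> {1..n - c}. (\<kappa> (t ^ 32) (2 * l))\<^sup>2) * 1"
        using k1 by (intro mult_left_mono prod_le_1 prod_nonneg) (auto simp: power_le_one less_imp_le)
      also have "\<dots> \<le> (\<Prod>l\<in>{1..n - c} \<inter> {..<N}. (a (c + l))\<^sup>2)"
        unfolding mult_1_right Int_commute[of "{..<N}"]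
        using ak[of "c + l" for l] k1 by (intro prod_mono) (auto intro!: power_mono simp: less_imp_le)
      finally show "(\<Prod>l\<in>{..<N}. (\<kappa> (t ^ 32) (2 * l))\<^sup>2) \<le> (\<Prod>l\<in>{1..n - c} \<inter> {..<N}. (a (c + l))\<^sup>2)" .
      have "(\<Sum>l\<in>{1..n - c} - {..<N}. 1 - (a (c + l))\<^sup>2) \<le> (\<Sum>l\<in>{1..n - c} - {..<N}. calm_tail t l)"
        using at[of "c + l" for l] by (intro sum_mono) (simp add: algebra_simps)
      also have "\<dots> \<le> (\<Sum>l\<in>{N..n - c}. calm_tail t l)"
        using calm_tail_nonneg[OF t(1)] by (intro sum_mono2) auto
      also have "\<dots> \<le> 1 / 2" using N[of N "n - c"] by simp
      finally have "1 / 2 \<le> 1 - (\<Sum>l\<in>{1..n - c} - {..<N}. 1 - (a (c + l))\<^sup>2)" by simp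
      also have "\<dots> \<le> (\<Prod>l\<in>{1..n - c} - {..<N}. 1 - (1 - (a (c + l))\<^sup>2))"
        using a01 by (intro Weierstrass_prod_ineq) (auto simp: power_le_one)
      finally show "1 / 2 \<le> (\<Prod>l\<in>{1..n - c} - {..<N}. (a (c + l))\<^sup>2)" by simp
    qed (auto intro: prod_nonneg)
    finally show ?thesis by (simp add: p_def)
  qed
  ultimately show ?thesis by blast
qed

text \<open>
  Scanning the persons upwards from \<open>s\<close>, the first height at which somebody is not calm is \<open>l\<close>.
  The event is decided by the persons up to \<open>s + l\<close>, so a new attempt at level \<open>s + l\<close>, which
  looks only at persons above, is independent of it.
\<close>

definition first_restless :: "nat \<Rightarrow> nat \<Rightarrow> nat \<Rightarrow> pref \<Rightarrow> bool" where
  "first_restless n s l P \<longleftrightarrow> (\<forall>i g. s < i \<and> i < s + l \<longrightarrow> calm n s i (P (i, g))) \<and> \<not> (\<forall>g. calm n s (s + l) (P (s + l, g)))"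

lemma not_calm_above_first_restless:
  assumes "\<not> calm_above n s P"
  shows "\<exists>l\<in>{1..n - s}. first_restless n s l P"
proof -
  let ?Q = "\<lambda>i. s < i \<and> i \<le> n \<and> \<not> (\<forall>g. calm n s i (P (i, g)))"
  obtain i0 where "?Q i0" using assms by (auto simp: calm_above_def)
  define i where "i = (LEAST i. ?Q i)"
  have i: "?Q i" unfolding i_def by (rule LeastI[of ?Q, OF \<open>?Q i0\<close>])
  have less: "\<not> ?Q j" if "j < i" for j using that unfolding i_def by (rule not_less_Least)
  have "first_restless n s (i - s) P" unfolding first_restless_def using i less by auto
  then show ?thesis using i by (intro bexI[of _ "i - s"]) auto
qed

lemma first_restless_unique: "first_restless n s l P \<Longrightarrow> first_restless n s l' P \<Longrightarrow> 1 \<le> l \<Longrightarrow> 1 \<le> l' \<Longrightarrow> l = l'"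
  unfolding first_restless_def by (metis less_add_same_cancel1 linorder_neqE_nat nat_add_left_cancel_less not_one_le_zero gr0I)

lemma first_restless_not_calm_above: "first_restless n s l P \<Longrightarrow> 1 \<le> l \<Longrightarrow> l \<le> n - s \<Longrightarrow> \<not> calm_above n s P"
  unfolding first_restless_def calm_above_def by (metis add_le_cancel_left le_add_diff_inverse less_add_same_cancel1 less_imp_le_nat not_one_le_zero gr0I diff_is_0_eq le_0_eq nle_le)


text \<open>
  The generating function of \<open>calm_tail\<close> has radius of convergence larger than one, and so it is
  continuous at one.
\<close>

lemma geometric_slack:
  assumes t: "0 < t" "t < 1" and p: "0 < p"
  shows "\<exists>x>1. \<forall>N. (\<Sum>l=1..N. calm_tail t l * (x ^ l - 1)) \<le> p"
proof -
  define f where "f x = (\<Sum>l. calm_tail t l * x ^ l)" for x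
  \<comment> \<open>Any number strictly between the point \<open>1\<close> and the radius of convergence \<open>1 / t\<close>.\<close>
  define K where "K = (1 + 1 / t) / 2"
  have K: "1 < K" "t * K < 1" using t by (auto simp: K_def field_simps)
  have sK: "summable (\<lambda>l. calm_tail t l * K ^ l)" using K t by (intro summable_calm_tail) auto
  have "isCont f 1" unfolding f_def by (rule isCont_powser[OF sK]) (use K in simp)
  then obtain d where d: "0 < d" "\<And>x. \<bar>x - 1\<bar> < d \<Longrightarrow> \<bar>f x - f 1\<bar> < p"
    using p unfolding continuous_at_eps_delta by (auto simp: dist_real_def)
  define x where "x = min K (1 + d / 2)"
  have x: "1 < x" "x \<le> K" "\<bar>x - 1\<bar> < d" using K d by (auto simp: x_def)
  have "t * x \<le> t * K" using x t by simp
  then have "t * x < 1" using K by linarith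
  then have sx: "summable (\<lambda>l. calm_tail t l * x ^ l)" using x t by (intro summable_calm_tail) auto
  have s1: "summable (\<lambda>l. calm_tail t l * 1 ^ l)" using t by (intro summable_calm_tail) auto
  have "(\<Sum>l=1..N. calm_tail t l * (x ^ l - 1)) \<le> p" for N
  proof -
    have eq: "calm_tail t l * (x ^ l - 1) = calm_tail t l * x ^ l - calm_tail t l * 1 ^ l" for l
      by (simp add: algebra_simps)
    have nn: "0 \<le> calm_tail t l * (x ^ l - 1)" for l
      using x calm_tail_nonneg[OF t(1)] by (simp add: one_le_power)
    have "(\<Sum>l=1..N. calm_tail t l * (x ^ l - 1)) \<le> (\<Sum>l. calm_tail t l * (x ^ l - 1))"
      using summable_diff[OF sx s1] nn unfolding eq[symmetric] by (intro sum_le_suminf) auto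
    also have "\<dots> = f x - f 1" unfolding eq f_def by (rule suminf_diff[OF sx s1, symmetric])
    also have "\<dots> \<le> p" using d(2)[OF x(3)] by linarith
    finally show ?thesis .
  qed
  then show ?thesis using x(1) by blast
qed

lemma depends_on_first_restless: "depends_on ({s<..s + l} \<times> UNIV) (first_restless n s l)" if "1 \<le> l"
proof -
  have "first_restless n s l P \<longleftrightarrow> first_restless n s l P'" if e: "\<forall>x\<in>{s<..s + l} \<times> UNIV. P x = P' x" for P P'
  proof -
    have "P (i, g) = P' (i, g)" if "s < i" "i \<le> s + l" for i g using e that by auto
    then show ?thesis unfolding first_restless_def using \<open>1 \<le> l\<close> by auto
  qed
  then show ?thesis unfolding depends_on_def by blast
qed

lemma depends_on_calm_above: "depends_on ({c<..n} \<times> UNIV) (calm_above n c)"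
  unfolding depends_on_def calm_above_def by auto

lemma depends_on_no_calm_cut: "depends_on ({s<..n} \<times> UNIV) (no_calm_cut n s r)"
proof -
  have "calm_above n c P \<longleftrightarrow> calm_above n c P'" if "\<forall>x\<in>{s<..n} \<times> UNIV. P x = P' x" "s \<le> c" for P P' c
    by (rule depends_onD[OF depends_on_calm_above]) (use that in auto)
  then show ?thesis unfolding depends_on_def no_calm_cut_def by blast
qed

text \<open>
  A renewal argument. If none of the \<open>r\<close> levels is calm, then the attempt at \<open>s\<close> stops at some
  height \<open>l\<close>, and from \<open>s + l\<close> on there are \<open>r - l\<close> further levels without success, independently.
  By induction the probability is at most \<open>\<rho> ^ r\<close> times the expectation of \<open>\<rho> ^ (- l)\<close> over
  failing attempts, which is at most one for \<open>\<rho>\<close> close to one because an attempt succeeds with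
  probability at least \<open>p\<close>.
\<close>

theorem Pr_no_calm_cut:
  assumes t: "0 < t" "t < 1"
  shows "\<exists>\<rho>. 0 < \<rho> \<and> \<rho> < 1 \<and> (\<forall>q n s r. 0 < q \<and> q \<le> t ^ 32 \<longrightarrow> Pr q n (no_calm_cut n s r) \<le> \<rho> ^ r)"
proof -
  obtain p where p: "0 < p" and good: "\<And>q n c. 0 < q \<Longrightarrow> q \<le> t ^ 32 \<Longrightarrow> p \<le> Pr q n (calm_above n c)"
    using Pr_calm_above[OF t] by blast
  obtain x where x: "1 < x" and slack: "\<And>N. (\<Sum>l=1..N. calm_tail t l * (x ^ l - 1)) \<le> p"
    using geometric_slack[OF t p] by blast
  define \<rho> where "\<rho> = 1 / x"
  have \<rho>: "0 < \<rho>" "\<rho> < 1" using x by (auto simp: \<rho>_def)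
  have "Pr q n (no_calm_cut n s r) \<le> \<rho> ^ r" if q: "0 < q" "q \<le> t ^ 32" for q n s r
  proof (induction r arbitrary: s rule: less_induct)
    case (less r)
    show ?case
    proof (cases "r = 0")
      case False
      let ?N = "n - s"
      have F: "Pr q n (first_restless n s l) \<le> calm_tail t l" if l: "1 \<le> l" "l \<le> ?N" for l
      proof -
        have om: "(s + l, g) \<in> Omega n" for g using l by (auto simp: Omega_def)
        have c1: "Pr q n (\<lambda>P. \<not> calm n s (s + l) (P (s + l, g))) \<le> calm_tail t l / 2" for g
        proof -
          have "Pr q n (\<lambda>P. \<not> calm n s (s + l) (P (s + l, g))) = measure_pmf.prob (Mal q n) {\<pi>. \<not> calm n s (s + l) \<pi>}"
            by (rule Pr_one[OF om])
          also have "\<dots> = 1 - measure_pmf.prob (Mal q n) {\<pi>. calm n s (s + l) \<pi>}"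
            using measure_pmf.prob_compl[of "{\<pi>. calm n s (s + l) \<pi>}" "Mal q n"]
            by (simp add: Compl_eq_Diff_UNIV[symmetric] Collect_neg_eq)
          finally show ?thesis using prob_calm_ge[OF q t, of "s + l" s n] by simp
        qed
        have "Pr q n (first_restless n s l) \<le> measure_pmf.prob (MalPref q n)
            ({P. \<not> calm n s (s + l) (P (s + l, Man))} \<union> {P. \<not> calm n s (s + l) (P (s + l, Woman))})"
          by (intro measure_pmf.finite_measure_mono) (auto simp: first_restless_def, metis gender.exhaust)
        also have "\<dots> \<le> Pr q n (\<lambda>P. \<not> calm n s (s + l) (P (s + l, Man))) + Pr q n (\<lambda>P. \<not> calm n s (s + l) (P (s + l, Woman)))"
          by (rule measure_Un_le) auto
        finally show ?thesis using c1[of Man] c1[of Woman] by linarith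
      qed
      have tot: "(\<Sum>l=1..?N. Pr q n (first_restless n s l)) \<le> 1 - p"
      proof -
        have "(\<Sum>l=1..?N. Pr q n (first_restless n s l)) = measure_pmf.prob (MalPref q n) (\<Union>l\<in>{1..?N}. {P. first_restless n s l P})"
          by (rule measure_pmf.finite_measure_finite_Union[symmetric])
            (auto simp: disjoint_family_on_def dest: first_restless_unique)
        also have "\<dots> \<le> measure_pmf.prob (MalPref q n) (- {P. calm_above n s P})"
          by (intro measure_pmf.finite_measure_mono) (auto dest: first_restless_not_calm_above)
        also have "\<dots> = 1 - Pr q n (calm_above n s)"
          using measure_pmf.prob_compl[of "{P. calm_above n s P}" "MalPref q n"] by (simp add: Compl_eq_Diff_UNIV)
        finally show ?thesis using good[OF q, of n s] by linarith
      qed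
      have "Pr q n (no_calm_cut n s r) \<le>
          measure_pmf.prob (MalPref q n) (\<Union>l\<in>{1..?N}. {P. first_restless n s l P \<and> no_calm_cut n (s + l) (r - l) P})"
      proof (intro measure_pmf.finite_measure_mono subsetI)
        fix P assume "P \<in> {P. no_calm_cut n s r P}"
        then have b: "no_calm_cut n s r P" by simp
        then have "\<not> calm_above n s P" using False by (auto simp: no_calm_cut_def)
        then obtain l where "l \<in> {1..?N}" "first_restless n s l P" using not_calm_above_first_restless by blast
        moreover have "no_calm_cut n (s + l) (r - l) P" using b by (auto simp: no_calm_cut_def)
        ultimately show "P \<in> (\<Union>l\<in>{1..?N}. {P. first_restless n s l P \<and> no_calm_cut n (s + l) (r - l) P})" by blast
      qed simp
      also have "\<dots> \<le> (\<Sum>l=1..?N. Pr q n (\<lambda>P. first_restless n s l P \<and> no_calm_cut n (s + l) (r - l) P))"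
        by (intro measure_pmf.finite_measure_subadditive_finite) auto
      also have "\<dots> \<le> (\<Sum>l=1..?N. Pr q n (first_restless n s l) * (\<rho> ^ r * x ^ l))"
      proof (rule sum_mono)
        fix l assume l: "l \<in> {1..?N}"
        have "Pr q n (\<lambda>P. first_restless n s l P \<and> no_calm_cut n (s + l) (r - l) P) =
            Pr q n (first_restless n s l) * Pr q n (no_calm_cut n (s + l) (r - l))"
          by (rule Pr_indep[OF q(1) _ depends_on_first_restless depends_on_no_calm_cut]) (use l in \<open>auto simp: Omega_def\<close>)
        also have "\<dots> \<le> Pr q n (first_restless n s l) * \<rho> ^ (r - l)"
          using l False by (intro mult_left_mono less.IH) auto
        also have "\<dots> \<le> Pr q n (first_restless n s l) * (\<rho> ^ r * x ^ l)"
        proof (intro mult_left_mono)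
          show "\<rho> ^ (r - l) \<le> \<rho> ^ r * x ^ l"
          proof (cases "l \<le> r")
            case True
            have "\<rho> ^ r = \<rho> ^ (r - l) * \<rho> ^ l" using True by (simp add: power_add[symmetric])
            then show ?thesis using x by (simp add: \<rho>_def power_divide)
          next
            case False
            have "\<rho> ^ r * x ^ l = x ^ (l - r)"
              using False x by (simp add: \<rho>_def power_divide power_diff)
            then show ?thesis using False x by (simp add: one_le_power)
          qed
        qed simp
        finally show "Pr q n (\<lambda>P. first_restless n s l P \<and> no_calm_cut n (s + l) (r - l) P) \<le> Pr q n (first_restless n s l) * (\<rho> ^ r * x ^ l)" .
      qed
      also have "\<dots> = \<rho> ^ r * ((\<Sum>l=1..?N. Pr q n (first_restless n s l)) + (\<Sum>l=1..?N. Pr q n (first_restless n s l) * (x ^ l - 1)))"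
        unfolding sum.distrib[symmetric] sum_distrib_left by (intro sum.cong) (auto simp: algebra_simps)
      also have "\<dots> \<le> \<rho> ^ r * ((1 - p) + p)"
      proof (intro mult_left_mono add_mono tot)
        \<comment> \<open>Here \<open>1 - p\<close> is the total failure probability, and the slack \<open>p\<close> pays for the factors \<open>x ^ l\<close>.\<close>
        have "(\<Sum>l=1..?N. Pr q n (first_restless n s l) * (x ^ l - 1)) \<le> (\<Sum>l=1..?N. calm_tail t l * (x ^ l - 1))"
          using x F by (intro sum_mono mult_right_mono) (auto simp: one_le_power)
        then show "(\<Sum>l=1..?N. Pr q n (first_restless n s l) * (x ^ l - 1)) \<le> p" using slack[of ?N] by linarith
      qed (use \<rho> in auto)
      finally show ?thesis by simp
    qed simp
  qed
  then show ?thesis using \<rho> by blast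
qed

section \<open>Approximation by independent blocks\<close>

text \<open>
  The constant depends on neither the interval nor its subdivision, and is the same
  for all \<open>q\<close> up to \<open>t ^ 32\<close>.
\<close>

theorem E_defect:
  assumes t: "0 < t" "t < 1"
  shows "\<exists>K\<ge>0. \<forall>q n a m b. 0 < q \<and> q \<le> t ^ 32 \<and> a \<le> m \<and> m \<le> b \<and> b \<le> n \<longrightarrow>
    E q n (\<lambda>P. \<bar>log_stab a b P - log_stab a m P - log_stab m b P\<bar>) \<le> K"
proof -
  obtain \<rho> where \<rho>: "0 < \<rho>" "\<rho> < 1"
    and bar: "\<And>q n s r. 0 < q \<Longrightarrow> q \<le> t ^ 32 \<Longrightarrow> Pr q n (no_calm_cut n s r) \<le> \<rho> ^ r"
    using Pr_no_calm_cut[OF t] by blast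
  have sums: "(\<lambda>r. real (Suc r) * \<rho> ^ r) sums (1 / (1 - \<rho>)\<^sup>2)" using geometric_deriv_sums[of \<rho>] \<rho> by simp
  define K where "K = 8 * (1 / (1 - \<rho>)\<^sup>2)"
  have "E q n (\<lambda>P. \<bar>log_stab a b P - log_stab a m P - log_stab m b P\<bar>) \<le> K"
    if q: "0 < q" "q \<le> t ^ 32" and amb: "a \<le> m" "m \<le> b" "b \<le> n" for q n a m b
  proof -
    have "E q n (\<lambda>P. \<bar>log_stab a b P - log_stab a m P - log_stab m b P\<bar>) \<le>
        E q n (\<lambda>P. \<Sum>r=1..n. 4 * real r * (of_bool (no_calm_cut n m r P) + of_bool (r \<le> m \<and> no_calm_cut n (m + 1 - r) r P)))"
      by (rule E_mono[OF q(1)]) (intro log_stab_defect MalPref_strict_pref[OF q(1)] amb)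
    also have "\<dots> = (\<Sum>r=1..n. 4 * real r * (Pr q n (no_calm_cut n m r) + Pr q n (\<lambda>P. r \<le> m \<and> no_calm_cut n (m + 1 - r) r P)))"
      unfolding Pr_eq_E
      by (simp only: Bochner_Integration.integral_sum Bochner_Integration.integral_add integral_mult_right_zero
          integrable_MalPref[OF q(1)])
    also have "\<dots> \<le> (\<Sum>r=1..n. 4 * real r * (\<rho> ^ r + \<rho> ^ r))"
    proof (intro sum_mono mult_left_mono add_mono bar q)
      fix r
      have "Pr q n (\<lambda>P. r \<le> m \<and> no_calm_cut n (m + 1 - r) r P) \<le> Pr q n (no_calm_cut n (m + 1 - r) r)"
        by (intro measure_pmf.finite_measure_mono) auto
      then show "Pr q n (\<lambda>P. r \<le> m \<and> no_calm_cut n (m + 1 - r) r P) \<le> \<rho> ^ r" using bar[OF q] order_trans by blast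
    qed auto
    also have "\<dots> = 8 * (\<Sum>r=1..n. real r * \<rho> ^ r)" by (simp add: sum_distrib_left mult.assoc)
    also have "(\<Sum>r=1..n. real r * \<rho> ^ r) \<le> (\<Sum>r=1..n. real (Suc r) * \<rho> ^ r)"
      using \<rho> by (intro sum_mono mult_right_mono) auto
    also have "\<dots> \<le> (\<Sum>r. real (Suc r) * \<rho> ^ r)"
      using sums \<rho> by (intro sum_le_suminf) (auto simp: sums_iff)
    also have "\<dots> = 1 / (1 - \<rho>)\<^sup>2" using sums by (simp add: sums_iff)
    finally show ?thesis by (simp add: K_def)
  qed
  moreover have "0 \<le> K" by (simp add: K_def)
  ultimately show ?thesis by blast
qed

lemma pattern_id: "pattern a L id = id"
proof
  fix i
  have "{j \<in> {1..L}. id (a + j) \<le> id (a + i)} = {1..i}" if "1 \<le> i" "i \<le> L" using that by auto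
  then show "pattern a L id i = id i" by (simp add: pattern_def)
qed

text \<open>
  The patterns of the rankings on a window form a Mallows preference structure of that size.
\<close>

lemma E_block:
  assumes q: "0 < q" and aL: "a + L \<le> n"
  shows "E q n (log_stab a (a + L)) = E q L (log_stab 0 L)"
proof -
  define B where "B = {a<..a + L} \<times> (UNIV :: gender set)"
  define sh where "sh x = (a + fst x, snd x)" for x :: person
  have finO: "finite (Omega k)" for k by simp
  have B: "B \<subseteq> Omega n" using aL by (auto simp: B_def Omega_def)
  have bij: "bij_betw sh (Omega L) B"
    by (rule bij_betw_byWitness[of _ "\<lambda>x. (fst x - a, snd x)"]) (auto simp: sh_def B_def Omega_def)
  have out: "sh x \<notin> B" if "x \<notin> Omega L" for x
    using that by (cases x) (auto simp: sh_def B_def Omega_def)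
  have "MalPref q L = Pi_pmf (Omega L) id (\<lambda>_. map_pmf (pattern a L) (Mal q n))"
    unfolding MalPref_def map_pattern_Mal[OF q aL] ..
  also have "\<dots> = map_pmf (\<lambda>h. pattern a L \<circ> h) (Pi_pmf (Omega L) id (\<lambda>_. Mal q n))"
    by (rule Pi_pmf_map[where f = "pattern a L" and dflt = id, OF finO pattern_id])
  also have "Pi_pmf (Omega L) id (\<lambda>_. Mal q n) = map_pmf (\<lambda>g. g \<circ> sh) (Pi_pmf B id (\<lambda>_. Mal q n))"
    by (rule Pi_pmf_bij_betw[OF finO bij out])
  also have "Pi_pmf B id (\<lambda>_. Mal q n) = map_pmf (\<lambda>f x. if x \<in> B then f x else id) (MalPref q n)"
    unfolding MalPref_def by (rule Pi_pmf_subset[OF finO B])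
  finally have M: "MalPref q L = map_pmf (\<lambda>P. pattern a L \<circ> ((\<lambda>x. if x \<in> B then P x else id) \<circ> sh)) (MalPref q n)"
    by (simp add: pmf.map_comp o_def)
  have "E q L (log_stab 0 L) = E q n (\<lambda>P. log_stab 0 L (pattern a L \<circ> ((\<lambda>x. if x \<in> B then P x else id) \<circ> sh)))"
    unfolding M by simp
  also have "\<dots> = E q n (log_stab a (a + L))"
  proof (intro integral_cong_AE)
    show "AE P in measure_pmf (MalPref q n). log_stab 0 L (pattern a L \<circ> ((\<lambda>x. if x \<in> B then P x else id) \<circ> sh)) = log_stab a (a + L) P"
      unfolding AE_measure_pmf_iff
    proof
      fix P assume "P \<in> set_pmf (MalPref q n)"
      then have "inj (P x)" for x using strict_pref_inj_on[OF MalPref_strict_pref[OF q]] by blast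
      then show "log_stab 0 L (pattern a L \<circ> ((\<lambda>x. if x \<in> B then P x else id) \<circ> sh)) = log_stab a (a + L) P"
        by (intro log_stab_translate) (auto simp: sh_def B_def pattern_less_iff)
    qed
  qed auto
  finally show ?thesis ..
qed

definition blocks :: "nat \<Rightarrow> nat \<Rightarrow> pref \<Rightarrow> real" where
  "blocks L k P = (\<Sum>j<k. log_stab (j * L) (Suc j * L) P)"

lemma blocks_Suc: "blocks L (Suc k) P = blocks L k P + log_stab (k * L) (Suc k * L) P"
  by (simp add: blocks_def)

lemma depends_on_log_stab: "depends_on ({a<..b} \<times> UNIV) (log_stab a b)"
  unfolding depends_on_def by (auto intro!: log_stab_cong)

lemma depends_on_blocks: "depends_on ({0<..k * L} \<times> UNIV) (blocks L k)"
  unfolding depends_on_def blocks_def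
proof (intro allI impI sum.cong refl)
  fix P P' :: pref and j assume e: "\<forall>x\<in>{0<..k * L} \<times> UNIV. P x = P' x" and j: "j \<in> {..<k}"
  have "Suc j * L \<le> k * L" using j by (intro mult_le_mono1) auto
  then show "log_stab (j * L) (Suc j * L) P = log_stab (j * L) (Suc j * L) P'"
    using e by (intro depends_onD[OF depends_on_log_stab]) auto
qed

lemma E_blocks_defect:
  assumes q: "0 < q" and K: "\<And>a m b. a \<le> m \<Longrightarrow> m \<le> b \<Longrightarrow> b \<le> n \<Longrightarrow> E q n (\<lambda>P. \<bar>log_stab a b P - log_stab a m P - log_stab m b P\<bar>) \<le> K"
  shows "k * L \<le> n \<Longrightarrow> E q n (\<lambda>P. \<bar>log_stab 0 (k * L) P - blocks L k P\<bar>) \<le> real k * K"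
proof (induction k)
  case 0
  then show ?case by (simp add: blocks_def log_stab_small)
next
  case (Suc k)
  let ?D = "\<lambda>P. \<bar>log_stab 0 (Suc k * L) P - log_stab 0 (k * L) P - log_stab (k * L) (Suc k * L) P\<bar>"
  have "E q n (\<lambda>P. \<bar>log_stab 0 (Suc k * L) P - blocks L (Suc k) P\<bar>) \<le>
      E q n (\<lambda>P. ?D P + \<bar>log_stab 0 (k * L) P - blocks L k P\<bar>)"
    by (rule E_mono[OF q]) (simp add: blocks_Suc)
  also have "\<dots> = E q n ?D + E q n (\<lambda>P. \<bar>log_stab 0 (k * L) P - blocks L k P\<bar>)"
    by (intro Bochner_Integration.integral_add integrable_MalPref q)
  also have "\<dots> \<le> K + real k * K"
    using Suc by (intro add_mono K) auto
  finally show ?case by (simp add: algebra_simps)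
qed

lemma E_log_stab_bounds:
  assumes q: "0 < q"
  shows "0 \<le> E q n (log_stab a b)" "E q n (log_stab a b) \<le> (real (b - a))\<^sup>2"
proof -
  have "E q n (log_stab a b) \<le> E q n (\<lambda>_. (real (b - a))\<^sup>2)" by (rule E_mono[OF q]) (rule log_stab_le)
  then show "E q n (log_stab a b) \<le> (real (b - a))\<^sup>2" by simp
  show "0 \<le> E q n (log_stab a b)" by (rule integral_nonneg_AE) (simp add: log_stab_nonneg)
qed

text \<open>
  Distinct blocks involve distinct persons, so the centred contributions are orthogonal.
\<close>

lemma E_blocks_variance:
  assumes q: "0 < q"
  defines "e \<equiv> \<lambda>L. E q L (log_stab 0 L)"
  shows "k * L \<le> n \<Longrightarrow> E q n (\<lambda>P. (blocks L k P - real k * e L)\<^sup>2) \<le> real k * (real L) ^ 4"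
proof (induction k)
  case 0
  then show ?case by (simp add: blocks_def)
next
  case (Suc k)
  define X Y where "X P = blocks L k P - real k * e L" and "Y P = log_stab (k * L) (Suc k * L) P - e L" for P
  have kL: "k * L + L \<le> n" using Suc.prems by simp
  have int: "integrable (measure_pmf (MalPref q n)) f" for f :: "pref \<Rightarrow> real"
    by (rule integrable_MalPref[OF q])
  have "E q n (log_stab (k * L) (Suc k * L)) = e L"
    using E_block[OF q kL] by (simp add: e_def add.commute)
  then have EY: "E q n Y = 0" unfolding Y_def by (simp add: int)
  have "E q n (\<lambda>P. X P * Y P) = E q n X * E q n Y"
  proof (rule E_indep[OF q])
    show "{0<..k * L} \<times> UNIV \<subseteq> Omega n" using kL by (auto simp: Omega_def)
    show "depends_on ({0<..k * L} \<times> UNIV) X" unfolding X_def by (rule depends_on_comp[OF depends_on_blocks])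
    show "depends_on ({k * L<..Suc k * L} \<times> UNIV) Y" unfolding Y_def by (rule depends_on_comp[OF depends_on_log_stab])
  qed auto
  then have cross: "E q n (\<lambda>P. X P * Y P) = 0" using EY by simp
  have Y2: "E q n (\<lambda>P. (Y P)\<^sup>2) \<le> (real L) ^ 4"
  proof -
    have "E q n (\<lambda>P. (Y P)\<^sup>2) \<le> E q n (\<lambda>_. (real L) ^ 4)"
    proof (rule E_mono[OF q])
      fix P
      have "\<bar>Y P\<bar> \<le> (real L)\<^sup>2"
        using log_stab_le[of "k * L" "Suc k * L" P] log_stab_nonneg[of "k * L" "Suc k * L" P]
          E_log_stab_bounds[OF q, of L 0 L] by (simp add: Y_def e_def abs_le_iff)
      then have "(Y P)\<^sup>2 \<le> ((real L)\<^sup>2)\<^sup>2" by (metis abs_ge_zero power2_abs power_mono)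
      then show "(Y P)\<^sup>2 \<le> (real L) ^ 4" by (simp add: power_mult[symmetric])
    qed
    then show ?thesis by simp
  qed
  have "E q n (\<lambda>P. (blocks L (Suc k) P - real (Suc k) * e L)\<^sup>2) = E q n (\<lambda>P. (X P)\<^sup>2 + 2 * (X P * Y P) + (Y P)\<^sup>2)"
    by (rule Bochner_Integration.integral_cong) (simp_all add: X_def Y_def blocks_Suc power2_eq_square algebra_simps)
  also have "\<dots> = E q n (\<lambda>P. (X P)\<^sup>2) + 2 * E q n (\<lambda>P. X P * Y P) + E q n (\<lambda>P. (Y P)\<^sup>2)"
    by (simp add: int)
  also have "\<dots> \<le> real k * (real L) ^ 4 + (real L) ^ 4"
    using Suc kL cross Y2 by (simp add: X_def)
  finally show ?case by (simp add: algebra_simps)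
qed

text \<open>
  Integrate \<open>2 * s * \<bar>x\<bar> \<le> x\<^sup>2 + s\<^sup>2\<close>.
\<close>

lemma E_abs_le_of_square:
  assumes q: "0 < q" and s: "0 < s" and "E q n (\<lambda>P. (f P)\<^sup>2) \<le> s\<^sup>2"
  shows "E q n (\<lambda>P. \<bar>f P\<bar>) \<le> s"
proof -
  have "E q n (\<lambda>P. \<bar>f P\<bar>) \<le> E q n (\<lambda>P. (f P)\<^sup>2 / (2 * s) + s / 2)"
  proof (rule E_mono[OF q])
    fix P
    have "0 \<le> (\<bar>f P\<bar> - s)\<^sup>2" by simp
    then have "2 * s * \<bar>f P\<bar> \<le> (f P)\<^sup>2 + s\<^sup>2" by (simp add: power2_diff algebra_simps)
    then show "\<bar>f P\<bar> \<le> (f P)\<^sup>2 / (2 * s) + s / 2" using s by (simp add: field_simps power2_eq_square)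
  qed
  also have "\<dots> = E q n (\<lambda>P. (f P)\<^sup>2) / (2 * s) + s / 2"
    using integrable_MalPref[OF q] by simp
  also have "\<dots> \<le> s\<^sup>2 / (2 * s) + s / 2" using assms by (intro add_right_mono divide_right_mono) auto
  also have "\<dots> = s" using s by (simp add: power2_eq_square)
  finally show ?thesis .
qed

text \<open>
  Three errors: \<open>K\<close> for each of the roughly \<open>n / L\<close> block boundaries, at most \<open>2 * L\<^sup>2\<close> for the
  incomplete last block, and the fluctuation of the sum of independent blocks.
\<close>

theorem E_mean_deviation:
  assumes q: "0 < q" and K: "\<And>n a m b. a \<le> m \<Longrightarrow> m \<le> b \<Longrightarrow> b \<le> n \<Longrightarrow> E q n (\<lambda>P. \<bar>log_stab a b P - log_stab a m P - log_stab m b P\<bar>) \<le> K"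
    and L: "1 \<le> L" and n: "1 \<le> n"
  shows "E q n (\<lambda>P. \<bar>log_stab 0 n P / real n - E q L (log_stab 0 L) / real L\<bar>) \<le>
    K / real L + (K + 2 * (real L)\<^sup>2) / real n + (real L)\<^sup>2 / sqrt (real n)"
proof -
  define k where "k = n div L"
  define e where "e = E q L (log_stab 0 L)"
  have kL: "k * L \<le> n" "n - k * L < L" using L by (auto simp: k_def minus_div_mult_eq_mod)
  have e: "0 \<le> e" "e \<le> (real L)\<^sup>2" using E_log_stab_bounds[OF q, of L 0 L] by (auto simp: e_def)
  have int: "integrable (measure_pmf (MalPref q n)) f" for f :: "pref \<Rightarrow> real"
    by (rule integrable_MalPref[OF q])
  have K0: "0 \<le> K" using K[of 0 0 0 0] by (simp add: log_stab_small)
  let ?D1 = "\<lambda>P. \<bar>log_stab 0 n P - log_stab 0 (k * L) P - log_stab (k * L) n P\<bar>"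
  let ?D2 = "\<lambda>P. \<bar>log_stab 0 (k * L) P - blocks L k P\<bar>"
  let ?D3 = "\<lambda>P. \<bar>blocks L k P - real k * e\<bar>"
  \<comment> \<open>The blocks cover \<open>k * L\<close> of the \<open>n\<close> indices, the remainder being shorter than one block.\<close>
  have ke: "\<bar>real k * e - real n / real L * e\<bar> \<le> (real L)\<^sup>2"
  proof -
    have "real n = real (k * L) + real (n - k * L)" using kL by linarith
    then have "real n / real L = real k + real (n - k * L) / real L" using L by (simp add: field_simps)
    then have "\<bar>real k * e - real n / real L * e\<bar> = real (n - k * L) / real L * e"
      using e by (simp add: algebra_simps)
    also have "\<dots> \<le> 1 * e"
    proof (rule mult_right_mono)
      have "real (n - k * L) \<le> real L" using kL by linarith
      then show "real (n - k * L) / real L \<le> 1" using L by (simp add: divide_le_eq del: of_nat_diff)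
    qed (rule e)
    finally show ?thesis using e by simp
  qed
  have triangle: "\<bar>x - y\<bar> \<le> \<bar>x - u - v\<bar> + \<bar>u - w\<bar> + \<bar>w - z\<bar> + 2 * d"
    if "\<bar>z - y\<bar> \<le> d" "0 \<le> v" "v \<le> d" for x y z u v w d :: real
    using that by linarith
  have "E q n (\<lambda>P. \<bar>log_stab 0 n P / real n - e / real L\<bar>) \<le>
      E q n (\<lambda>P. (?D1 P + ?D2 P + ?D3 P + 2 * (real L)\<^sup>2) / real n)"
  proof (rule E_mono[OF q])
    fix P
    have "(real (n - k * L))\<^sup>2 \<le> (real L)\<^sup>2" using kL by (intro power_mono) linarith+
    then have "log_stab (k * L) n P \<le> (real L)\<^sup>2" using log_stab_le[of "k * L" n P] by (rule order_trans[rotated])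
    then have "\<bar>log_stab 0 n P - real n / real L * e\<bar> \<le> ?D1 P + ?D2 P + ?D3 P + 2 * (real L)\<^sup>2"
      using triangle[OF ke log_stab_nonneg[of "k * L" n P]] by blast
    moreover have "\<bar>log_stab 0 n P / real n - e / real L\<bar> = \<bar>log_stab 0 n P - real n / real L * e\<bar> / real n"
    proof -
      have "log_stab 0 n P / real n - e / real L = (log_stab 0 n P - real n / real L * e) / real n"
        using n L by (simp add: diff_divide_distrib)
      then show ?thesis by (simp only: abs_divide abs_of_nat)
    qed
    ultimately show "\<bar>log_stab 0 n P / real n - e / real L\<bar> \<le> (?D1 P + ?D2 P + ?D3 P + 2 * (real L)\<^sup>2) / real n"
      by (simp add: divide_right_mono)
  qed
  also have "\<dots> = (E q n ?D1 + E q n ?D2 + E q n ?D3 + 2 * (real L)\<^sup>2) / real n"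
    by (simp add: int)
  also have "\<dots> \<le> (K + real k * K + sqrt (real n) * (real L)\<^sup>2 + 2 * (real L)\<^sup>2) / real n"
  proof (intro divide_right_mono add_mono)
    show "E q n ?D1 \<le> K" using kL by (intro K) auto
    show "E q n ?D2 \<le> real k * K" by (rule E_blocks_defect[OF q K kL(1)]) auto
    have "E q n (\<lambda>P. (blocks L k P - real k * e)\<^sup>2) \<le> real k * (real L) ^ 4"
      unfolding e_def by (rule E_blocks_variance[OF q kL(1)])
    also have "\<dots> \<le> real n * (real L) ^ 4" unfolding k_def by (intro mult_right_mono) auto
    also have "\<dots> = (sqrt (real n) * (real L)\<^sup>2)\<^sup>2" by (simp add: power_mult_distrib power_mult[symmetric])
    finally show "E q n ?D3 \<le> sqrt (real n) * (real L)\<^sup>2"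
      using n L by (intro E_abs_le_of_square[OF q]) auto
  qed auto
  also have "\<dots> \<le> (K + real n / real L * K + sqrt (real n) * (real L)\<^sup>2 + 2 * (real L)\<^sup>2) / real n"
  proof -
    have "real k * real L \<le> real n" using kL(1) by (metis of_nat_le_iff of_nat_mult)
    then have "real k \<le> real n / real L" using L by (simp add: le_divide_eq)
    then show ?thesis using K0 by (intro divide_right_mono add_mono mult_right_mono) auto
  qed
  also have "\<dots> = K / real L + (K + 2 * (real L)\<^sup>2) / real n + (real L)\<^sup>2 * (sqrt (real n) / real n)"
    using n L by (simp add: field_simps)
  also have "sqrt (real n) / real n = 1 / sqrt (real n)"
    using n by (simp add: real_div_sqrt field_simps)
  finally show ?thesis by (simp add: e_def)
qed

section \<open>Matchings and permutations\<close>

definition matching_of :: "nat \<Rightarrow> (nat \<Rightarrow> nat) \<Rightarrow> person set set" where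
  "matching_of n \<sigma> = (\<lambda>i. {(i, Man), (\<sigma> i, Woman)}) ` {1..n}"

lemma matching_of_iff:
  assumes \<sigma>: "\<sigma> permutes {1..n}" and i: "i \<in> {1..n}"
  shows "{(i, Man), (j, Woman)} \<in> matching_of n \<sigma> \<longleftrightarrow> j = \<sigma> i"
  using i by (auto simp: matching_of_def doubleton_eq_iff)

lemma matching_of_matchings:
  assumes \<sigma>: "\<sigma> permutes {1..n}"
  shows "matching_of n \<sigma> \<in> matchings n"
  unfolding matchings_def mem_Collect_eq
proof (intro conjI ballI)
  show "matching_of n \<sigma> \<subseteq> matches n"
  proof
    fix e assume "e \<in> matching_of n \<sigma>"
    then obtain i where "i \<in> {1..n}" "e = {(i, Man), (\<sigma> i, Woman)}" by (auto simp: matching_of_def)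
    moreover from this have "\<sigma> i \<in> {1..n}" using permutes_in_image[OF \<sigma>, of i] by blast
    ultimately show "e \<in> matches n" unfolding matches_def by blast
  qed
  fix x assume x: "x \<in> Omega n"
  obtain i g where xi: "x = (i, g)" "i \<in> {1..n}" using x by (cases x) (auto simp: Omega_def)
  show "\<exists>!e. e \<in> matching_of n \<sigma> \<and> x \<in> e"
  proof (cases g)
    case Man
    then show ?thesis
      using xi by (intro ex1I[of _ "{(i, Man), (\<sigma> i, Woman)}"]) (auto simp: matching_of_def)
  next
    case Woman
    have inv: "inv \<sigma> i \<in> {1..n}" "\<sigma> (inv \<sigma> i) = i"
      using permutes_in_image[OF permutes_inv[OF \<sigma>]] permutes_inverses[OF \<sigma>] xi by auto
    show ?thesis
    proof (rule ex1I[of _ "{(inv \<sigma> i, Man), (i, Woman)}"])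
      show "{(inv \<sigma> i, Man), (i, Woman)} \<in> matching_of n \<sigma> \<and> x \<in> {(inv \<sigma> i, Man), (i, Woman)}"
        using matching_of_iff[OF \<sigma> inv(1), of i] inv(2) xi Woman by simp
      fix e assume e: "e \<in> matching_of n \<sigma> \<and> x \<in> e"
      then obtain k where "e = {(k, Man), (\<sigma> k, Woman)}" "i = \<sigma> k" using xi Woman by (auto simp: matching_of_def)
      then show "e = {(inv \<sigma> i, Man), (i, Woman)}" using permutes_inverses[OF \<sigma>] by simp
    qed
  qed
qed

lemma stable_matching_of:
  assumes \<sigma>: "\<sigma> permutes {1..n}"
  shows "stable n P (matching_of n \<sigma>) \<longleftrightarrow> \<sigma> \<in> stab {1..n} (\<lambda>i. P (i, Man)) (\<lambda>j. P (j, Woman))"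
proof -
  note M = matching_of_matchings[OF \<sigma>]
  have mem: "{(i, Man), (\<sigma> i, Woman)} \<in> matching_of n \<sigma>" if "i \<in> {1..n}" for i
    using that by (simp add: matching_of_def)
  have pm: "partner (matching_of n \<sigma>) (i, Man) = (\<sigma> i, Woman)" if "i \<in> {1..n}" for i
    by (rule partner_eqI[OF M mem[OF that]])
  have pw: "partner (matching_of n \<sigma>) (\<sigma> k, Woman) = (k, Man)" if "k \<in> {1..n}" for k
    by (rule partner_eqI[OF M]) (use mem[OF that] in \<open>simp add: insert_commute\<close>)
  \<comment> \<open>Every woman is of the form \<open>\<sigma> k\<close>, as in the definition of \<open>stab\<close>.\<close>
  have im: "{1..n} = \<sigma> ` {1..n}" by (rule permutes_image[OF \<sigma>, symmetric])
  have "stable n P (matching_of n \<sigma>) \<longleftrightarrow> \<not> (\<exists>i\<in>{1..n}. \<exists>j\<in>\<sigma> ` {1..n}.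
      prefers P (i, Man) (j, Woman) (partner (matching_of n \<sigma>) (i, Man)) \<and>
      prefers P (j, Woman) (i, Man) (partner (matching_of n \<sigma>) (j, Woman)))"
    unfolding stable_def using im by simp
  also have "\<dots> \<longleftrightarrow> \<not> (\<exists>i\<in>{1..n}. \<exists>k\<in>{1..n}. P (i, Man) (\<sigma> i) < P (i, Man) (\<sigma> k) \<and>
      P (\<sigma> k, Woman) k < P (\<sigma> k, Woman) i)"
    by (simp add: pm pw prefers_def)
  finally show ?thesis using \<sigma> by (simp add: stab_def)
qed

lemma matchings_eq: "matchings n = matching_of n ` {\<sigma>. \<sigma> permutes {1..n}}"
proof (intro equalityI subsetI)
  fix M assume M: "M \<in> matchings n"
  have sub: "M \<subseteq> matches n" and one: "\<And>x. x \<in> Omega n \<Longrightarrow> \<exists>!e. e \<in> M \<and> x \<in> e"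
    using M by (auto simp: matchings_def)
  have uniq: "e = e'" if "e \<in> M" "e' \<in> M" "x \<in> Omega n" "x \<in> e" "x \<in> e'" for e e' x
    using one[OF that(3)] that by blast
  have "\<exists>j\<in>{1..n}. {(i, Man), (j, Woman)} \<in> M" if i: "i \<in> {1..n}" for i
  proof -
    obtain e where e: "e \<in> M" "(i, Man) \<in> e" using one[of "(i, Man)"] i by (auto simp: Omega_def)
    then obtain k j where kj: "e = {(k, Man), (j, Woman)}" "j \<in> {1..n}" using sub unfolding matches_def by blast
    then have "k = i" using e by auto
    then show ?thesis using e kj by blast
  qed
  then obtain f where f: "\<And>i. i \<in> {1..n} \<Longrightarrow> f i \<in> {1..n} \<and> {(i, Man), (f i, Woman)} \<in> M" by metis
  define \<sigma> where "\<sigma> i = (if i \<in> {1..n} then f i else i)" for i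
  have fi: "\<sigma> i \<in> {1..n}" "{(i, Man), (\<sigma> i, Woman)} \<in> M" if "i \<in> {1..n}" for i
    using f[OF that] that by (auto simp: \<sigma>_def)
  have "inj_on \<sigma> {1..n}"
  proof (rule inj_onI)
    fix i k assume ik: "i \<in> {1..n}" "k \<in> {1..n}" "\<sigma> i = \<sigma> k"
    have "(\<sigma> i, Woman) \<in> Omega n" using fi ik by (auto simp: Omega_def)
    then have "{(i, Man), (\<sigma> i, Woman)} = {(k, Man), (\<sigma> k, Woman)}"
      by (rule uniq[OF fi(2)[OF ik(1)] fi(2)[OF ik(2)]]) (simp_all add: ik(3))
    then show "i = k" by (auto simp: doubleton_eq_iff)
  qed
  then have "bij_betw \<sigma> {1..n} {1..n}" using fi(1) by (simp add: bij_betw_def endo_inj_surj image_subset_iff)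
  then have per: "\<sigma> permutes {1..n}" by (rule bij_imp_permutes) (auto simp: \<sigma>_def)
  have "M = matching_of n \<sigma>"
  proof (intro equalityI subsetI)
    fix e assume e: "e \<in> M"
    then obtain i j where ij: "e = {(i, Man), (j, Woman)}" "i \<in> {1..n}" using sub by (auto simp: matches_def)
    have "e = {(i, Man), (\<sigma> i, Woman)}"
      by (rule uniq[OF e fi(2)[OF ij(2)], of "(i, Man)"]) (use ij in \<open>auto simp: Omega_def\<close>)
    then show "e \<in> matching_of n \<sigma>" using ij by (auto simp: matching_of_def)
  qed (use fi in \<open>auto simp: matching_of_def\<close>)
  then show "M \<in> matching_of n ` {\<sigma>. \<sigma> permutes {1..n}}" using per by blast
qed (use matching_of_matchings in auto)

theorem ln_card_StabMatch: "ln (real (card (StabMatch n P))) = log_stab 0 n P"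
proof -
  let ?S = "stab {1..n} (\<lambda>i. P (i, Man)) (\<lambda>j. P (j, Woman))"
  have "StabMatch n P = matching_of n ` ?S"
    unfolding StabMatch_def matchings_eq using stable_matching_of stab_permutes by blast
  moreover have "inj_on (matching_of n) ?S"
  proof (rule inj_onI)
    fix \<sigma> \<tau> assume st: "\<sigma> \<in> ?S" "\<tau> \<in> ?S" "matching_of n \<sigma> = matching_of n \<tau>"
    then have p: "\<sigma> permutes {1..n}" "\<tau> permutes {1..n}" by (auto dest: stab_permutes)
    show "\<sigma> = \<tau>"
    proof
      fix i
      show "\<sigma> i = \<tau> i"
        using matching_of_iff[OF p(1), of i "\<sigma> i"] matching_of_iff[OF p(2), of i "\<sigma> i"] st(3) p
        by (cases "i \<in> {1..n}") (auto simp: permutes_def)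
    qed
  qed
  moreover have "{1..n} = {0<..n}" by auto
  ultimately show ?thesis by (simp add: log_stab_def stab_count_def card_image)
qed

section \<open>The growth rate\<close>

definition mean_rate :: "real \<Rightarrow> nat \<Rightarrow> real" where
  "mean_rate q n = E q n (log_stab 0 n) / real n"

definition growth :: "real \<Rightarrow> real" where
  "growth q = lim (mean_rate q)"

lemma abs_E_diff_le:
  assumes q: "0 < q"
  shows "\<bar>E q n f - c\<bar> \<le> E q n (\<lambda>P. \<bar>f P - c\<bar>)"
proof -
  have "E q n f - c = E q n (\<lambda>P. f P - c)" by (simp add: integrable_MalPref[OF q])
  then show ?thesis using integral_abs_bound[of "measure_pmf (MalPref q n)" "\<lambda>P. f P - c"] by simp
qed

text \<open>
  For fixed \<open>L\<close> the deviation bound tends to \<open>K / L\<close> as \<open>n\<close> grows. Hence the normalised means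
  form a Cauchy sequence, and the limit is within \<open>K / L\<close> of the mean at \<open>L\<close>, uniformly for all \<open>q\<close>
  up to \<open>q1\<close>.
\<close>

theorem growth_limits:
  assumes q1: "0 < q1" "q1 < 1"
  shows "\<exists>K\<ge>0. \<forall>q. 0 < q \<and> q \<le> q1 \<longrightarrow>
    (\<forall>L\<ge>1. \<bar>growth q - mean_rate q L\<bar> \<le> K / real L) \<and> mean_rate q \<longlonglongrightarrow> growth q \<and>
    (\<lambda>n. E q n (\<lambda>P. \<bar>log_stab 0 n P / real n - growth q\<bar>)) \<longlonglongrightarrow> 0"
proof -
  define t where "t = root 32 q1"
  have t: "0 < t" "t < 1" "t ^ 32 = q1" using q1 by (auto simp: t_def real_root_pow_pos)
  obtain K where K: "0 \<le> K" "\<And>q n a m b. 0 < q \<Longrightarrow> q \<le> t ^ 32 \<Longrightarrow> a \<le> m \<Longrightarrow> m \<le> b \<Longrightarrow> b \<le> n \<Longrightarrow>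
    E q n (\<lambda>P. \<bar>log_stab a b P - log_stab a m P - log_stab m b P\<bar>) \<le> K"
    using E_defect[OF t(1,2)] by blast
  define \<delta> where "\<delta> L n = K / real L + (K + 2 * (real L)\<^sup>2) / real n + (real L)\<^sup>2 / sqrt (real n)" for L n
  have \<delta>_lim: "\<delta> L \<longlonglongrightarrow> K / real L" for L
    unfolding \<delta>_def by real_asymp
  have small: "\<exists>L\<ge>1. c * (K / real L) < \<epsilon>" if "0 < \<epsilon>" "0 \<le> c" for \<epsilon> c :: real
  proof -
    obtain L :: nat where L: "c * K / \<epsilon> < real L" using reals_Archimedean2 by blast
    have "0 \<le> c * K / \<epsilon>" using that K(1) by simp
    then have "0 < real L" using L by linarith
    then have "c * K / real L < \<epsilon>" using L that by (simp add: field_simps)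
    then show ?thesis using \<open>0 < real L\<close> by (intro exI[of _ L]) auto
  qed
  have "(\<forall>L\<ge>1. \<bar>growth q - mean_rate q L\<bar> \<le> K / real L) \<and> mean_rate q \<longlonglongrightarrow> growth q \<and>
    (\<lambda>n. E q n (\<lambda>P. \<bar>log_stab 0 n P / real n - growth q\<bar>)) \<longlonglongrightarrow> 0" if q: "0 < q" "q \<le> q1" for q
  proof -
    have dev: "E q n (\<lambda>P. \<bar>log_stab 0 n P / real n - mean_rate q L\<bar>) \<le> \<delta> L n" if "1 \<le> L" "1 \<le> n" for L n
      unfolding mean_rate_def \<delta>_def using K(2) q t(3) that by (intro E_mean_deviation) auto
    have md: "\<bar>mean_rate q n - mean_rate q L\<bar> \<le> \<delta> L n" if "1 \<le> L" "1 \<le> n" for L n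
    proof -
      have "mean_rate q n = E q n (\<lambda>P. log_stab 0 n P / real n)" by (simp add: mean_rate_def)
      then show ?thesis using abs_E_diff_le[OF q(1), of n "\<lambda>P. log_stab 0 n P / real n" "mean_rate q L"] dev[OF that] by simp
    qed
    have "Cauchy (mean_rate q)"
    proof (rule metric_CauchyI)
      fix \<epsilon> :: real assume \<epsilon>: "0 < \<epsilon>"
      obtain L where L: "1 \<le> L" "1 * (K / real L) < \<epsilon> / 2" using small[of "\<epsilon> / 2" 1] \<epsilon> by auto
      have "eventually (\<lambda>n. \<delta> L n < \<epsilon> / 2) sequentially"
        by (rule order_tendstoD(2)[OF \<delta>_lim]) (use L in linarith)
      then obtain N where N: "\<And>n. N \<le> n \<Longrightarrow> \<delta> L n < \<epsilon> / 2" by (auto simp: eventually_sequentially)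
      have "dist (mean_rate q m) (mean_rate q n) < \<epsilon>" if "max 1 N \<le> m" "max 1 N \<le> n" for m n
      proof -
        have "\<bar>mean_rate q m - mean_rate q L\<bar> < \<epsilon> / 2" "\<bar>mean_rate q n - mean_rate q L\<bar> < \<epsilon> / 2"
          using md[OF L(1), of m] md[OF L(1), of n] N[of m] N[of n] that by auto
        then show ?thesis unfolding dist_real_def by linarith
      qed
      then show "\<exists>N. \<forall>m\<ge>N. \<forall>n\<ge>N. dist (mean_rate q m) (mean_rate q n) < \<epsilon>" by blast
    qed
    then have lim: "mean_rate q \<longlonglongrightarrow> growth q"
      unfolding growth_def by (simp add: Cauchy_convergent_iff convergent_LIMSEQ_iff)
    have bound: "\<bar>growth q - mean_rate q L\<bar> \<le> K / real L" if L: "1 \<le> L" for L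
    proof (rule tendsto_le[OF sequentially_bot \<delta>_lim])
      show "(\<lambda>n. \<bar>mean_rate q n - mean_rate q L\<bar>) \<longlonglongrightarrow> \<bar>growth q - mean_rate q L\<bar>" by (intro tendsto_intros lim)
      show "eventually (\<lambda>n. \<bar>mean_rate q n - mean_rate q L\<bar> \<le> \<delta> L n) sequentially"
        using md[OF L] by (auto simp: eventually_sequentially)
    qed
    have "(\<lambda>n. E q n (\<lambda>P. \<bar>log_stab 0 n P / real n - growth q\<bar>)) \<longlonglongrightarrow> 0"
    proof (rule LIMSEQ_I)
      fix \<epsilon> :: real assume \<epsilon>: "0 < \<epsilon>"
      obtain L where L: "1 \<le> L" "2 * (K / real L) < \<epsilon>" using small[of \<epsilon> 2] \<epsilon> by auto
      have "eventually (\<lambda>n. \<delta> L n < \<epsilon> - K / real L) sequentially"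
        by (rule order_tendstoD(2)[OF \<delta>_lim]) (use L in linarith)
      then obtain N where N: "\<And>n. N \<le> n \<Longrightarrow> \<delta> L n < \<epsilon> - K / real L" by (auto simp: eventually_sequentially)
      have "norm (E q n (\<lambda>P. \<bar>log_stab 0 n P / real n - growth q\<bar>) - 0) < \<epsilon>" if n: "max 1 N \<le> n" for n
      proof -
        have "E q n (\<lambda>P. \<bar>log_stab 0 n P / real n - growth q\<bar>) \<le>
            E q n (\<lambda>P. \<bar>log_stab 0 n P / real n - mean_rate q L\<bar> + K / real L)"
          using bound[OF L(1)] by (intro E_mono[OF q(1)]) linarith
        also have "\<dots> = E q n (\<lambda>P. \<bar>log_stab 0 n P / real n - mean_rate q L\<bar>) + K / real L"
          by (simp add: integrable_MalPref[OF q(1)])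
        also have "\<dots> < \<epsilon>" using dev[OF L(1), of n] N[of n] n by simp
        finally show ?thesis by (simp add: integral_nonneg_AE)
      qed
      then show "\<exists>N. \<forall>n\<ge>N. norm (E q n (\<lambda>P. \<bar>log_stab 0 n P / real n - growth q\<bar>) - 0) < \<epsilon>" by blast
    qed
    with lim bound show ?thesis by blast
  qed
  then show ?thesis using K(1) by blast
qed

lemma E_formula:
  assumes q: "0 < q"
  shows "E q n f = (\<Sum>P\<in>PiE_dflt (Omega n) id (\<lambda>_. perms n).
    f P * (\<Prod>x\<in>Omega n. q ^ inv_count n (P x) / weight q n (\<lambda>_. True)))"
proof -
  have "E q n f = (\<Sum>P\<in>PiE_dflt (Omega n) id (\<lambda>_. perms n). f P * pmf (MalPref q n) P)"
    by (rule integral_measure_pmf_real) (auto simp: set_MalPref[OF q])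
  also have "\<dots> = (\<Sum>P\<in>PiE_dflt (Omega n) id (\<lambda>_. perms n).
    f P * (\<Prod>x\<in>Omega n. q ^ inv_count n (P x) / weight q n (\<lambda>_. True)))"
  proof (intro sum.cong refl arg_cong2[where f = "(*)"])
    fix P assume P: "P \<in> PiE_dflt (Omega n) id (\<lambda>_. perms n)"
    have "pmf (MalPref q n) P = (\<Prod>x\<in>Omega n. pmf (Mal q n) (P x))"
      unfolding MalPref_def by (rule pmf_Pi') (use P in \<open>auto simp: PiE_dflt_def\<close>)
    also have "\<dots> = (\<Prod>x\<in>Omega n. q ^ inv_count n (P x) / weight q n (\<lambda>_. True))"
      by (intro prod.cong refl) (use P in \<open>simp add: PiE_dflt_def pmf_Mal[OF q] weight_True del: split_paired_All\<close>)
    finally show "pmf (MalPref q n) P = \<dots>" .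
  qed
  finally show ?thesis .
qed

lemma continuous_on_mean_rate: "continuous_on {0<..<1} (\<lambda>q. mean_rate q n)"
proof -
  have "continuous_on {0<..<1} (\<lambda>q. (\<Sum>P\<in>PiE_dflt (Omega n) id (\<lambda>_. perms n).
    log_stab 0 n P * (\<Prod>x\<in>Omega n. q ^ inv_count n (P x) / (\<Sum>\<pi>\<in>perms n. q ^ inv_count n \<pi>))) * (1 / real n))"
    by (intro continuous_intros) (use Mal_normaliser_pos in \<open>force simp: less_le\<close>)
  then show ?thesis
    by (rule continuous_on_cong[THEN iffD1, rotated -1]) (auto simp: mean_rate_def E_formula weight_True)
qed

text \<open>
  A locally uniform limit of rational functions of \<open>q\<close>.
\<close>

theorem continuous_on_growth: "continuous_on {0<..<1} growth"
proof -
  have "continuous (at q0) growth" if q0: "q0 \<in> {0<..<1}" for q0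
  proof -
    define q1 where "q1 = (q0 + 1) / 2"
    have q1: "0 < q1" "q1 < 1" "q0 < q1" using q0 by (auto simp: q1_def)
    obtain K where K: "\<And>q L. 0 < q \<Longrightarrow> q \<le> q1 \<Longrightarrow> 1 \<le> L \<Longrightarrow> \<bar>growth q - mean_rate q L\<bar> \<le> K / real L"
      using growth_limits[OF q1(1,2)] by metis
    have "uniform_limit {0<..<q1} (\<lambda>L q. mean_rate q L) growth sequentially"
    proof (rule uniform_limitI)
      fix \<epsilon> :: real assume "0 < \<epsilon>"
      moreover have "(\<lambda>L. K / real L) \<longlonglongrightarrow> 0" by real_asymp
      ultimately have "eventually (\<lambda>L. K / real L < \<epsilon>) sequentially" by (intro order_tendstoD) auto
      then show "\<forall>\<^sub>F L in sequentially. \<forall>q\<in>{0<..<q1}. dist (mean_rate q L) (growth q) < \<epsilon>"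
        using eventually_ge_at_top[of 1]
      proof eventually_elim
        case (elim L)
        show ?case
        proof
          fix q assume "q \<in> {0<..<q1}"
          then have "\<bar>growth q - mean_rate q L\<bar> \<le> K / real L" using elim by (intro K) auto
          then show "dist (mean_rate q L) (growth q) < \<epsilon>" using elim unfolding dist_real_def by linarith
        qed
      qed
    qed
    then have "continuous_on {0<..<q1} growth"
      by (rule uniform_limit_theorem[rotated])
        (auto intro!: always_eventually continuous_on_subset[OF continuous_on_mean_rate] simp: less_trans[OF _ q1(2)])
    then show ?thesis using q0 q1 by (simp add: continuous_on_eq_continuous_at)
  qed
  then show ?thesis by (simp add: continuous_on_eq_continuous_at)
qed

lemma perms_no_inversion:
  assumes \<pi>: "\<pi> \<in> perms n" and z: "inv_count n \<pi> = 0"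
  shows "\<pi> = id"
proof -
  let ?S = "{(i, j). 1 \<le> i \<and> i < j \<and> j \<le> n \<and> \<pi> i > \<pi> j}"
  have "finite ?S" by (rule finite_subset[of _ "{1..n} \<times> {1..n}"]) auto
  then have S: "?S = {}" using z by (simp add: inv_count_def)
  have inc: "\<pi> i \<le> \<pi> j" if "1 \<le> i" "i \<le> j" "j \<le> n" for i j
  proof (rule ccontr)
    assume n: "\<not> \<pi> i \<le> \<pi> j"
    then have "i \<noteq> j" by auto
    then have "(i, j) \<in> ?S" using that n by simp
    then show False unfolding S by simp
  qed
  have inj: "inj_on \<pi> S" for S using perms_inj[OF \<pi>] by (rule inj_on_subset) simp
  have "\<pi> i = i" for i
  proof (cases "i \<in> {1..n}")
    case True
    have "\<pi> ` {1..i} \<subseteq> {1..\<pi> i}" using inc True perms_range[OF \<pi>] by fastforce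
    then have 1: "card {1..i} \<le> card {1..\<pi> i}" by (intro card_inj_on_le[OF inj]) auto
    have "\<pi> ` {i..n} \<subseteq> {\<pi> i..n}" using inc True perms_range[OF \<pi>] by fastforce
    then have "card {i..n} \<le> card {\<pi> i..n}" by (intro card_inj_on_le[OF inj]) auto
    with 1 True perms_range[OF \<pi>, of i] show ?thesis by simp
  qed (use permsD[OF \<pi>] in \<open>auto simp: permutes_def\<close>)
  then show ?thesis by auto
qed

text \<open>
  Unless all rankings are the identity, in which case there is just one stable matching, some
  ranking has an inversion, which costs a factor \<open>q\<close>. The constant may depend on \<open>n\<close>.
\<close>

lemma E_log_stab_le_linear: "\<exists>C. \<forall>q. 0 < q \<and> q \<le> 1 \<longrightarrow> E q n (log_stab 0 n) \<le> C * q"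
proof -
  let ?PP = "PiE_dflt (Omega n) id (\<lambda>_. perms n)"
  define C where "C = (\<Sum>P\<in>?PP. log_stab 0 n P)"
  have "E q n (log_stab 0 n) \<le> C * q" if q: "0 < q" "q \<le> 1" for q
  proof -
    define W where "W P x = q ^ inv_count n (P x) / weight q n (\<lambda>_. True)" for P :: pref and x
    have id0: "inv_count n id = 0"
    proof -
      have "{(i, j). 1 \<le> i \<and> i < j \<and> j \<le> n \<and> id i > id j} = {}" by auto
      then show ?thesis unfolding inv_count_def by (simp only: card.empty)
    qed
    have "q ^ inv_count n id \<le> (\<Sum>\<pi>\<in>perms n. q ^ inv_count n \<pi>)" by (rule member_le_sum[OF id_in_perms]) (use q in auto)
    then have Z: "1 \<le> weight q n (\<lambda>_. True)" unfolding weight_True id0 by simp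
    have W0: "0 \<le> W P x" for P x using q Z by (simp add: W_def)
    have Wle: "W P x \<le> q ^ inv_count n (P x)" for P x
      unfolding W_def using q Z mult_left_mono[OF Z, of "q ^ inv_count n (P x)"] by (simp add: divide_le_eq)
    have "E q n (log_stab 0 n) = (\<Sum>P\<in>?PP. log_stab 0 n P * (\<Prod>x\<in>Omega n. W P x))"
      unfolding W_def by (rule E_formula[OF q(1)])
    also have "\<dots> \<le> (\<Sum>P\<in>?PP. log_stab 0 n P * q)"
    proof (rule sum_mono)
      fix P assume P: "P \<in> ?PP"
      show "log_stab 0 n P * (\<Prod>x\<in>Omega n. W P x) \<le> log_stab 0 n P * q"
      proof (cases "\<forall>x\<in>Omega n. P x = id")
        case True
        have "strict_pref P" by (rule MalPref_strict_pref[OF q(1), of P n]) (use P in \<open>simp add: set_MalPref[OF q(1)]\<close>)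
        then have "log_stab 0 n P = 0" using True by (intro log_stab_identity) auto
        then show ?thesis by simp
      next
        case False
        then obtain y where y: "y \<in> Omega n" "P y \<noteq> id" by blast
        have "P y \<in> perms n" using P y by (simp add: PiE_dflt_def del: split_paired_All)
        then have "1 \<le> inv_count n (P y)" using perms_no_inversion y by (metis less_one not_le)
        then have Wy: "W P y \<le> q" using Wle[of P y] power_decreasing[of 1 "inv_count n (P y)" q] q by simp
        have W1: "W P x \<le> 1" for x using Wle[of P x] power_le_one[of q "inv_count n (P x)"] q by linarith
        have "(\<Prod>x\<in>Omega n. W P x) = W P y * (\<Prod>x\<in>Omega n - {y}. W P x)"
          by (rule prod.remove) (use y in auto)
        also have "\<dots> \<le> q * 1" using Wy W0 W1 q by (intro mult_mono prod_le_1 prod_nonneg) auto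
        finally show ?thesis using log_stab_nonneg[of 0 n P] by (simp add: mult_left_mono)
      qed
    qed
    finally show ?thesis by (simp add: C_def sum_distrib_right)
  qed
  then show ?thesis by blast
qed

theorem growth_at_0: "(growth \<longlongrightarrow> 0) (at_right 0)"
proof (rule tendstoI)
  fix \<epsilon> :: real assume \<epsilon>: "0 < \<epsilon>"
  obtain K where K: "0 \<le> K" "\<And>q L. 0 < q \<Longrightarrow> q \<le> 1 / 2 \<Longrightarrow> 1 \<le> L \<Longrightarrow> \<bar>growth q - mean_rate q L\<bar> \<le> K / real L"
    using growth_limits[of "1 / 2"] by auto
  have "(\<lambda>L. K / real L) \<longlonglongrightarrow> 0" by real_asymp
  then have "eventually (\<lambda>L. K / real L < \<epsilon> / 2 \<and> 1 \<le> L) sequentially"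
    using \<epsilon> by (intro eventually_conj order_tendstoD(2) eventually_ge_at_top) auto
  then obtain L where L: "K / real L < \<epsilon> / 2" "1 \<le> L" by (auto simp: eventually_sequentially)
  obtain C where C: "\<And>q. 0 < q \<Longrightarrow> q \<le> 1 \<Longrightarrow> E q L (log_stab 0 L) \<le> C * q" using E_log_stab_le_linear[of L] by blast
  have "((\<lambda>q. C * q / real L) \<longlongrightarrow> C * 0 / real L) (at_right 0)" using L by (intro tendsto_intros) auto
  then have "eventually (\<lambda>q. C * q / real L < \<epsilon> / 2) (at_right 0)" using \<epsilon> by (intro order_tendstoD(2)) auto
  moreover have "eventually (\<lambda>q::real. q \<in> {0<..<1 / 2}) (at_right 0)" by (rule eventually_at_right_real) simp
  ultimately show "eventually (\<lambda>q. dist (growth q) 0 < \<epsilon>) (at_right 0)"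
  proof eventually_elim
    case (elim q)
    then have q: "0 < q" "q \<le> 1 / 2" by auto
    have "mean_rate q L \<le> C * q / real L" unfolding mean_rate_def using C[of q] q by (intro divide_right_mono) auto
    moreover have "0 \<le> mean_rate q L" unfolding mean_rate_def using E_log_stab_bounds(1)[OF q(1)] by simp
    ultimately show ?case using K(2)[OF q L(2)] L(1) elim(1) unfolding dist_real_def by linarith
  qed
qed

section \<open>Positivity of the growth rate\<close>

text \<open>
  What \<open>gadget s\<close> asks of the single person \<open>x\<close>; for persons outside the gadget it is nothing.
\<close>

definition gadget_role :: "nat \<Rightarrow> person \<Rightarrow> (nat \<Rightarrow> nat) \<Rightarrow> bool" where
  "gadget_role s x \<pi> \<longleftrightarrow> fst x \<in> {s + 1, s + 2} \<longrightarrow> top_pair s \<pi> \<and>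
     (if (fst x = s + 1) = (snd x = Man) then \<pi> (s + 1) < \<pi> (s + 2) else \<pi> (s + 2) < \<pi> (s + 1))"

lemma gadget_if_roles:
  assumes "s + 2 \<le> n" "\<forall>x\<in>Omega n. gadget_role s x (P x)"
  shows "gadget s P"
proof -
  have r: "gadget_role s (i, g) (P (i, g))" if "i \<in> {s + 1, s + 2}" for i g
    using assms that by (auto simp: Omega_def)
  have "top_pair s (P (i, g))" if "i \<in> {s + 1, s + 2}" for i g
    using r[OF that, of g] that unfolding gadget_role_def fst_conv by blast
  moreover have "P (s + 1, Man) (s + 1) < P (s + 1, Man) (s + 2)" "P (s + 2, Man) (s + 2) < P (s + 2, Man) (s + 1)"
    "P (s + 1, Woman) (s + 2) < P (s + 1, Woman) (s + 1)" "P (s + 2, Woman) (s + 1) < P (s + 2, Woman) (s + 2)"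
    using r[of "s + 1" Man] r[of "s + 2" Man] r[of "s + 1" Woman] r[of "s + 2" Woman]
    by (simp_all add: gadget_role_def)
  ultimately show ?thesis unfolding gadget_def top_pair_def by blast
qed

lemma Pr_gadget:
  assumes q: "0 < q" "q < 1" and s: "s + 2 \<le> n"
  shows "(q * \<kappa> q 2) ^ 4 \<le> Pr q n (gadget s)"
proof -
  let ?X = "{s + 1, s + 2} \<times> (UNIV :: gender set)"
  let ?c = "q * \<kappa> q 2"
  have c: "0 \<le> ?c" "?c \<le> \<kappa> q 2" using q \<kappa>_pos[OF q(2), of 2] by (auto intro: mult_right_le_one_le mult_left_le_one_le)
  have "?c \<le> measure_pmf.prob (Mal q n) {\<pi>. gadget_role s x \<pi>}" if "x \<in> ?X" for x
  proof (cases "(fst x = s + 1) = (snd x = Man)")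
    case True
    then have "{\<pi>. gadget_role s x \<pi>} = {\<pi>. top_pair s \<pi> \<and> \<pi> (s + 1) < \<pi> (s + 2)}"
      using that by (auto simp: gadget_role_def)
    then show ?thesis using prob_top_pair_inc[OF q s] c by simp
  next
    case False
    then have "{\<pi>. gadget_role s x \<pi>} = {\<pi>. top_pair s \<pi> \<and> \<pi> (s + 2) < \<pi> (s + 1)}"
      using that by (auto simp: gadget_role_def)
    then show ?thesis using prob_top_pair_dec[OF q s] by simp
  qed
  then have "(\<Prod>x\<in>?X. ?c) \<le> (\<Prod>x\<in>?X. measure_pmf.prob (Mal q n) {\<pi>. gadget_role s x \<pi>})"
    using c by (intro prod_mono) auto
  also have "\<dots> = (\<Prod>x\<in>Omega n. measure_pmf.prob (Mal q n) {\<pi>. gadget_role s x \<pi>})"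
  proof (rule prod.mono_neutral_left[OF finite_Omega])
    show "?X \<subseteq> Omega n" using s by (auto simp: Omega_def)
    show "\<forall>x\<in>Omega n - ?X. measure_pmf.prob (Mal q n) {\<pi>. gadget_role s x \<pi>} = 1"
    proof
      fix x assume "x \<in> Omega n - ?X"
      then have "fst x \<notin> {s + 1, s + 2}" by (cases x) auto
      then have "{\<pi>. gadget_role s x \<pi>} = UNIV" unfolding gadget_role_def by blast
      then show "measure_pmf.prob (Mal q n) {\<pi>. gadget_role s x \<pi>} = 1" by simp
    qed
  qed
  also have "\<dots> = Pr q n (\<lambda>P. \<forall>x\<in>Omega n. gadget_role s x (P x))" by (rule Pr_all[symmetric])
  also have "\<dots> \<le> Pr q n (gadget s)"
    by (intro measure_pmf.finite_measure_mono) (use gadget_if_roles[OF s] in auto)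
  also have "(\<Prod>x\<in>?X. ?c) = ?c ^ card ?X" by (rule prod_constant)
  also have "card ?X = 4" by (simp add: card_cartesian_product UNIV_gender)
  finally show ?thesis .
qed

lemma depends_on_gadget: "depends_on ({s + 1, s + 2} \<times> UNIV) (gadget s)"
  unfolding depends_on_def gadget_def by simp

text \<open>
  A calm level and a gadget directly below it involve disjoint sets of persons, so they
  occur together with a probability bounded away from zero at every even level. A positive
  proportion of the levels thus contributes \<open>ln 2\<close> to the mean.
\<close>

theorem growth_pos:
  assumes q: "0 < q" "q < 1"
  shows "0 < growth q"
proof -
  define t where "t = root 32 q"
  have t: "0 < t" "t < 1" "t ^ 32 = q" using q by (auto simp: t_def real_root_pow_pos)
  obtain p where p: "0 < p" "\<And>n c. p \<le> Pr q n (calm_above n c)"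
    using Pr_calm_above[OF t(1,2)] q(1) t(3) by blast
  define g where "g = (q * \<kappa> q 2) ^ 4"
  have g: "0 < g" using q \<kappa>_pos[of q 2] by (simp add: g_def)
  have both: "p * g \<le> Pr q n (\<lambda>P. calm_above n (2 * k + 2) P \<and> gadget (2 * k) P)" if k: "2 * k + 2 \<le> n" for n k
  proof -
    have "Pr q n (\<lambda>P. calm_above n (2 * k + 2) P \<and> gadget (2 * k) P) = Pr q n (calm_above n (2 * k + 2)) * Pr q n (gadget (2 * k))"
      by (rule Pr_indep[OF q(1) _ depends_on_calm_above depends_on_gadget]) (auto simp: Omega_def)
    also have "\<dots> \<ge> p * g"
      using p g Pr_gadget[OF q k] by (intro mult_mono) (auto simp: g_def)
    finally show ?thesis .
  qed
  have "ln 2 * (p * g) / 3 \<le> mean_rate q n" if n: "2 \<le> n" for n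
  proof -
    define A where "A k P \<longleftrightarrow> calm_above n (2 * k + 2) P \<and> gadget (2 * k) P" for k P
    have card_eq: "real (card {k. 2 * k + 2 \<le> n \<and> A k P}) = (\<Sum>k<n div 2. of_bool (A k P))" for P
    proof -
      have "{k. 2 * k + 2 \<le> n \<and> A k P} = {k \<in> {..<n div 2}. A k P}" by auto
      then show ?thesis by (simp add: sum.If_cases of_bool_def Int_def)
    qed
    have "ln 2 * (real (n div 2) * (p * g)) \<le> ln 2 * (\<Sum>k<n div 2. Pr q n (A k))"
    proof (intro mult_left_mono)
      have "real (n div 2) * (p * g) = (\<Sum>k<n div 2. p * g)" by simp
      also have "\<dots> \<le> (\<Sum>k<n div 2. Pr q n (A k))"
        unfolding A_def by (intro sum_mono both) auto
      finally show "real (n div 2) * (p * g) \<le> (\<Sum>k<n div 2. Pr q n (A k))" .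
    qed simp
    also have "\<dots> = E q n (\<lambda>P. ln 2 * real (card {k. 2 * k + 2 \<le> n \<and> A k P}))"
      unfolding card_eq Pr_eq_E
      by (simp only: integral_mult_right_zero Bochner_Integration.integral_sum integrable_MalPref[OF q(1)])
    also have "\<dots> \<le> E q n (log_stab 0 n)"
      unfolding A_def by (rule E_mono[OF q(1)]) (intro log_stab_ge_gadgets[OF MalPref_strict_pref[OF q(1)]] order_refl)
    finally have "ln 2 * (real (n div 2) * (p * g)) \<le> E q n (log_stab 0 n)" .
    moreover have "ln 2 * (real n / 3 * (p * g)) \<le> ln 2 * (real (n div 2) * (p * g))"
    proof (intro mult_left_mono mult_right_mono)
      \<comment> \<open>The crude factor \<open>3\<close> covers odd \<open>n\<close>.\<close>
      have "n \<le> 3 * (n div 2)" using n by presburger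
      then have "real n \<le> real (3 * (n div 2))" by (simp only: of_nat_le_iff)
      then show "real n / 3 \<le> real (n div 2)" by simp
    qed (use p(1) g in auto)
    ultimately show ?thesis using n unfolding mean_rate_def by (simp add: le_divide_eq mult_ac)
  qed
  moreover have "mean_rate q \<longlonglongrightarrow> growth q" using growth_limits[OF q] q by blast
  ultimately have "ln 2 * (p * g) / 3 \<le> growth q" by (intro LIMSEQ_le_const) auto
  moreover have "0 < ln 2 * (p * g) / 3" using p(1) g by simp
  ultimately show ?thesis by linarith
qed

section \<open>Convergence in distribution\<close>

lemma prob_deviation_le:
  assumes q: "0 < q" and d: "0 < d" and A: "\<And>P. A P \<Longrightarrow> d \<le> \<bar>f P - c\<bar>"
  shows "Pr q n A \<le> E q n (\<lambda>P. \<bar>f P - c\<bar>) / d"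
proof -
  have "Pr q n A \<le> E q n (\<lambda>P. \<bar>f P - c\<bar> / d)"
    unfolding Pr_eq_E by (rule E_mono[OF q]) (use A d in \<open>auto simp: le_divide_eq\<close>)
  then show ?thesis by simp
qed

text \<open>
  Convergence in mean to a constant, by Markov's inequality. The distribution function of the
  constant is discontinuous at \<open>c\<close>, so that only the points \<open>x \<noteq> c\<close> matter.
\<close>

theorem weak_conv_to_constant:
  assumes q: "0 < q" and lim: "(\<lambda>n. E q n (\<lambda>P. \<bar>Y n P - c\<bar>)) \<longlonglongrightarrow> 0"
  shows "weak_conv_m (\<lambda>n. distr (measure_pmf (MalPref q n)) borel (Y n)) (return borel c)"
  unfolding weak_conv_m_def weak_conv_def
proof (intro allI impI)
  fix x assume cont: "isCont (cdf (return borel c)) x"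
  interpret R: real_distribution "return borel c"
    by (auto simp: real_distribution_def real_distribution_axioms_def prob_space_return)
  have "x \<noteq> c"
  proof
    assume "x = c"
    then show False using cont R.isCont_cdf[of x] by (simp add: measure_return)
  qed
  have cdf_n: "cdf (distr (measure_pmf (MalPref q n)) borel (Y n)) x = Pr q n (\<lambda>P. Y n P \<le> x)" for n
    by (simp add: cdf_def measure_distr vimage_def)
  have cdf_c: "cdf (return borel c) x = of_bool (c \<le> x)"
    by (simp add: cdf_def measure_return)
  show "(\<lambda>n. cdf (distr (measure_pmf (MalPref q n)) borel (Y n)) x) \<longlonglongrightarrow> cdf (return borel c) x"
  proof (cases "x < c")
    case True
    have "(\<lambda>n. Pr q n (\<lambda>P. Y n P \<le> x)) \<longlonglongrightarrow> 0"
    proof (rule tendsto_sandwich[OF _ _ tendsto_const])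
      show "(\<lambda>n. E q n (\<lambda>P. \<bar>Y n P - c\<bar>) / (c - x)) \<longlonglongrightarrow> 0"
        using tendsto_divide_zero[OF lim] .
      show "eventually (\<lambda>n. Pr q n (\<lambda>P. Y n P \<le> x) \<le> E q n (\<lambda>P. \<bar>Y n P - c\<bar>) / (c - x)) sequentially"
        using True by (intro always_eventually allI prob_deviation_le[OF q]) auto
    qed simp
    then show ?thesis using True unfolding cdf_n cdf_c by simp
  next
    case False
    then have xc: "c < x" using \<open>x \<noteq> c\<close> by simp
    have "(\<lambda>n. Pr q n (\<lambda>P. x < Y n P)) \<longlonglongrightarrow> 0"
    proof (rule tendsto_sandwich[OF _ _ tendsto_const])
      show "(\<lambda>n. E q n (\<lambda>P. \<bar>Y n P - c\<bar>) / (x - c)) \<longlonglongrightarrow> 0"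
        using tendsto_divide_zero[OF lim] .
      show "eventually (\<lambda>n. Pr q n (\<lambda>P. x < Y n P) \<le> E q n (\<lambda>P. \<bar>Y n P - c\<bar>) / (x - c)) sequentially"
        using xc by (intro always_eventually allI prob_deviation_le[OF q]) auto
    qed simp
    then have "(\<lambda>n. 1 - Pr q n (\<lambda>P. x < Y n P)) \<longlonglongrightarrow> 1 - 0" by (intro tendsto_intros)
    moreover have "Pr q n (\<lambda>P. Y n P \<le> x) = 1 - Pr q n (\<lambda>P. x < Y n P)" for n
    proof -
      have "{P. Y n P \<le> x} = UNIV - {P. x < Y n P}" by auto
      then show ?thesis using measure_pmf.prob_compl[of "{P. x < Y n P}" "MalPref q n"] by simp
    qed
    ultimately show ?thesis using xc unfolding cdf_n cdf_c by simp
  qed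
qed

theorem theorem1:
  shows "\<exists>gr :: real \<Rightarrow> real.
    (\<forall>q\<in>{0<..<1}. 0 < gr q \<and>
       weak_conv_m
         (\<lambda>n. distr (measure_pmf (MalPref q n)) borel
                (\<lambda>P. ln (real (card (StabMatch n P))) / real n))
         (return borel (gr q))) \<and>
    continuous_on {0<..<1} gr \<and>
    (gr \<longlongrightarrow> 0) (at_right 0)"
proof (intro exI conjI ballI)
  fix q :: real assume "q \<in> {0<..<1}"
  then have q: "0 < q" "q < 1" by auto
  show "0 < growth q" by (rule growth_pos[OF q])
  have "(\<lambda>n. E q n (\<lambda>P. \<bar>log_stab 0 n P / real n - growth q\<bar>)) \<longlonglongrightarrow> 0"
    using growth_limits[OF q] q by blast
  then show "weak_conv_m (\<lambda>n. distr (measure_pmf (MalPref q n)) borel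
      (\<lambda>P. ln (real (card (StabMatch n P))) / real n)) (return borel (growth q))"
    unfolding ln_card_StabMatch by (rule weak_conv_to_constant[OF q(1)])
qed (rule continuous_on_growth growth_at_0)+

end
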